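(* For each $n\ge 3$, the first resonance variety of the upper McCool group $P\Sigma_n^+$ decomposes into irreducible components as $$\mathcal R_1(P\Sigma_n^+)=\bigcup_{2\le j<i\le n}L_{ij},$$ where $L_{ij}$ is the $j$-dimensional linear subspace of $H^1(P\Sigma_n^+;\mathbb C)\cong\mathbb C^{\binom n2}$ defined by the equations $$\begin{cases}x_{i,l}+x_{j,l}=0 & \text{for } 1\le l\le j-1,\\ x_{i,l}=0 & \text{for } j+1\le l\le i-1,\\ x_{s,t}=0 & \text{for } s\ne i,\ s\ne j,\ 1\le t<s.\end{cases}$$ Moreover: (1) All the components are projectively disjoint, i.e., $L_{ij}\cap L_{st}=\{0\}$ if $(i,j)\ne(s,t)$. (2) The subspaces $L_{ij}$ are $0$-isotropic for $j=2$ and $\binom{j-1}{2}$-isotropic for $j\ge3$; i.e., the restriction of the cup-product map on $H^1(P\Sigma_n^+;\mathbb C)$ to $L_{ij}$ has rank $\binom{j-1}{2}$.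
   Context: Let $F_n=\langle x_1,\dots,x_n\rangle$ be the free group; for $1\le i\neq j\le n$ let $\alpha_{ij}\in\mathrm{Aut}(F_n)$ send $x_i\mapsto x_jx_ix_j^{-1}$ and fix the other generators. The upper McCool group $P\Sigma_n^+$ is the subgroup of $\mathrm{Aut}(F_n)$ generated by the $\alpha_{ij}$ with $i>j$; its first homology is free abelian on the classes of these generators. For $1\le j<i\le n$, $x_{i,j}$ denotes the coordinate function on $H^1(P\Sigma_n^+;\mathbb C)$ given by evaluation on the class of $\alpha_{ij}$. For a finitely generated group $G$ with $A^*=H^*(G;\mathbb C)$, the first resonance variety is $$\mathcal R_1(G)=\{a\in A^1\mid \exists\, b\in A^1,\ b\notin\mathbb C\cdot a,\ ab=0\in A^2\}.$$ A linear subspace $L\subseteq H^1(G;\mathbb C)$ is $p$-isotropic if the restriction of the cup-product map $H^1(G;\mathbb C)\wedge H^1(G;\mathbb C)\to H^2(G;\mathbb C)$ to $L\wedge L$ has rank $p$. *)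

theory Defs
  imports
    "HOL-Algebra.Bij"
    "HOL-Algebra.AbelCoset"
    "HOL-Algebra.Generated_Groups"
    "Jordan_Normal_Form.VS_Connect"
begin

section \<open>Free groups\<close>

text \<open>A letter \<open>(x, True)\<close> stands for the generator \<open>x\<close> and \<open>(x, False)\<close> for its inverse.
  Elements of the free group are the reduced words; \<open>cancel_cons\<close> multiplies a reduced word
  by a letter from the left.\<close>

type_synonym 'a word = "('a \<times> bool) list"

definition inv_letter :: "'a \<times> bool \<Rightarrow> 'a \<times> bool" where
  "inv_letter l = (fst l, \<not> snd l)"

definition reduced :: "'a word \<Rightarrow> bool" where
  "reduced w \<longleftrightarrow> successively (\<lambda>k l. l \<noteq> inv_letter k) w"

fun cancel_cons :: "'a \<times> bool \<Rightarrow> 'a word \<Rightarrow> 'a word" where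
  "cancel_cons l [] = [l]"
| "cancel_cons l (k # w) = (if k = inv_letter l then w else l # k # w)"

definition free_group :: "'a set \<Rightarrow> 'a word monoid" where
  "free_group X =
    \<lparr>carrier = {w. reduced w \<and> fst ` set w \<subseteq> X},
     mult = (\<lambda>u v. foldr cancel_cons u v),
     one = []\<rparr>"

definition free_gen :: "'a \<Rightarrow> 'a word" where
  "free_gen x = [(x, True)]"

text \<open>The homomorphism from a free group to \<open>H\<close> that sends each generator \<open>x\<close> to \<open>f x\<close>.\<close>

definition free_lift :: "('b, 'm) monoid_scheme \<Rightarrow> ('a \<Rightarrow> 'b) \<Rightarrow> 'a word \<Rightarrow> 'b" where
  "free_lift H f w =
    foldr (\<lambda>(x, s) h. (if s then f x else inv\<^bsub>H\<^esub> (f x)) \<otimes>\<^bsub>H\<^esub> h) w \<one>\<^bsub>H\<^esub>"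


section \<open>Upper McCool groups\<close>

abbreviation free_group_n :: "nat \<Rightarrow> nat word monoid" where
  "free_group_n n \<equiv> free_group {1..n}"

definition mccool_gen :: "nat \<Rightarrow> nat \<Rightarrow> nat \<Rightarrow> nat word \<Rightarrow> nat word" where
  "mccool_gen n i j = restrict
    (free_lift (free_group_n n)
      (\<lambda>k. if k = i
            then free_gen j \<otimes>\<^bsub>free_group_n n\<^esub> free_gen i \<otimes>\<^bsub>free_group_n n\<^esub> inv\<^bsub>free_group_n n\<^esub> (free_gen j)
            else free_gen k))
    (carrier (free_group_n n))"

definition upper_mccool :: "nat \<Rightarrow> (nat word \<Rightarrow> nat word) monoid" where
  "upper_mccool n = (AutoGroup (free_group_n n))
    \<lparr>carrier := generate (AutoGroup (free_group_n n))
      {mccool_gen n i j | i j. 1 \<le> j \<and> j < i \<and> i \<le> n}\<rparr>"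


section \<open>Complex vector spaces: quotients, dimension, Zariski topology\<close>

text \<open>The ring fields \<open>mult\<close> and \<open>one\<close> of the record play no role in a module. In
  \<open>smult\<close> the union runs over equal cosets.\<close>

definition quotient_space ::
    "(complex, 'v, 'm) module_scheme \<Rightarrow> 'v set \<Rightarrow> (complex, 'v set) module" where
  "quotient_space V W =
    \<lparr>carrier = a_rcosets\<^bsub>V\<^esub> W,
     mult = undefined,
     one = undefined,
     zero = W,
     add = (<+>\<^bsub>V\<^esub>),
     smult = (\<lambda>c X. \<Union>x\<in>X. W +>\<^bsub>V\<^esub> (c \<odot>\<^bsub>V\<^esub> x))\<rparr>"

text \<open>Finite-dimensionality is part of the definition, since \<^term>\<open>vectorspace.dim\<close> is
  unspecified for spaces of infinite dimension.\<close>

definition has_dimension :: "(complex, 'v, 'm) module_scheme \<Rightarrow> nat \<Rightarrow> bool" where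
  "has_dimension V d \<longleftrightarrow>
    vectorspace class_ring V \<and> vectorspace.fin_dim class_ring V \<and>
    vectorspace.dim class_ring V = d"

definition complex_line :: "(complex, complex) module" where
  "complex_line =
    \<lparr>carrier = UNIV, mult = (*), one = 1, zero = 0, add = (+), smult = (*)\<rparr>"

inductive_set polynomial_functions :: "(complex, 'v, 'm) module_scheme \<Rightarrow> ('v \<Rightarrow> complex) set"
  for V where
  const: "(\<lambda>_. c) \<in> polynomial_functions V"
| linear: "f \<in> LinearCombinations.module_hom class_ring V complex_line \<Longrightarrow> f \<in> polynomial_functions V"
| add: "f \<in> polynomial_functions V \<Longrightarrow> g \<in> polynomial_functions V \<Longrightarrow>
    (\<lambda>v. f v + g v) \<in> polynomial_functions V"
| mult: "f \<in> polynomial_functions V \<Longrightarrow> g \<in> polynomial_functions V \<Longrightarrow>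
    (\<lambda>v. f v * g v) \<in> polynomial_functions V"

definition zariski_closed :: "(complex, 'v, 'm) module_scheme \<Rightarrow> 'v set \<Rightarrow> bool" where
  "zariski_closed V Z \<longleftrightarrow>
    (\<exists>P \<subseteq> polynomial_functions V. Z = {v \<in> carrier V. \<forall>p\<in>P. p v = 0})"

definition zariski_irreducible :: "(complex, 'v, 'm) module_scheme \<Rightarrow> 'v set \<Rightarrow> bool" where
  "zariski_irreducible V S \<longleftrightarrow>
    S \<subseteq> carrier V \<and> S \<noteq> {} \<and>
    (\<forall>Y Z. zariski_closed V Y \<and> zariski_closed V Z \<and> S \<subseteq> Y \<union> Z \<longrightarrow> S \<subseteq> Y \<or> S \<subseteq> Z)"

definition irreducible_components ::
    "(complex, 'v, 'm) module_scheme \<Rightarrow> 'v set \<Rightarrow> 'v set set" where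
  "irreducible_components V R =
    {S. S \<subseteq> R \<and> zariski_irreducible V S \<and>
        (\<forall>T. T \<subseteq> R \<and> zariski_irreducible V T \<and> S \<subseteq> T \<longrightarrow> T = S)}"


section \<open>Group cohomology with trivial complex coefficients\<close>

text \<open>Inhomogeneous cochains, viewed as functions on lists of length \<open>p\<close> of group elements.\<close>

definition tuples :: "('a, 'm) monoid_scheme \<Rightarrow> nat \<Rightarrow> 'a list set" where
  "tuples G p = {gs. length gs = p \<and> set gs \<subseteq> carrier G}"

definition cochains ::
    "('a, 'm) monoid_scheme \<Rightarrow> nat \<Rightarrow> (complex, 'a list \<Rightarrow> complex) module" where
  "cochains G p = ring.func_space class_ring (tuples G p)"

definition coboundary ::
    "('a, 'm) monoid_scheme \<Rightarrow> nat \<Rightarrow> ('a list \<Rightarrow> complex) \<Rightarrow> 'a list \<Rightarrow> complex" where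
  "coboundary G p f = (\<lambda>gs \<in> tuples G (Suc p).
      f (tl gs)
      + (\<Sum>i<p. (-1) ^ Suc i * f (take i gs @ (gs ! i \<otimes>\<^bsub>G\<^esub> gs ! Suc i) # drop (i + 2) gs))
      + (-1) ^ Suc p * f (butlast gs))"

definition cocycles :: "('a, 'm) monoid_scheme \<Rightarrow> nat \<Rightarrow> ('a list \<Rightarrow> complex) set" where
  "cocycles G p =
    {f \<in> carrier (cochains G p). coboundary G p f = \<zero>\<^bsub>cochains G (Suc p)\<^esub>}"

fun coboundaries :: "('a, 'm) monoid_scheme \<Rightarrow> nat \<Rightarrow> ('a list \<Rightarrow> complex) set" where
  "coboundaries G 0 = {\<zero>\<^bsub>cochains G 0\<^esub>}"
| "coboundaries G (Suc p) = coboundary G p ` carrier (cochains G p)"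

definition cohomology ::
    "('a, 'm) monoid_scheme \<Rightarrow> nat \<Rightarrow> (complex, ('a list \<Rightarrow> complex) set) module" where
  "cohomology G p =
    quotient_space ((cochains G p)\<lparr>carrier := cocycles G p\<rparr>) (coboundaries G p)"

definition cochain_cup ::
    "('a, 'm) monoid_scheme \<Rightarrow> nat \<Rightarrow> nat \<Rightarrow> ('a list \<Rightarrow> complex) \<Rightarrow> ('a list \<Rightarrow> complex)
      \<Rightarrow> 'a list \<Rightarrow> complex" where
  "cochain_cup G p q f g = (\<lambda>gs \<in> tuples G (p + q). f (take p gs) * g (drop p gs))"

definition cup ::
    "('a, 'm) monoid_scheme \<Rightarrow> nat \<Rightarrow> nat \<Rightarrow> ('a list \<Rightarrow> complex) set \<Rightarrow> ('a list \<Rightarrow> complex) set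
      \<Rightarrow> ('a list \<Rightarrow> complex) set" where
  "cup G p q a b =
    (\<Union>f\<in>a. \<Union>g\<in>b. coboundaries G (p + q) +>\<^bsub>cochains G (p + q)\<^esub> cochain_cup G p q f g)"

text \<open>The value of a class in \<open>H\<^sup>1(G; \<complex>)\<close> on the homology class of \<open>g\<close>. It does not depend on the
  representing cocycle, because the coboundary of a 0-cochain vanishes.\<close>

definition eval1 :: "('a list \<Rightarrow> complex) set \<Rightarrow> 'a \<Rightarrow> complex" where
  "eval1 a g = the_elem ((\<lambda>f. f [g]) ` a)"


section \<open>Resonance and isotropic subspaces\<close>

definition resonance1 :: "('a, 'm) monoid_scheme \<Rightarrow> ('a list \<Rightarrow> complex) set set" where
  "resonance1 G =
    {a \<in> carrier (cohomology G 1).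
      \<exists>b \<in> carrier (cohomology G 1).
        b \<notin> range (\<lambda>c. c \<odot>\<^bsub>cohomology G 1\<^esub> a) \<and> cup G 1 1 a b = \<zero>\<^bsub>cohomology G 2\<^esub>}"

text \<open>The image of \<open>L \<and> L\<close> under the cup product is the span of the products of two
  elements of \<open>L\<close>, and the rank is the dimension of this image.\<close>

definition isotropic ::
    "('a, 'm) monoid_scheme \<Rightarrow> nat \<Rightarrow> ('a list \<Rightarrow> complex) set set \<Rightarrow> bool" where
  "isotropic G p L \<longleftrightarrow>
    VectorSpace.subspace class_ring L (cohomology G 1) \<and>
    has_dimension
      ((cohomology G 2)\<lparr>carrier :=
        LinearCombinations.module.span class_ring (cohomology G 2) {cup G 1 1 a b | a b. a \<in> L \<and> b \<in> L}\<rparr>) p"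


section \<open>Coordinates and the subspaces \<open>L\<^sub>i\<^sub>j\<close>\<close>

abbreviation H1_mccool ::
    "nat \<Rightarrow> (complex, ((nat word \<Rightarrow> nat word) list \<Rightarrow> complex) set) module" where
  "H1_mccool n \<equiv> cohomology (upper_mccool n) 1"

definition mccool_coord ::
    "nat \<Rightarrow> nat \<Rightarrow> nat \<Rightarrow> ((nat word \<Rightarrow> nat word) list \<Rightarrow> complex) set \<Rightarrow> complex" where
  "mccool_coord n i j a = eval1 a (mccool_gen n i j)"

definition L_space ::
    "nat \<Rightarrow> nat \<Rightarrow> nat \<Rightarrow> ((nat word \<Rightarrow> nat word) list \<Rightarrow> complex) set set" where
  "L_space n i j =
    {a \<in> carrier (H1_mccool n).
      (\<forall>l\<in>{1..j - 1}. mccool_coord n i l a + mccool_coord n j l a = 0) \<and>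
      (\<forall>l\<in>{j + 1..i - 1}. mccool_coord n i l a = 0) \<and>
      (\<forall>s\<in>{1..n}. \<forall>t. s \<noteq> i \<and> s \<noteq> j \<and> 1 \<le> t \<and> t < s \<longrightarrow> mccool_coord n s t a = 0)}"

end

theory Submission
  imports Defs
begin

text \<open>Every element of the upper McCool group sends \<open>x\<^sub>i\<close> to a conjugate \<open>w\<^sub>i x\<^sub>i w\<^sub>i\<^sup>-\<^sup>1\<close> with \<open>w\<^sub>i\<close> a word in
  \<open>x\<^sub>1, \<dots>, x\<^sub>i\<^sub>-\<^sub>1\<close>. The exponent sums \<open>u\<^sub>i\<^sub>j\<close> of \<open>x\<^sub>j\<close> in \<open>w\<^sub>i\<close> are homomorphisms dual to the generators, so they
  form a basis of \<open>H\<^sup>1\<close>. No presentation of the group is needed to compute the cup product. On the one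
  hand, the second order Magnus coefficients of \<open>w\<^sub>i\<close> give explicit 1-cochains that show
  \<open>(u\<^sub>i\<^sub>k - u\<^sub>j\<^sub>k) \<union> u\<^sub>i\<^sub>j = 0\<close> for \<open>k < j < i\<close>. On the other hand, for commuting \<open>g\<close> and \<open>h\<close> the map
  \<open>F \<mapsto> F(g, h) - F(h, g)\<close> is a well-defined linear form on \<open>H\<^sup>2\<close>, and McCool's relations provide
  enough commuting pairs to detect all other products. Hence \<open>a \<union> b = 0\<close> becomes the vanishing of
  certain \<open>2 \<times> 2\<close> minors of the coordinates of \<open>a\<close> and \<open>b\<close>: if \<open>a\<close> and \<open>b\<close> are independent, some minor
  at \<open>(i, j), (i, k)\<close> with \<open>k < j < i\<close> is nonzero, and all other coordinates are then forced to
  satisfy the equations of \<open>L\<^sub>i\<^sub>j\<close>.\<close>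

section \<open>Free groups\<close>

text \<open>The two computations of cup products work in opposite directions. Commuting pairs
  produce necessary conditions for \<open>a \<union> b = 0\<close>, and these alone force a resonant
  class into some \<open>L_ij\<close>. Magnus cochains produce vanishing products, and these show
  that \<open>u_ij\<close> annihilates all of \<open>L_ij\<close>, so that its elements are
  resonant. Both meet in the rank of the cup product on \<open>L_ij\<close>: vanishing bounds it
  from above, detection on commuting pairs from below. The shape of the components comes from a gap
  in the commuting pairs. For \<open>k < j < i\<close> the automorphisms \<alpha>_ij and \<alpha>_ik
  do not commute, and \<alpha>_ij commutes only with the product \<alpha>_ik \<alpha>_jk, which
  conjugates \<open>x_i\<close> and \<open>x_j\<close> simultaneously by \<open>x_k\<close>. So the
  minor at \<open>(i, j), (i, k)\<close> is constrained only through its sum with the minor at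
  \<open>(i, j), (j, k)\<close>, and may be nonzero. The condition \<open>j >= 2\<close> leaves room
  for such a \<open>k\<close>.\<close>

lemma inv_letter_simps [simp]:
  "inv_letter (x, s) = (x, \<not> s)"
  "inv_letter (inv_letter l) = l"
  "fst (inv_letter l) = fst l"
  "snd (inv_letter l) \<longleftrightarrow> \<not> snd l"
  by (simp_all add: inv_letter_def)

lemma reduced_Nil [simp]: "reduced []"
  by (simp add: reduced_def)

lemma reduced_Cons: "reduced (l # w) \<longleftrightarrow> (w = [] \<or> hd w \<noteq> inv_letter l) \<and> reduced w"
  by (cases w) (auto simp: reduced_def)

lemma reduced_cancel_cons: "reduced w \<Longrightarrow> reduced (cancel_cons l w)"
  by (cases w) (auto simp: reduced_Cons)

text \<open>If \<open>w\<close> begins with \<open>l\<close>, the inner step removes that letter and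
  exposes the next one; reducedness prevents \<open>l\<close> from cancelling against it. Hence the
  split of two letters.\<close>

lemma cancel_cons_inv:
  assumes "reduced w"
  shows "cancel_cons l (cancel_cons (inv_letter l) w) = w"
  using assms by (cases w rule: list.exhaust; cases "tl w") (auto simp: reduced_Cons)

lemma cancel_cons_reduced: "reduced (l # w) \<Longrightarrow> cancel_cons l w = l # w"
  by (cases w) (auto simp: reduced_Cons)

lemma reduced_foldr: "reduced v \<Longrightarrow> reduced (foldr cancel_cons u v)"
  by (induction u) (auto intro: reduced_cancel_cons)

lemma foldr_cancel_cons_Nil: "reduced u \<Longrightarrow> foldr cancel_cons u [] = u"
  by (induction u) (auto simp: reduced_Cons cancel_cons_reduced)

text \<open>The letterwise core of associativity. If \<open>l\<close> cancels the head of
  \<open>v\<close>, then on the right both letters act on the product of \<open>tl v\<close> with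
  \<open>w\<close>, where \<open>cancel_cons_inv\<close> removes them.\<close>

lemma foldr_cancel_cons_cons:
  assumes "reduced w"
  shows "foldr cancel_cons (cancel_cons l v) w = cancel_cons l (foldr cancel_cons v w)"
  using cancel_cons_inv[of "foldr cancel_cons (tl v) w" l] reduced_foldr[OF assms, of "tl v"]
  by (cases v) auto

lemma foldr_cancel_cons_assoc:
  assumes "reduced w"
  shows "foldr cancel_cons (foldr cancel_cons u v) w = foldr cancel_cons u (foldr cancel_cons v w)"
  by (induction u) (simp_all add: foldr_cancel_cons_cons[OF assms])

definition inv_word :: "'a word \<Rightarrow> 'a word" where
  "inv_word w = rev (map inv_letter w)"

lemma reduced_inv_word: "reduced w \<Longrightarrow> reduced (inv_word w)"
  by (auto simp: reduced_def inv_word_def successively_map successively_rev elim!: successively_mono)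

lemma foldr_inv_word:
  assumes "reduced v"
  shows "foldr cancel_cons (inv_word w) (foldr cancel_cons w v) = v"
  using assms
proof (induction w arbitrary: v)
  case (Cons l w)
  have "reduced (foldr cancel_cons w v)"
    using Cons.prems by (rule reduced_foldr)
  then show ?case
    using Cons cancel_cons_inv[of "foldr cancel_cons w v" "inv_letter l"]
    by (simp add: inv_word_def)
qed (simp add: inv_word_def)

lemma set_cancel_cons: "set (cancel_cons l w) \<subseteq> insert l (set w)"
  by (cases w) auto

lemma set_foldr_cancel_cons: "set (foldr cancel_cons u v) \<subseteq> set u \<union> set v"
  using set_cancel_cons by (induction u) fastforce+

lemma carrier_free_group: "w \<in> carrier (free_group X) \<longleftrightarrow> reduced w \<and> fst ` set w \<subseteq> X"
  by (simp add: free_group_def)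

lemma mult_free_group: "u \<otimes>\<^bsub>free_group X\<^esub> v = foldr cancel_cons u v"
  by (simp add: free_group_def)

lemma one_free_group [simp]: "\<one>\<^bsub>free_group X\<^esub> = []"
  by (simp add: free_group_def)

lemma mult_Nil_free_group [simp]:
  "[] \<otimes>\<^bsub>free_group X\<^esub> w = w"
  "w \<in> carrier (free_group X) \<Longrightarrow> w \<otimes>\<^bsub>free_group X\<^esub> [] = w"
  by (simp_all add: mult_free_group carrier_free_group foldr_cancel_cons_Nil)

lemma mult_free_group_closed:
  assumes "u \<in> carrier (free_group X)" "v \<in> carrier (free_group X)"
  shows "foldr cancel_cons u v \<in> carrier (free_group X)"
  using assms image_mono[OF set_foldr_cancel_cons[of u v], of fst] reduced_foldr[of v u]
  unfolding carrier_free_group image_Un by blast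

lemma inv_word_closed:
  assumes "w \<in> carrier (free_group X)"
  shows "inv_word w \<in> carrier (free_group X)"
  using assms reduced_inv_word[of w] by (auto simp: carrier_free_group inv_word_def image_subset_iff)

lemma group_free_group: "group (free_group X)"
proof (rule groupI)
  fix u assume u: "u \<in> carrier (free_group X)"
  show "\<exists>v\<in>carrier (free_group X). v \<otimes>\<^bsub>free_group X\<^esub> u = \<one>\<^bsub>free_group X\<^esub>"
    using u foldr_inv_word[of "[]" u] inv_word_closed[OF u]
    by (auto simp: mult_free_group carrier_free_group foldr_cancel_cons_Nil intro!: bexI[of _ "inv_word u"])
next
  fix u v w assume "w \<in> carrier (free_group X)"
  then show "u \<otimes>\<^bsub>free_group X\<^esub> v \<otimes>\<^bsub>free_group X\<^esub> w =
      u \<otimes>\<^bsub>free_group X\<^esub> (v \<otimes>\<^bsub>free_group X\<^esub> w)"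
    by (simp add: mult_free_group carrier_free_group foldr_cancel_cons_assoc)
qed (simp_all add: mult_free_group mult_free_group_closed, simp add: carrier_free_group)

lemma inv_free_group:
  assumes "w \<in> carrier (free_group X)"
  shows "inv\<^bsub>free_group X\<^esub> w = inv_word w"
proof -
  interpret group "free_group X" by (rule group_free_group)
  show ?thesis
    using assms foldr_inv_word[of "[]" w] inv_word_closed[OF assms]
    by (intro inv_equality)
      (auto simp: mult_free_group carrier_free_group foldr_cancel_cons_Nil)
qed

lemma free_gen_closed: "x \<in> X \<Longrightarrow> free_gen x \<in> carrier (free_group X)"
  by (simp add: carrier_free_group free_gen_def reduced_def)

lemma inv_free_gen: "x \<in> X \<Longrightarrow> inv\<^bsub>free_group X\<^esub> (free_gen x) = [(x, False)]"
  by (simp add: inv_free_group free_gen_closed) (simp add: inv_word_def free_gen_def)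

text \<open>Phrased with group multiplication instead of list construction, so that homomorphism
  laws apply directly in the induction steps. The two agree because prepending a letter to form a
  reduced word causes no cancellation.\<close>

lemma free_group_induct [consumes 1, case_names one gen inv_gen]:
  assumes "w \<in> carrier (free_group X)"
    and "P []"
    and "\<And>x w. x \<in> X \<Longrightarrow> w \<in> carrier (free_group X) \<Longrightarrow> P w \<Longrightarrow>
      P (free_gen x \<otimes>\<^bsub>free_group X\<^esub> w)"
    and "\<And>x w. x \<in> X \<Longrightarrow> w \<in> carrier (free_group X) \<Longrightarrow> P w \<Longrightarrow>
      P (inv\<^bsub>free_group X\<^esub> (free_gen x) \<otimes>\<^bsub>free_group X\<^esub> w)"
  shows "P w"
  using assms(1)
proof (induction w)
  case (Cons l w)
  obtain x s where l: "l = (x, s)" by force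
  have w: "w \<in> carrier (free_group X)" and x: "x \<in> X"
    using Cons.prems by (auto simp: carrier_free_group reduced_Cons l)
  have "l # w = cancel_cons l w"
    using Cons.prems by (simp add: carrier_free_group cancel_cons_reduced)
  then show ?case
    using assms(3)[OF x w] assms(4)[OF x w, unfolded inv_free_gen[OF x]] Cons.IH[OF w]
    by (cases s) (simp_all add: l mult_free_group free_gen_def)
qed (rule assms(2))

section \<open>Universal property of free groups\<close>

context group
begin

lemma free_lift_Nil [simp]: "free_lift G f [] = \<one>"
  by (simp add: free_lift_def)

lemma free_lift_Cons:
  "free_lift G f ((x, s) # w) = (if s then f x else inv (f x)) \<otimes> free_lift G f w"
  by (simp add: free_lift_def)

lemma free_lift_closed:
  "f \<in> X \<rightarrow> carrier G \<Longrightarrow> fst ` set w \<subseteq> X \<Longrightarrow> free_lift G f w \<in> carrier G"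
  by (induction w) (auto simp: free_lift_Cons Pi_iff)

lemma free_lift_cancel_cons:
  assumes f: "f \<in> X \<rightarrow> carrier G" and w: "fst ` set w \<subseteq> X" and x: "x \<in> X"
  shows "free_lift G f (cancel_cons (x, s) w) = (if s then f x else inv (f x)) \<otimes> free_lift G f w"
proof (cases w)
  case Nil
  then show ?thesis by (simp add: free_lift_Cons)
next
  case (Cons k v)
  have fx: "f x \<in> carrier G" and v: "free_lift G f v \<in> carrier G"
    using f x w free_lift_closed[OF f, of v] by (auto simp: Cons)
  have "f x \<otimes> (inv (f x) \<otimes> free_lift G f v) = free_lift G f v"
    "inv (f x) \<otimes> (f x \<otimes> free_lift G f v) = free_lift G f v"
    using fx v by (simp_all add: m_assoc[symmetric])
  then show ?thesis
    by (cases k) (auto simp: Cons free_lift_Cons)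
qed

lemma free_lift_hom:
  assumes f: "f \<in> X \<rightarrow> carrier G"
  shows "free_lift G f \<in> hom (free_group X) G"
proof (rule homI)
  fix u v
  assume u: "u \<in> carrier (free_group X)" and v: "v \<in> carrier (free_group X)"
  have "fst ` set u \<subseteq> X" "fst ` set v \<subseteq> X"
    using u v by (auto simp: carrier_free_group)
  then show "free_lift G f (u \<otimes>\<^bsub>free_group X\<^esub> v) = free_lift G f u \<otimes> free_lift G f v"
  proof (induction u)
    case (Cons l u)
    obtain x s where l: "l = (x, s)" by force
    have "fst ` set (foldr cancel_cons u v) \<subseteq> X"
      using set_foldr_cancel_cons[of u v] Cons.prems by fastforce
    then show ?case
      using Cons f free_lift_closed[OF f, of u] free_lift_closed[OF f, of v]
      by (auto simp: l mult_free_group free_lift_Cons free_lift_cancel_cons[OF f] m_assoc Pi_iff)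
  qed (auto simp: mult_free_group free_lift_closed[OF f])
qed (auto simp: carrier_free_group intro: free_lift_closed[OF f])

lemma free_lift_gen: "f x \<in> carrier G \<Longrightarrow> free_lift G f (free_gen x) = f x"
  by (simp add: free_gen_def free_lift_Cons)

end

lemma free_group_hom_eqI:
  assumes "group G" and g: "g \<in> hom (free_group X) G" and h: "h \<in> hom (free_group X) G"
    and eq: "\<And>x. x \<in> X \<Longrightarrow> g (free_gen x) = h (free_gen x)"
    and w: "w \<in> carrier (free_group X)"
  shows "g w = h w"
proof -
  interpret F: group "free_group X" by (rule group_free_group)
  interpret g: group_hom "free_group X" G g
    using assms(1) g by (simp add: group_hom_def group_hom_axioms_def F.group_axioms)
  interpret h: group_hom "free_group X" G h
    using assms(1) h by (simp add: group_hom_def group_hom_axioms_def F.group_axioms)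
  show ?thesis
    using w
  proof (induction rule: free_group_induct)
    case one
    then show ?case using g.hom_one h.hom_one by simp
  qed (simp_all add: free_gen_closed eq)
qed


declare One_nat_def [simp del]

section \<open>Magnus coefficients\<close>

text \<open>\<open>mag I w\<close> is the coefficient of the monomial \<open>X\<^sub>I\<close> in the image of \<open>w\<close> under the Magnus
  embedding \<open>x \<mapsto> 1 + X\<close>; the recursion for an inverse letter comes from
  \<open>(1 + X) (1 + X)\<^sup>-\<^sup>1 W = W\<close>.\<close>

fun mag :: "'a list \<Rightarrow> 'a word \<Rightarrow> int" where
  "mag [] w = 1"
| "mag (a # I) [] = 0"
| "mag (a # I) ((x, s) # w) =
    mag (a # I) w + (if a = x then if s then mag I w else - mag I ((x, s) # w) else 0)"

text \<open>Multiplicativity of the Magnus expansion in noncommuting variables: a monomial of a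
  product arises by cutting it into a prefix from \<open>u\<close> and a suffix from
  \<open>v\<close>. It holds for all words, reduced or not.\<close>

lemma mag_append: "mag I (u @ v) = (\<Sum>p\<le>length I. mag (take p I) u * mag (drop p I) v)"
proof (induction I u rule: mag.induct)
  case (2 a I)
  show ?case by (simp only: length_Cons sum.atMost_Suc_shift) simp
next
  case (3 a I x s w)
  have "mag (a # I) (((x, s) # w) @ v) = mag (a # I) (w @ v) +
      (if a = x then if s then mag I (w @ v) else - mag I (((x, s) # w) @ v) else 0)"
    by simp
  also have "\<dots> = (\<Sum>p\<le>length (a # I). mag (take p (a # I)) ((x, s) # w) * mag (drop p (a # I)) v)"
    using 3 by (cases "a = x"; cases s)
      (simp_all only: length_Cons sum.atMost_Suc_shift, simp_all add: algebra_simps sum.distrib sum_subtractf sum_negf)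
  finally show ?case .
qed simp

text \<open>Free reduction does not change the coefficients, so a product in the free group may be
  evaluated on the concatenated word.\<close>

lemma mag_cancel: "mag I (l # inv_letter l # w) = mag I w"
proof (induction I)
  case (Cons a I)
  then show ?case by (cases l; cases "snd l") auto
qed simp

lemma mag_cong_Cons:
  assumes "\<And>I. mag I u = mag I v"
  shows "mag I (l # u) = mag I (l # v)"
  using assms by (induction I; cases l) auto

lemma mag_cancel_cons: "mag I (cancel_cons l w) = mag I (l # w)"
  using mag_cancel[of I l "tl w"] by (cases w) (auto simp del: mag.simps)

lemma mag_foldr_cancel_cons: "mag I (foldr cancel_cons u v) = mag I (u @ v)"
proof (induction u arbitrary: I)
  case (Cons l u)
  then show ?case by (simp add: mag_cancel_cons del: mag.simps cong: mag_cong_Cons)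
qed simp

lemma mag_mult:
  "mag I (u \<otimes>\<^bsub>free_group X\<^esub> v) = (\<Sum>p\<le>length I. mag (take p I) u * mag (drop p I) v)"
  by (simp add: mult_free_group mag_foldr_cancel_cons mag_append)

lemma mag1_mult [simp]: "mag [j] (u \<otimes>\<^bsub>free_group X\<^esub> v) = mag [j] u + mag [j] v"
  by (simp add: mag_mult)

lemma mag2_mult [simp]:
  "mag [j, k] (u \<otimes>\<^bsub>free_group X\<^esub> v) = mag [j, k] u + mag [j] u * mag [k] v + mag [j, k] v"
  by (simp add: mag_mult)

lemma mag3_mult:
  "mag [j, k, l] (u \<otimes>\<^bsub>free_group X\<^esub> v) =
    mag [j, k, l] u + mag [j, k] u * mag [l] v + mag [j] u * mag [k, l] v + mag [j, k, l] v"
  by (simp add: mag_mult)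

lemma mag_eq_0: "a \<in> set I \<Longrightarrow> a \<notin> fst ` set w \<Longrightarrow> mag I w = 0"
  by (induction I w rule: mag.induct) auto

lemma mag_eq_0_free_group:
  "w \<in> carrier (free_group X) \<Longrightarrow> a \<in> set I \<Longrightarrow> a \<notin> X \<Longrightarrow> mag I w = 0"
  by (rule mag_eq_0) (auto simp: carrier_free_group)

lemma mag_gen [simp]:
  "mag [j] (free_gen x) = (if j = x then 1 else 0)"
  "mag [j, k] (free_gen x) = 0"
  "mag [j, k, l] (free_gen x) = 0"
  by (auto simp: free_gen_def)

lemma mag1_inv [simp]:
  assumes "u \<in> carrier (free_group X)"
  shows "mag [j] (inv\<^bsub>free_group X\<^esub> u) = - mag [j] u"
proof -
  interpret group "free_group X" by (rule group_free_group)
  have "mag [j] (u \<otimes>\<^bsub>free_group X\<^esub> inv\<^bsub>free_group X\<^esub> u) = 0"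
    using assms by simp
  then show ?thesis unfolding mag1_mult by simp
qed

lemma mag2_inv [simp]:
  assumes "u \<in> carrier (free_group X)"
  shows "mag [j, k] (inv\<^bsub>free_group X\<^esub> u) = mag [j] u * mag [k] u - mag [j, k] u"
proof -
  interpret group "free_group X" by (rule group_free_group)
  have "mag [j, k] (u \<otimes>\<^bsub>free_group X\<^esub> inv\<^bsub>free_group X\<^esub> u) = 0"
    using assms by simp
  then show ?thesis unfolding mag2_mult using assms by simp
qed

lemma free_group_mono: "X \<subseteq> Y \<Longrightarrow> carrier (free_group X) \<subseteq> carrier (free_group Y)"
  unfolding carrier_free_group subset_iff by blast

text \<open>Reduced words are multiplied and inverted in the same way over every alphabet, so the
  free group on \<open>X\<close> is a subgroup of the one on \<open>Y\<close>.\<close>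

lemma free_group_subset_closed:
  assumes "X \<subseteq> Y"
  shows "u \<in> carrier (free_group X) \<Longrightarrow> v \<in> carrier (free_group X) \<Longrightarrow>
      u \<otimes>\<^bsub>free_group Y\<^esub> v \<in> carrier (free_group X)"
    and "u \<in> carrier (free_group X) \<Longrightarrow> inv\<^bsub>free_group Y\<^esub> u \<in> carrier (free_group X)"
  using mult_free_group_closed[of u X v] free_group_mono[OF assms] inv_word_closed[of u X]
  by (auto simp: mult_free_group inv_free_group)

text \<open>The word \<open>w\<close> is recovered from its conjugate \<open>w x w\<^sup>-\<^sup>1\<close>, since the letter \<open>x\<close> does not occur
  in \<open>w\<close>.\<close>

lemma mag_conj:
  assumes w: "w \<in> carrier (free_group Y)" and "Y \<subseteq> X" "x \<notin> Y" "j \<noteq> x" "k \<noteq> x"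
  defines "v \<equiv> w \<otimes>\<^bsub>free_group X\<^esub> free_gen x \<otimes>\<^bsub>free_group X\<^esub> inv\<^bsub>free_group X\<^esub> w"
  shows "mag [j, x] v = mag [j] w" and "mag [j, k, x] v = mag [j, k] w"
proof -
  have w': "inv\<^bsub>free_group X\<^esub> w \<in> carrier (free_group Y)"
    using assms by (intro free_group_subset_closed)
  show "mag [j, x] v = mag [j] w"
    using assms(2-5) mag_eq_0_free_group[OF w, of x] mag_eq_0_free_group[OF w', of x]
    by (simp only: v_def mag2_mult mag1_mult mag_gen) simp
  show "mag [j, k, x] v = mag [j, k] w"
    using assms(2-5) mag_eq_0_free_group[OF w, of x] mag_eq_0_free_group[OF w', of x]
    by (simp only: v_def mag3_mult mag2_mult mag1_mult mag_gen) simp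
qed


section \<open>Triangular automorphisms\<close>

text \<open>An invariant that passes to products and holds for the generators and their inverses,
  which is what induction over \<open>generate\<close> demands. The alphabet \<open>{1..<i}\<close>
  omits \<open>i\<close>, so that \<open>mag_conj\<close> can recover \<open>w\<close>.\<close>

definition triangular :: "nat \<Rightarrow> (nat word \<Rightarrow> nat word) \<Rightarrow> bool" where
  "triangular n g \<longleftrightarrow> g \<in> auto (free_group_n n) \<and>
    (\<forall>i\<in>{1..n}. \<exists>w\<in>carrier (free_group {1..<i}).
      g (free_gen i) = w \<otimes>\<^bsub>free_group_n n\<^esub> free_gen i \<otimes>\<^bsub>free_group_n n\<^esub> inv\<^bsub>free_group_n n\<^esub> w)"

lemma auto_group_hom: "g \<in> auto (free_group X) \<Longrightarrow> group_hom (free_group X) (free_group X) g"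
  by (simp add: auto_def group_hom_def group_hom_axioms_def group_free_group)

lemma triangularE:
  assumes "triangular n g" "i \<in> {1..n}"
  obtains w where "w \<in> carrier (free_group {1..<i})" "w \<in> carrier (free_group_n n)"
    "g (free_gen i) = w \<otimes>\<^bsub>free_group_n n\<^esub> free_gen i \<otimes>\<^bsub>free_group_n n\<^esub> inv\<^bsub>free_group_n n\<^esub> w"
proof -
  have "{1..<i} \<subseteq> {1..n}" using assms by auto
  then show thesis
    using assms that free_group_mono[of "{1..<i}" "{1..n}"] unfolding triangular_def by blast
qed

text \<open>Each \<open>x_k\<close> with \<open>k < i\<close> goes to a conjugate of itself by a
  word in even earlier letters. This keeps the conjugating word of a composite inside the right
  alphabet.\<close>

lemma triangular_mono:
  assumes g: "triangular n g" and i: "i \<in> {1..n}" and w: "w \<in> carrier (free_group {1..<i})"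
  shows "g w \<in> carrier (free_group {1..<i})"
proof -
  interpret F: group "free_group_n n" by (rule group_free_group)
  interpret g: group_hom "free_group_n n" "free_group_n n" g
    using g by (intro auto_group_hom) (simp add: triangular_def)
  have sub: "{1..<i} \<subseteq> {1..n}" using i by auto
  have wn: "v \<in> carrier (free_group_n n)" if "v \<in> carrier (free_group {1..<i})" for v
    using free_group_mono[OF sub] that by auto
  have g_gen: "g (free_gen k) \<in> carrier (free_group {1..<i})" if k: "k \<in> {1..<i}" for k
  proof -
    have kn: "k \<in> {1..n}" using k i by auto
    obtain v where v: "v \<in> carrier (free_group {1..<k})"
      "g (free_gen k) = v \<otimes>\<^bsub>free_group_n n\<^esub> free_gen k \<otimes>\<^bsub>free_group_n n\<^esub> inv\<^bsub>free_group_n n\<^esub> v"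
      by (rule triangularE[OF g kn])
    have "v \<in> carrier (free_group {1..<i})"
      using v(1) free_group_mono[of "{1..<k}" "{1..<i}"] k by auto
    then show ?thesis
      unfolding v(2) using k by (intro free_group_subset_closed[OF sub] free_gen_closed)
  qed
  \<comment> \<open>The induction rule uses the operations of the small free group, whereas
    \<open>g\<close> is a homomorphism for those of the large one.\<close>
  have eqs: "u \<otimes>\<^bsub>free_group {1..<i}\<^esub> v = u \<otimes>\<^bsub>free_group_n n\<^esub> v"
    "u \<in> carrier (free_group {1..<i}) \<Longrightarrow> inv\<^bsub>free_group {1..<i}\<^esub> u = inv\<^bsub>free_group_n n\<^esub> u" for u v
    by (auto simp: mult_free_group inv_free_group wn)
  show ?thesis
    using w
  proof (induction rule: free_group_induct)
    case one
    then show ?case using g.hom_one by (simp add: carrier_free_group)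
  next
    case (gen x w)
    then show ?case
      by (simp add: eqs wn free_gen_closed free_group_subset_closed[OF sub] g_gen)
  next
    case (inv_gen x w)
    then show ?case
      by (simp add: eqs wn free_gen_closed free_group_subset_closed[OF sub] g_gen)
  qed
qed


text \<open>Conjugation preserves exponent sums, so a triangular automorphism acts trivially on the
  abelianization.\<close>

lemma mag1_triangular:
  assumes g: "triangular n g" and v: "v \<in> carrier (free_group_n n)"
  shows "mag [j] (g v) = mag [j] v"
proof -
  interpret F: group "free_group_n n" by (rule group_free_group)
  interpret g: group_hom "free_group_n n" "free_group_n n" g
    using g by (intro auto_group_hom) (simp add: triangular_def)
  have g_gen: "mag [j] (g (free_gen a)) = mag [j] (free_gen a)" if a: "a \<in> {1..n}" for a
  proof -
    obtain w where "w \<in> carrier (free_group_n n)"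
      "g (free_gen a) = w \<otimes>\<^bsub>free_group_n n\<^esub> free_gen a \<otimes>\<^bsub>free_group_n n\<^esub> inv\<^bsub>free_group_n n\<^esub> w"
      by (rule triangularE[OF g a])
    then show ?thesis by simp
  qed
  show ?thesis
    using v
  proof (induction rule: free_group_induct)
    case one
    then show ?case using g.hom_one by simp
  next
    case (gen a w)
    then show ?case by (simp add: free_gen_closed g_gen del: mag_gen)
  next
    case (inv_gen a w)
    then show ?case by (simp add: free_gen_closed g_gen del: mag_gen)
  qed
qed

text \<open>To second order, \<open>w x_a w^-1\<close> differs from \<open>x_a\<close> by the
  commutator of \<open>w\<close> and \<open>x_a\<close>. At \<open>X_j X_k\<close> with
  \<open>k < j\<close> this contributes only for \<open>a = j\<close>, with value minus the exponent
  sum of \<open>x_k\<close> in \<open>w\<close>. As first-order coefficients are preserved, the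
  change is additive in \<open>v\<close>.\<close>

lemma mag2_triangular:
  assumes g: "triangular n g" and v: "v \<in> carrier (free_group_n n)" and jk: "k < j" "j \<in> {1..n}"
  shows "mag [j, k] (g v) = mag [j, k] v - mag [j] v * mag [k, j] (g (free_gen j))"
proof -
  interpret F: group "free_group_n n" by (rule group_free_group)
  interpret g: group_hom "free_group_n n" "free_group_n n" g
    using g by (intro auto_group_hom) (simp add: triangular_def)
  have g_gen: "mag [j, k] (g (free_gen a)) = - (if j = a then 1 else 0) * mag [k, j] (g (free_gen j))"
    if a: "a \<in> {1..n}" for a
  proof -
    obtain w where w: "w \<in> carrier (free_group {1..<a})" "w \<in> carrier (free_group_n n)"
      and ga: "g (free_gen a) = w \<otimes>\<^bsub>free_group_n n\<^esub> free_gen a \<otimes>\<^bsub>free_group_n n\<^esub> inv\<^bsub>free_group_n n\<^esub> w"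
      by (rule triangularE[OF g a])
    have "mag [j, k] (g (free_gen a)) =
        mag [j] w * mag [k] (free_gen a) - mag [j] (free_gen a) * mag [k] w"
      using w(2) by (simp add: ga algebra_simps)
    \<comment> \<open>Here \<open>w\<close> uses only letters below \<open>k\<close>, and
      \<open>k < j\<close>.\<close>
    moreover have "mag [j] w = 0" if "a = k"
      using that jk by (intro mag_eq_0_free_group[OF w(1)]) auto
    moreover have "mag [k, a] (g (free_gen a)) = mag [k] w" if "a = j"
      unfolding ga using that jk by (intro mag_conj[OF w(1)]) auto
    ultimately show ?thesis by auto
  qed
  have gen1: "mag [a] (g (free_gen b)) = mag [a] (free_gen b)" if "b \<in> {1..n}" for a b
    using that by (intro mag1_triangular[OF g]) (rule free_gen_closed)
  show ?thesis
    using v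
  proof (induction rule: free_group_induct)
    case one
    then show ?case using g.hom_one by simp
  next
    case (gen a w)
    then show ?case using jk
      by (simp add: free_gen_closed g_gen gen1 mag1_triangular[OF g] algebra_simps)
  next
    case (inv_gen a w)
    then show ?case using jk
      by (simp add: free_gen_closed g_gen gen1 mag1_triangular[OF g] algebra_simps)
  qed
qed

text \<open>If \<open>g\<close> maps \<open>x\<^sub>i\<close> to \<open>w x\<^sub>i w\<^sup>-\<^sup>1\<close>, then \<open>mccool_char i j g\<close> is the exponent sum of \<open>x\<^sub>j\<close> in \<open>w\<close>,
  and \<open>mccool_cochain i j k g\<close> is the second order Magnus coefficient of \<open>w\<close> at \<open>X\<^sub>j X\<^sub>k\<close>. For
  \<open>k < j < i\<close> the negative of the latter bounds the cup product that has to vanish.\<close>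

definition mccool_char :: "nat \<Rightarrow> nat \<Rightarrow> (nat word \<Rightarrow> nat word) \<Rightarrow> int" where
  "mccool_char i j g = mag [j, i] (g (free_gen i))"

definition mccool_cochain :: "nat \<Rightarrow> nat \<Rightarrow> nat \<Rightarrow> (nat word \<Rightarrow> nat word) \<Rightarrow> int" where
  "mccool_cochain i j k g = mag [j, k, i] (g (free_gen i))"

text \<open>Applying \<open>g\<close> to \<open>w x_i w^-1\<close> gives the conjugate of
  \<open>x_i\<close> by \<open>(g w) v\<close>: conjugating words form a crossed homomorphism,
  twisted by the action of \<open>g\<close>.\<close>

lemma triangular_comp_gen:
  assumes g: "triangular n g" and h: "triangular n h" and i: "i \<in> {1..n}"
  obtains v w where "v \<in> carrier (free_group {1..<i})" "w \<in> carrier (free_group {1..<i})"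
    "g (free_gen i) = v \<otimes>\<^bsub>free_group_n n\<^esub> free_gen i \<otimes>\<^bsub>free_group_n n\<^esub> inv\<^bsub>free_group_n n\<^esub> v"
    "h (free_gen i) = w \<otimes>\<^bsub>free_group_n n\<^esub> free_gen i \<otimes>\<^bsub>free_group_n n\<^esub> inv\<^bsub>free_group_n n\<^esub> w"
    "g w \<otimes>\<^bsub>free_group_n n\<^esub> v \<in> carrier (free_group {1..<i})"
    "g (h (free_gen i)) = (g w \<otimes>\<^bsub>free_group_n n\<^esub> v) \<otimes>\<^bsub>free_group_n n\<^esub> free_gen i
      \<otimes>\<^bsub>free_group_n n\<^esub> inv\<^bsub>free_group_n n\<^esub> (g w \<otimes>\<^bsub>free_group_n n\<^esub> v)"
proof -
  interpret F: group "free_group_n n" by (rule group_free_group)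
  interpret g: group_hom "free_group_n n" "free_group_n n" g
    using g by (intro auto_group_hom) (simp add: triangular_def)
  have sub: "{1..<i} \<subseteq> {1..n}" using i by auto
  obtain v where v: "v \<in> carrier (free_group {1..<i})" "v \<in> carrier (free_group_n n)"
    "g (free_gen i) = v \<otimes>\<^bsub>free_group_n n\<^esub> free_gen i \<otimes>\<^bsub>free_group_n n\<^esub> inv\<^bsub>free_group_n n\<^esub> v"
    by (rule triangularE[OF g i])
  obtain w where w: "w \<in> carrier (free_group {1..<i})" "w \<in> carrier (free_group_n n)"
    "h (free_gen i) = w \<otimes>\<^bsub>free_group_n n\<^esub> free_gen i \<otimes>\<^bsub>free_group_n n\<^esub> inv\<^bsub>free_group_n n\<^esub> w"
    by (rule triangularE[OF h i])
  show thesis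
  proof (rule that[of v w])
    show "g w \<otimes>\<^bsub>free_group_n n\<^esub> v \<in> carrier (free_group {1..<i})"
      using triangular_mono[OF g i w(1)] v(1) by (rule free_group_subset_closed[OF sub])
    show "g (h (free_gen i)) = (g w \<otimes>\<^bsub>free_group_n n\<^esub> v) \<otimes>\<^bsub>free_group_n n\<^esub> free_gen i
      \<otimes>\<^bsub>free_group_n n\<^esub> inv\<^bsub>free_group_n n\<^esub> (g w \<otimes>\<^bsub>free_group_n n\<^esub> v)"
      using v(2) w(2) i by (simp add: v(3) w(3) free_gen_closed F.inv_mult_group F.m_assoc)
  qed (fact v w)+
qed

text \<open>By \<open>mag1_triangular\<close> the twist by \<open>g\<close> is invisible to first
  order.\<close>

lemma mccool_char_comp:
  assumes g: "triangular n g" and h: "triangular n h" and "i \<in> {1..n}" "j < i"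
  shows "mag [j, i] (g (h (free_gen i))) = mccool_char i j g + mccool_char i j h"
proof -
  obtain v w where vw: "v \<in> carrier (free_group {1..<i})" "w \<in> carrier (free_group {1..<i})"
    "g (free_gen i) = v \<otimes>\<^bsub>free_group_n n\<^esub> free_gen i \<otimes>\<^bsub>free_group_n n\<^esub> inv\<^bsub>free_group_n n\<^esub> v"
    "h (free_gen i) = w \<otimes>\<^bsub>free_group_n n\<^esub> free_gen i \<otimes>\<^bsub>free_group_n n\<^esub> inv\<^bsub>free_group_n n\<^esub> w"
    "g w \<otimes>\<^bsub>free_group_n n\<^esub> v \<in> carrier (free_group {1..<i})"
    "g (h (free_gen i)) = (g w \<otimes>\<^bsub>free_group_n n\<^esub> v) \<otimes>\<^bsub>free_group_n n\<^esub> free_gen i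
      \<otimes>\<^bsub>free_group_n n\<^esub> inv\<^bsub>free_group_n n\<^esub> (g w \<otimes>\<^bsub>free_group_n n\<^esub> v)"
    by (rule triangular_comp_gen[OF assms(1-3)])
  have sub: "{1..<i} \<subseteq> {1..n}" using assms by auto
  have w: "w \<in> carrier (free_group_n n)" using free_group_mono[OF sub] vw(2) by auto
  note conj = mag_conj(1)[where Y = "{1..<i}" and X = "{1..n}" and x = i and k = j, OF _ sub]
  show ?thesis
    unfolding mccool_char_def vw(6) unfolding vw(3,4)
    using assms vw(1,2,5) w by (simp add: conj mag1_triangular[OF g] del: mag2_mult)
qed

text \<open>The defect from additivity has two sources. The product rule for \<open>(g w) v\<close>
  gives the term with \<open>mccool_char i k g\<close>, and the twist of \<open>w\<close> by
  \<open>g\<close>, through \<open>mag2_triangular\<close>, the term with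
  \<open>mccool_char j k g\<close>.\<close>

lemma mccool_cochain_comp:
  assumes g: "triangular n g" and h: "triangular n h" and i: "i \<in> {1..n}" and jk: "1 \<le> k" "k < j" "j < i"
  shows "mag [j, k, i] (g (h (free_gen i))) = mccool_cochain i j k g + mccool_cochain i j k h
    + mccool_char i j h * (mccool_char i k g - mccool_char j k g)"
proof -
  obtain v w where vw: "v \<in> carrier (free_group {1..<i})" "w \<in> carrier (free_group {1..<i})"
    "g (free_gen i) = v \<otimes>\<^bsub>free_group_n n\<^esub> free_gen i \<otimes>\<^bsub>free_group_n n\<^esub> inv\<^bsub>free_group_n n\<^esub> v"
    "h (free_gen i) = w \<otimes>\<^bsub>free_group_n n\<^esub> free_gen i \<otimes>\<^bsub>free_group_n n\<^esub> inv\<^bsub>free_group_n n\<^esub> w"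
    "g w \<otimes>\<^bsub>free_group_n n\<^esub> v \<in> carrier (free_group {1..<i})"
    "g (h (free_gen i)) = (g w \<otimes>\<^bsub>free_group_n n\<^esub> v) \<otimes>\<^bsub>free_group_n n\<^esub> free_gen i
      \<otimes>\<^bsub>free_group_n n\<^esub> inv\<^bsub>free_group_n n\<^esub> (g w \<otimes>\<^bsub>free_group_n n\<^esub> v)"
    by (rule triangular_comp_gen[OF assms(1-3)])
  have sub: "{1..<i} \<subseteq> {1..n}" using assms by auto
  have w: "w \<in> carrier (free_group_n n)" using free_group_mono[OF sub] vw(2) by auto
  have ne: "j \<noteq> i" "k \<noteq> i" "i \<notin> {1..<i}" and jn: "j \<in> {1..n}" using jk i by auto
  note m1 = mag_conj(1)[OF _ sub ne(3)] and m2 = mag_conj(2)[OF _ sub ne(3)]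
  have c: "mag [j, i] (g (free_gen i)) = mag [j] v" "mag [k, i] (g (free_gen i)) = mag [k] v"
    "mag [j, i] (h (free_gen i)) = mag [j] w"
    "mag [j, k, i] (g (free_gen i)) = mag [j, k] v" "mag [j, k, i] (h (free_gen i)) = mag [j, k] w"
    "mag [j, k, i] (g (h (free_gen i))) = mag [j, k] (g w \<otimes>\<^bsub>free_group_n n\<^esub> v)"
    unfolding vw(6) unfolding vw(3,4)
    by (rule m1[OF vw(1) ne(1) ne(2)] m1[OF vw(1) ne(2) ne(2)] m1[OF vw(2) ne(1) ne(2)]
        m2[OF vw(1) ne(1) ne(2)] m2[OF vw(2) ne(1) ne(2)] m2[OF vw(5) ne(1) ne(2)])+
  show ?thesis
    unfolding mccool_char_def mccool_cochain_def c mag2_mult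
      mag2_triangular[OF g w jk(2) jn] mag1_triangular[OF g w]
    by (simp add: algebra_simps)
qed


section \<open>Partial conjugations\<close>

text \<open>A general conjugating word is allowed because the inverse of
  \<open>mccool_gen n i j\<close> is the partial conjugation by the inverse of
  \<open>x_j\<close>.\<close>

definition partial_conj :: "nat \<Rightarrow> nat \<Rightarrow> nat word \<Rightarrow> nat word \<Rightarrow> nat word" where
  "partial_conj n i v = restrict
    (free_lift (free_group_n n)
      (\<lambda>k. if k = i then v \<otimes>\<^bsub>free_group_n n\<^esub> free_gen i \<otimes>\<^bsub>free_group_n n\<^esub> inv\<^bsub>free_group_n n\<^esub> v
            else free_gen k))
    (carrier (free_group_n n))"

lemma mccool_gen_eq: "mccool_gen n i j = partial_conj n i (free_gen j)"
  by (simp add: mccool_gen_def partial_conj_def)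

context
  fixes n i :: nat and v :: "nat word"
  assumes i: "i \<in> {1..n}" and v: "v \<in> carrier (free_group_n n)"
begin

lemma partial_conj_hom: "partial_conj n i v \<in> hom (free_group_n n) (free_group_n n)"
proof -
  interpret F: group "free_group_n n" by (rule group_free_group)
  have "free_lift (free_group_n n)
      (\<lambda>k. if k = i then v \<otimes>\<^bsub>free_group_n n\<^esub> free_gen i \<otimes>\<^bsub>free_group_n n\<^esub> inv\<^bsub>free_group_n n\<^esub> v
            else free_gen k) \<in> hom (free_group_n n) (free_group_n n)"
    using i v by (intro F.free_lift_hom) (auto intro!: F.m_closed F.inv_closed free_gen_closed)
  then show ?thesis
    by (auto simp: partial_conj_def hom_def)
qed

lemma partial_conj_gen:
  assumes "k \<in> {1..n}"
  shows "partial_conj n i v (free_gen k) =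
    (if k = i then v \<otimes>\<^bsub>free_group_n n\<^esub> free_gen i \<otimes>\<^bsub>free_group_n n\<^esub> inv\<^bsub>free_group_n n\<^esub> v
      else free_gen k)"
proof -
  interpret F: group "free_group_n n" by (rule group_free_group)
  show ?thesis
    using assms i v by (simp add: partial_conj_def free_gen_closed F.free_lift_gen)
qed

lemma partial_conj_fixes:
  assumes "w \<in> carrier (free_group ({1..n} - {i}))"
  shows "partial_conj n i v w = w"
proof -
  interpret F: group "free_group_n n" by (rule group_free_group)
  interpret g: group_hom "free_group_n n" "free_group_n n" "partial_conj n i v"
    by (simp add: group_hom_def group_hom_axioms_def partial_conj_hom F.group_axioms)
  have sub: "carrier (free_group ({1..n} - {i})) \<subseteq> carrier (free_group_n n)"
    by (rule free_group_mono) auto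
  show ?thesis
    using assms
  proof (induction rule: free_group_induct)
    case one
    then show ?case using g.hom_one by simp
  next
    case (gen x w)
    then have "partial_conj n i v (free_gen x \<otimes>\<^bsub>free_group_n n\<^esub> w) = free_gen x \<otimes>\<^bsub>free_group_n n\<^esub> w"
      using subsetD[OF sub] by (auto simp: partial_conj_gen free_gen_closed)
    then show ?case by (simp add: mult_free_group)
  next
    case (inv_gen x w)
    then have "partial_conj n i v (inv\<^bsub>free_group_n n\<^esub> (free_gen x) \<otimes>\<^bsub>free_group_n n\<^esub> w) =
        inv\<^bsub>free_group_n n\<^esub> (free_gen x) \<otimes>\<^bsub>free_group_n n\<^esub> w"
      using subsetD[OF sub] by (auto simp: partial_conj_gen free_gen_closed)
    then show ?case using inv_gen(1) by (simp add: mult_free_group inv_free_gen)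
  qed
qed

end

text \<open>Since \<open>v\<close> avoids the letter \<open>x_i\<close>, both maps fix
  \<open>v\<close>, and the successive conjugations of \<open>x_i\<close> cancel.\<close>

lemma partial_conj_inverse:
  assumes i: "i \<in> {1..n}" and v: "v \<in> carrier (free_group ({1..n} - {i}))"
    and w: "w \<in> carrier (free_group_n n)"
  shows "partial_conj n i v (partial_conj n i (inv\<^bsub>free_group_n n\<^esub> v) w) = w"
proof -
  interpret F: group "free_group_n n" by (rule group_free_group)
  have sub: "{1..n} - {i} \<subseteq> {1..n}" by auto
  have vn: "v \<in> carrier (free_group_n n)" using free_group_mono[OF sub] v by auto
  interpret g: group_hom "free_group_n n" "free_group_n n" "partial_conj n i v"
    by (simp add: group_hom_def group_hom_axioms_def partial_conj_hom[OF i vn] F.group_axioms)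
  interpret h: group_hom "free_group_n n" "free_group_n n" "partial_conj n i (inv\<^bsub>free_group_n n\<^esub> v)"
    by (simp add: group_hom_def group_hom_axioms_def partial_conj_hom[OF i F.inv_closed[OF vn]]
        F.group_axioms)
  have "(partial_conj n i v \<circ> partial_conj n i (inv\<^bsub>free_group_n n\<^esub> v)) w = (\<lambda>w. w) w"
  proof (rule free_group_hom_eqI[OF F.group_axioms _ _ _ w])
    show "partial_conj n i v \<circ> partial_conj n i (inv\<^bsub>free_group_n n\<^esub> v)
        \<in> hom (free_group_n n) (free_group_n n)"
      by (intro homI) simp_all
    show "(\<lambda>w. w) \<in> hom (free_group_n n) (free_group_n n)"
      by (auto intro: homI)
    fix k assume k: "k \<in> {1..n}"
    have "partial_conj n i v (inv\<^bsub>free_group_n n\<^esub> v) = inv\<^bsub>free_group_n n\<^esub> v"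
      using free_group_subset_closed(2)[OF sub v] by (rule partial_conj_fixes[OF i vn])
    then show "(partial_conj n i v \<circ> partial_conj n i (inv\<^bsub>free_group_n n\<^esub> v)) (free_gen k) = free_gen k"
      using k i vn
      by (auto simp: partial_conj_gen free_gen_closed partial_conj_fixes[OF i vn v]
          F.inv_mult_group F.m_assoc F.inv_solve_left)
        (simp add: F.m_assoc[symmetric] free_gen_closed F.l_inv)
  qed
  then show ?thesis by simp
qed

lemma partial_conj_auto:
  assumes i: "i \<in> {1..n}" and v: "v \<in> carrier (free_group ({1..n} - {i}))"
  shows "partial_conj n i v \<in> auto (free_group_n n)"
proof -
  interpret F: group "free_group_n n" by (rule group_free_group)
  have sub: "{1..n} - {i} \<subseteq> {1..n}" by auto
  have vn: "v \<in> carrier (free_group_n n)" using free_group_mono[OF sub] v by auto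
  have iv: "inv\<^bsub>free_group_n n\<^esub> v \<in> carrier (free_group ({1..n} - {i}))"
    using free_group_subset_closed(2)[OF sub v] .
  have "bij_betw (partial_conj n i v) (carrier (free_group_n n)) (carrier (free_group_n n))"
  proof (rule bij_betwI)
    show "partial_conj n i v \<in> carrier (free_group_n n) \<rightarrow> carrier (free_group_n n)"
      using partial_conj_hom[OF i vn] by (simp add: hom_def)
    show "partial_conj n i (inv\<^bsub>free_group_n n\<^esub> v) \<in> carrier (free_group_n n) \<rightarrow> carrier (free_group_n n)"
      using partial_conj_hom[OF i, of "inv\<^bsub>free_group_n n\<^esub> v"] vn by (simp add: hom_def)
    show "partial_conj n i (inv\<^bsub>free_group_n n\<^esub> v) (partial_conj n i v w) = w"
      if "w \<in> carrier (free_group_n n)" for w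
      using partial_conj_inverse[OF i iv that] vn by simp
  qed (rule partial_conj_inverse[OF i v])
  then show ?thesis
    using partial_conj_hom[OF i vn] by (simp add: auto_def Bij_def partial_conj_def)
qed

lemma triangular_partial_conj:
  assumes i: "i \<in> {1..n}" and v: "v \<in> carrier (free_group {1..<i})"
  shows "triangular n (partial_conj n i v)"
  unfolding triangular_def
proof (intro conjI ballI)
  interpret F: group "free_group_n n" by (rule group_free_group)
  have v': "v \<in> carrier (free_group ({1..n} - {i}))"
    using subsetD[OF free_group_mono[of "{1..<i}" "{1..n} - {i}"] v] i by (simp add: subset_iff)
  then have vn: "v \<in> carrier (free_group_n n)"
    using free_group_mono[of "{1..n} - {i}" "{1..n}"] by auto
  show "partial_conj n i v \<in> auto (free_group_n n)"
    by (rule partial_conj_auto[OF i v'])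
  fix k assume k: "k \<in> {1..n}"
  show "\<exists>w\<in>carrier (free_group {1..<k}). partial_conj n i v (free_gen k) =
      w \<otimes>\<^bsub>free_group_n n\<^esub> free_gen k \<otimes>\<^bsub>free_group_n n\<^esub> inv\<^bsub>free_group_n n\<^esub> w"
  proof (cases "k = i")
    case True
    then show ?thesis using v partial_conj_gen[OF i vn k] by (intro bexI[of _ v]) simp_all
  next
    case False
    have "[] \<in> carrier (free_group {1..<k})" by (simp add: carrier_free_group)
    moreover have "free_gen k = [] \<otimes>\<^bsub>free_group_n n\<^esub> free_gen k \<otimes>\<^bsub>free_group_n n\<^esub> inv\<^bsub>free_group_n n\<^esub> []"
      using F.l_one[of "free_gen k"] F.r_one[of "free_gen k"] F.inv_one k
      by (simp add: free_gen_closed)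
    ultimately show ?thesis using False partial_conj_gen[OF i vn k] by (intro bexI[of _ "[]"]) simp_all
  qed
qed


section \<open>The upper McCool group\<close>

abbreviation mccool_gens :: "nat \<Rightarrow> (nat word \<Rightarrow> nat word) set" where
  "mccool_gens n \<equiv> {mccool_gen n i j | i j. 1 \<le> j \<and> j < i \<and> i \<le> n}"

lemma group_AutoGroup_free: "group (AutoGroup (free_group X))"
  by (rule group.AutoGroup[OF group_free_group])

lemma carrier_AutoGroup: "carrier (AutoGroup G) = auto G"
  by (simp add: AutoGroup_def)

lemma mult_AutoGroup:
  "g \<in> auto G \<Longrightarrow> h \<in> auto G \<Longrightarrow> g \<otimes>\<^bsub>AutoGroup G\<^esub> h = compose (carrier G) g h"
  by (simp add: AutoGroup_def BijGroup_def auto_def)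

lemma one_AutoGroup: "\<one>\<^bsub>AutoGroup G\<^esub> = (\<lambda>x\<in>carrier G. x)"
  by (simp add: AutoGroup_def BijGroup_def)

lemma auto_free_group_eqI:
  assumes "g \<in> auto (free_group X)" "h \<in> auto (free_group X)"
    and "\<And>x. x \<in> X \<Longrightarrow> g (free_gen x) = h (free_gen x)"
  shows "g = h"
proof (rule extensionalityI)
  show "g \<in> extensional (carrier (free_group X))" "h \<in> extensional (carrier (free_group X))"
    using assms by (auto simp: auto_def Bij_def)
  show "g w = h w" if "w \<in> carrier (free_group X)" for w
    using that by (rule free_group_hom_eqI[OF group_free_group, of g X X h, rotated -1])
      (use assms in \<open>simp_all add: auto_def\<close>)
qed

lemma triangular_one: "triangular n \<one>\<^bsub>AutoGroup (free_group_n n)\<^esub>"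
proof -
  interpret A: group "AutoGroup (free_group_n n)" by (rule group_AutoGroup_free)
  interpret F: group "free_group_n n" by (rule group_free_group)
  have "\<exists>w\<in>carrier (free_group {1..<k}). free_gen k =
      w \<otimes>\<^bsub>free_group_n n\<^esub> free_gen k \<otimes>\<^bsub>free_group_n n\<^esub> inv\<^bsub>free_group_n n\<^esub> w" if "k \<in> {1..n}" for k
    using F.inv_one that by (intro bexI[of _ "[]"]) (simp_all add: free_gen_closed, simp add: carrier_free_group)
  then show ?thesis
    using F.id_in_auto unfolding triangular_def
    by (simp add: one_AutoGroup free_gen_closed)
qed

lemma triangular_mult:
  assumes g: "triangular n g" and h: "triangular n h"
  shows "triangular n (g \<otimes>\<^bsub>AutoGroup (free_group_n n)\<^esub> h)"
  unfolding triangular_def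
proof (intro conjI ballI)
  interpret A: group "AutoGroup (free_group_n n)" by (rule group_AutoGroup_free)
  have gh: "g \<in> auto (free_group_n n)" "h \<in> auto (free_group_n n)"
    using g h by (simp_all add: triangular_def)
  then show "g \<otimes>\<^bsub>AutoGroup (free_group_n n)\<^esub> h \<in> auto (free_group_n n)"
    using A.m_closed by (simp add: carrier_AutoGroup)
  fix i assume i: "i \<in> {1..n}"
  obtain v w where vw: "g w \<otimes>\<^bsub>free_group_n n\<^esub> v \<in> carrier (free_group {1..<i})"
    "g (h (free_gen i)) = (g w \<otimes>\<^bsub>free_group_n n\<^esub> v) \<otimes>\<^bsub>free_group_n n\<^esub> free_gen i
      \<otimes>\<^bsub>free_group_n n\<^esub> inv\<^bsub>free_group_n n\<^esub> (g w \<otimes>\<^bsub>free_group_n n\<^esub> v)"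
    by (rule triangular_comp_gen[OF g h i])
  have "(g \<otimes>\<^bsub>AutoGroup (free_group_n n)\<^esub> h) (free_gen i) = g (h (free_gen i))"
    using gh free_gen_closed[OF i] by (simp add: mult_AutoGroup compose_def)
  then show "\<exists>w\<in>carrier (free_group {1..<i}). (g \<otimes>\<^bsub>AutoGroup (free_group_n n)\<^esub> h) (free_gen i) =
      w \<otimes>\<^bsub>free_group_n n\<^esub> free_gen i \<otimes>\<^bsub>free_group_n n\<^esub> inv\<^bsub>free_group_n n\<^esub> w"
    unfolding vw(2) using vw(1) by (rule bexI)
qed

lemma triangular_mccool_gen:
  assumes "1 \<le> j" "j < i" "i \<le> n"
  shows "triangular n (mccool_gen n i j)"
    and "triangular n (inv\<^bsub>AutoGroup (free_group_n n)\<^esub> (mccool_gen n i j))"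
proof -
  interpret A: group "AutoGroup (free_group_n n)" by (rule group_AutoGroup_free)
  have i: "i \<in> {1..n}" and ji: "j \<in> {1..<i}" and jn: "j \<in> {1..n}" using assms by auto
  have sub: "{1..<i} \<subseteq> {1..n}" "{1..<i} \<subseteq> {1..n} - {i}" using i by auto
  define v where "v = inv\<^bsub>free_group_n n\<^esub> (free_gen j)"
  have j: "free_gen j \<in> carrier (free_group {1..<i})"
    using ji by (rule free_gen_closed)
  then have v: "v \<in> carrier (free_group {1..<i})"
    unfolding v_def by (rule free_group_subset_closed(2)[OF sub(1)])
  show tri: "triangular n (mccool_gen n i j)"
    unfolding mccool_gen_eq by (rule triangular_partial_conj[OF i j])
  have tri': "triangular n (partial_conj n i v)"
    by (rule triangular_partial_conj[OF i v])
  have aut: "mccool_gen n i j \<in> auto (free_group_n n)" "partial_conj n i v \<in> auto (free_group_n n)"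
    using tri tri' by (simp_all add: triangular_def)
  have "partial_conj n i v (mccool_gen n i j w) = w" if "w \<in> carrier (free_group_n n)" for w
  proof -
    interpret F: group "free_group_n n" by (rule group_free_group)
    have "inv\<^bsub>free_group_n n\<^esub> v = free_gen j"
      using free_gen_closed[OF jn] by (simp add: v_def)
    then show ?thesis
      using partial_conj_inverse[OF i, of v w] that v free_group_mono[OF sub(2)]
      by (auto simp: mccool_gen_eq)
  qed
  then have "partial_conj n i v \<otimes>\<^bsub>AutoGroup (free_group_n n)\<^esub> mccool_gen n i j =
      \<one>\<^bsub>AutoGroup (free_group_n n)\<^esub>"
    using aut by (auto simp: mult_AutoGroup one_AutoGroup compose_def)
  then have "inv\<^bsub>AutoGroup (free_group_n n)\<^esub> (mccool_gen n i j) = partial_conj n i v"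
    using aut by (intro A.inv_equality) (simp_all add: carrier_AutoGroup)
  then show "triangular n (inv\<^bsub>AutoGroup (free_group_n n)\<^esub> (mccool_gen n i j))"
    using tri' by simp
qed

lemma mccool_gens_subset: "mccool_gens n \<subseteq> carrier (AutoGroup (free_group_n n))"
  using triangular_mccool_gen(1) by (auto simp: carrier_AutoGroup triangular_def)

lemma upper_mccool_simps:
  "carrier (upper_mccool n) = generate (AutoGroup (free_group_n n)) (mccool_gens n)"
  "mult (upper_mccool n) = mult (AutoGroup (free_group_n n))"
  "one (upper_mccool n) = one (AutoGroup (free_group_n n))"
  by (simp_all add: upper_mccool_def)

lemma group_upper_mccool: "group (upper_mccool n)"
  unfolding upper_mccool_def
  by (rule subgroup.subgroup_is_group[OF group.generate_is_subgroup])
    (simp_all add: group_AutoGroup_free mccool_gens_subset)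

lemma mccool_gen_closed:
  "1 \<le> j \<Longrightarrow> j < i \<Longrightarrow> i \<le> n \<Longrightarrow> mccool_gen n i j \<in> carrier (upper_mccool n)"
  unfolding upper_mccool_simps by (rule generate.incl) auto

lemma triangular_upper_mccool:
  assumes "g \<in> carrier (upper_mccool n)"
  shows "triangular n g"
  using assms unfolding upper_mccool_simps
proof (induction rule: generate.induct)
  case one
  show ?case by (rule triangular_one)
next
  case (incl h)
  then show ?case using triangular_mccool_gen by blast
next
  case (inv h)
  then show ?case using triangular_mccool_gen by blast
next
  case (eng g h)
  then show ?case by (simp add: triangular_mult)
qed

lemma upper_mccool_apply:
  assumes "g \<in> carrier (upper_mccool n)" "h \<in> carrier (upper_mccool n)"
    and w: "w \<in> carrier (free_group_n n)"
  shows "(g \<otimes>\<^bsub>upper_mccool n\<^esub> h) w = g (h w)"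
  using assms(1,2)[THEN triangular_upper_mccool] w
  by (simp add: upper_mccool_simps triangular_def mult_AutoGroup compose_def)

lemma mccool_gen_apply:
  assumes "1 \<le> j" "j < i" "i \<le> n" "k \<in> {1..n}"
  shows "mccool_gen n i j (free_gen k) =
    (if k = i then free_gen j \<otimes>\<^bsub>free_group_n n\<^esub> free_gen i \<otimes>\<^bsub>free_group_n n\<^esub> inv\<^bsub>free_group_n n\<^esub> (free_gen j)
      else free_gen k)"
  unfolding mccool_gen_eq using assms by (intro partial_conj_gen free_gen_closed) auto

section \<open>Characters and second-order cochains on the group\<close>

lemma mccool_char_mult:
  assumes "g \<in> carrier (upper_mccool n)" "h \<in> carrier (upper_mccool n)" "i \<in> {1..n}" "j < i"
  shows "mccool_char i j (g \<otimes>\<^bsub>upper_mccool n\<^esub> h) = mccool_char i j g + mccool_char i j h"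
  using mccool_char_comp[OF assms(1,2)[THEN triangular_upper_mccool] assms(3,4)] assms
  by (simp add: mccool_char_def[of _ _ "g \<otimes>\<^bsub>upper_mccool n\<^esub> h"] upper_mccool_apply free_gen_closed)

lemma mccool_cochain_mult:
  assumes "g \<in> carrier (upper_mccool n)" "h \<in> carrier (upper_mccool n)" "i \<in> {1..n}"
    "1 \<le> k" "k < j" "j < i"
  shows "mccool_cochain i j k (g \<otimes>\<^bsub>upper_mccool n\<^esub> h) = mccool_cochain i j k g + mccool_cochain i j k h
    + mccool_char i j h * (mccool_char i k g - mccool_char j k g)"
  using mccool_cochain_comp[OF assms(1,2)[THEN triangular_upper_mccool] assms(3-6)] assms
  by (simp add: mccool_cochain_def[of _ _ _ "g \<otimes>\<^bsub>upper_mccool n\<^esub> h"] upper_mccool_apply free_gen_closed)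

lemma mccool_char_gen:
  assumes "1 \<le> j" "j < i" "i \<le> n" "1 \<le> t" "t < s" "s \<le> n"
  shows "mccool_char s t (mccool_gen n i j) = (if (s, t) = (i, j) then 1 else 0)"
proof -
  have s: "s \<in> {1..n}" and j: "j \<in> {1..n}" using assms by auto
  show ?thesis
    using assms(4-6) free_gen_closed[OF j]
    by (auto simp: mccool_char_def mccool_gen_apply[OF assms(1-3) s])
qed

text \<open>This makes the coordinates separate the points of degree-one cohomology; the dual
  characters of \<open>mccool_char_gen\<close> then make every coordinate vector occur.\<close>

lemma additive_on_upper_mccool_eqI:
  fixes f f' :: "(nat word \<Rightarrow> nat word) \<Rightarrow> complex"
  assumes f: "\<And>g h. g \<in> carrier (upper_mccool n) \<Longrightarrow> h \<in> carrier (upper_mccool n) \<Longrightarrow>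
      f (g \<otimes>\<^bsub>upper_mccool n\<^esub> h) = f g + f h"
    and f': "\<And>g h. g \<in> carrier (upper_mccool n) \<Longrightarrow> h \<in> carrier (upper_mccool n) \<Longrightarrow>
      f' (g \<otimes>\<^bsub>upper_mccool n\<^esub> h) = f' g + f' h"
    and eq: "\<And>i j. 1 \<le> j \<Longrightarrow> j < i \<Longrightarrow> i \<le> n \<Longrightarrow> f (mccool_gen n i j) = f' (mccool_gen n i j)"
    and g: "g \<in> carrier (upper_mccool n)"
  shows "f g = f' g"
proof -
  interpret A: group "AutoGroup (free_group_n n)" by (rule group_AutoGroup_free)
  interpret G: group "upper_mccool n" by (rule group_upper_mccool)
  let ?A = "AutoGroup (free_group_n n)"
  have one: "f \<one>\<^bsub>?A\<^esub> = 0" "f' \<one>\<^bsub>?A\<^esub> = 0"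
    using f[OF G.one_closed G.one_closed] f'[OF G.one_closed G.one_closed] G.l_one[OF G.one_closed]
    by (simp_all add: upper_mccool_simps(3))
  show ?thesis
    using g unfolding upper_mccool_simps(1)
  proof (induction rule: generate.induct)
    case one
    then show ?case by (simp add: \<open>f \<one>\<^bsub>?A\<^esub> = 0\<close> \<open>f' \<one>\<^bsub>?A\<^esub> = 0\<close>)
  next
    case (incl h)
    then show ?case using eq by auto
  next
    case (inv h)
    then have h: "h \<in> carrier (upper_mccool n)" "inv\<^bsub>?A\<^esub> h \<in> carrier (upper_mccool n)" "h \<in> carrier ?A"
      using mccool_gens_subset by (auto simp: upper_mccool_simps intro: generate.intros)
    have "f h + f (inv\<^bsub>?A\<^esub> h) = 0" "f' h + f' (inv\<^bsub>?A\<^esub> h) = 0"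
      using f[OF h(1,2)] f'[OF h(1,2)] h(3) \<open>f \<one>\<^bsub>?A\<^esub> = 0\<close> \<open>f' \<one>\<^bsub>?A\<^esub> = 0\<close>
      by (simp_all add: upper_mccool_simps)
    moreover have "f h = f' h" using inv eq by auto
    ultimately show ?case by (metis add_left_cancel)
  next
    case (eng g h)
    then show ?case using f[of g h] f'[of g h] by (simp add: upper_mccool_simps)
  qed
qed

lemma upper_mccool_eqI:
  assumes "g \<in> carrier (upper_mccool n)" "h \<in> carrier (upper_mccool n)"
    and "\<And>x. x \<in> {1..n} \<Longrightarrow> g (free_gen x) = h (free_gen x)"
  shows "g = h"
  using assms(1,2)[THEN triangular_upper_mccool] assms(3)
  by (intro auto_free_group_eqI[of g "{1..n}" h]) (simp_all add: triangular_def)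

section \<open>McCool's commutation relations\<close>

lemma mccool_gen_conj:
  assumes "1 \<le> j" "j < i" "i \<le> n" "a \<in> {1..n}" "b \<in> {1..n}"
  shows "mccool_gen n i j (free_gen a \<otimes>\<^bsub>free_group_n n\<^esub> free_gen b \<otimes>\<^bsub>free_group_n n\<^esub> inv\<^bsub>free_group_n n\<^esub> (free_gen a))
    = mccool_gen n i j (free_gen a) \<otimes>\<^bsub>free_group_n n\<^esub> mccool_gen n i j (free_gen b)
      \<otimes>\<^bsub>free_group_n n\<^esub> inv\<^bsub>free_group_n n\<^esub> (mccool_gen n i j (free_gen a))"
proof -
  interpret g: group_hom "free_group_n n" "free_group_n n" "mccool_gen n i j"
    using triangular_mccool_gen(1)[OF assms(1-3)] by (intro auto_group_hom) (simp add: triangular_def)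
  show ?thesis using assms by (simp add: free_gen_closed)
qed

text \<open>The two automorphisms move different generators, and neither moves the conjugating
  letter of the other. The conjugating letters \<open>j\<close> and \<open>l\<close> may
  coincide.\<close>

lemma mccool_gen_commute:
  assumes ij: "1 \<le> j" "j < i" "i \<le> n" and kl: "1 \<le> l" "l < k" "k \<le> n"
    and dist: "i \<noteq> k" "i \<noteq> l" "j \<noteq> k"
  shows "mccool_gen n i j \<otimes>\<^bsub>upper_mccool n\<^esub> mccool_gen n k l =
    mccool_gen n k l \<otimes>\<^bsub>upper_mccool n\<^esub> mccool_gen n i j"
proof (rule upper_mccool_eqI)
  interpret G: group "upper_mccool n" by (rule group_upper_mccool)
  note gens = mccool_gen_closed[OF ij] mccool_gen_closed[OF kl]
  show "mccool_gen n i j \<otimes>\<^bsub>upper_mccool n\<^esub> mccool_gen n k l \<in> carrier (upper_mccool n)"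
    "mccool_gen n k l \<otimes>\<^bsub>upper_mccool n\<^esub> mccool_gen n i j \<in> carrier (upper_mccool n)"
    using gens by simp_all
  fix x assume x: "x \<in> {1..n}"
  then show "(mccool_gen n i j \<otimes>\<^bsub>upper_mccool n\<^esub> mccool_gen n k l) (free_gen x) =
    (mccool_gen n k l \<otimes>\<^bsub>upper_mccool n\<^esub> mccool_gen n i j) (free_gen x)"
    using dist ij kl
    by (simp add: upper_mccool_apply gens free_gen_closed mccool_gen_apply[OF ij]
        mccool_gen_apply[OF kl] mccool_gen_conj[OF ij] mccool_gen_conj[OF kl])
qed

text \<open>The product \<alpha>_ik \<alpha>_jk conjugates \<open>x_i\<close> and \<open>x_j\<close>
  simultaneously by \<open>x_k\<close>, hence also \<open>x_j x_i x_j^-1\<close>, while \<alpha>_ij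
  fixes \<open>x_k\<close>.\<close>

lemma mccool_gen_commute_mult:
  assumes ord: "1 \<le> k" "k < j" "j < i" "i \<le> n"
  shows "mccool_gen n i j \<otimes>\<^bsub>upper_mccool n\<^esub> (mccool_gen n i k \<otimes>\<^bsub>upper_mccool n\<^esub> mccool_gen n j k) =
    (mccool_gen n i k \<otimes>\<^bsub>upper_mccool n\<^esub> mccool_gen n j k) \<otimes>\<^bsub>upper_mccool n\<^esub> mccool_gen n i j"
proof (rule upper_mccool_eqI)
  interpret G: group "upper_mccool n" by (rule group_upper_mccool)
  interpret F: group "free_group_n n" by (rule group_free_group)
  have ij: "1 \<le> j" "j < i" "i \<le> n" and ik: "1 \<le> k" "k < i" "i \<le> n" and jk: "1 \<le> k" "k < j" "j \<le> n"
    using ord by auto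
  note gens = mccool_gen_closed[OF ij] mccool_gen_closed[OF ik] mccool_gen_closed[OF jk]
  show "mccool_gen n i j \<otimes>\<^bsub>upper_mccool n\<^esub> (mccool_gen n i k \<otimes>\<^bsub>upper_mccool n\<^esub> mccool_gen n j k)
      \<in> carrier (upper_mccool n)"
    "(mccool_gen n i k \<otimes>\<^bsub>upper_mccool n\<^esub> mccool_gen n j k) \<otimes>\<^bsub>upper_mccool n\<^esub> mccool_gen n i j
      \<in> carrier (upper_mccool n)"
    using gens by simp_all
  fix x assume x: "x \<in> {1..n}"
  have h: "mccool_gen n p q \<in> hom (free_group_n n) (free_group_n n)" if "1 \<le> q" "q < p" "p \<le> n" for p q
    using triangular_mccool_gen(1)[OF that] by (simp add: triangular_def auto_def)
  interpret ij: group_hom "free_group_n n" "free_group_n n" "mccool_gen n i j"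
    by (simp add: group_hom_def group_hom_axioms_def h[OF ij] F.group_axioms)
  interpret ik: group_hom "free_group_n n" "free_group_n n" "mccool_gen n i k"
    by (simp add: group_hom_def group_hom_axioms_def h[OF ik] F.group_axioms)
  interpret jk: group_hom "free_group_n n" "free_group_n n" "mccool_gen n j k"
    by (simp add: group_hom_def group_hom_axioms_def h[OF jk] F.group_axioms)
  have cancel: "inv\<^bsub>free_group_n n\<^esub> u \<otimes>\<^bsub>free_group_n n\<^esub> (u \<otimes>\<^bsub>free_group_n n\<^esub> w) = w"
    if "u \<in> carrier (free_group_n n)" "w \<in> carrier (free_group_n n)" for u w
    using that by (simp add: F.m_assoc[symmetric])
  show "(mccool_gen n i j \<otimes>\<^bsub>upper_mccool n\<^esub> (mccool_gen n i k \<otimes>\<^bsub>upper_mccool n\<^esub> mccool_gen n j k)) (free_gen x) =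
    ((mccool_gen n i k \<otimes>\<^bsub>upper_mccool n\<^esub> mccool_gen n j k) \<otimes>\<^bsub>upper_mccool n\<^esub> mccool_gen n i j) (free_gen x)"
    using ord x
    by (simp add: upper_mccool_apply gens free_gen_closed mccool_gen_apply
        F.m_assoc cancel F.inv_mult_group)
qed


section \<open>Dimension, quotients and Zariski irreducibility\<close>

abbreviation submod :: "(complex, 'v, 'm) module_scheme \<Rightarrow> 'v set \<Rightarrow> bool" where
  "submod V W \<equiv> submodule class_ring W V"

abbreviation linear_forms :: "(complex, 'v, 'm) module_scheme \<Rightarrow> ('v \<Rightarrow> complex) set" where
  "linear_forms V \<equiv> LinearCombinations.module_hom class_ring V complex_line"

abbreviation vspan :: "(complex, 'v, 'm) module_scheme \<Rightarrow> 'v set \<Rightarrow> 'v set" where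
  "vspan V \<equiv> LinearCombinations.module.span class_ring V"

lemma linear_forms_iff:
  "f \<in> linear_forms V \<longleftrightarrow>
    (\<forall>v\<in>carrier V. \<forall>w\<in>carrier V. f (v \<oplus>\<^bsub>V\<^esub> w) = f v + f w) \<and>
    (\<forall>c. \<forall>v\<in>carrier V. f (c \<odot>\<^bsub>V\<^esub> v) = c * f v)"
  by (auto simp: LinearCombinations.module_hom_def complex_line_def)

lemma linear_forms_subspace:
  "f \<in> linear_forms V \<Longrightarrow> W \<subseteq> carrier V \<Longrightarrow> f \<in> linear_forms (V\<lparr>carrier := W\<rparr>)"
  by (simp add: linear_forms_iff subset_iff)

lemma linear_forms_add:
  "f \<in> linear_forms V \<Longrightarrow> f' \<in> linear_forms V \<Longrightarrow> (\<lambda>v. f v + f' v) \<in> linear_forms V"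
  unfolding linear_forms_iff by (auto simp: algebra_simps)

locale cvs = vectorspace "class_ring :: complex ring" V for V (structure)
begin

lemma smult_in [simp, intro]: "v \<in> carrier V \<Longrightarrow> (c :: complex) \<odot>\<^bsub>V\<^esub> v \<in> carrier V"
  by (rule smult_closed) simp_all

lemma complex_smult_simps:
  fixes a b :: complex
  assumes "v \<in> carrier V"
  shows "(a + b) \<odot>\<^bsub>V\<^esub> v = a \<odot>\<^bsub>V\<^esub> v \<oplus>\<^bsub>V\<^esub> b \<odot>\<^bsub>V\<^esub> v"
    and "(a * b) \<odot>\<^bsub>V\<^esub> v = a \<odot>\<^bsub>V\<^esub> (b \<odot>\<^bsub>V\<^esub> v)"
    and "(1 :: complex) \<odot>\<^bsub>V\<^esub> v = v"
    and "(- 1 :: complex) \<odot>\<^bsub>V\<^esub> v = \<ominus>\<^bsub>V\<^esub> v"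
  using smult_l_distr[of a b v] smult_assoc1[of a b v] smult_one[of v] smult_minus_1[of v] assms
  by (simp_all add: class_ring_simps)

lemma linear_form_zero: "f \<in> linear_forms V \<Longrightarrow> f \<zero>\<^bsub>V\<^esub> = 0"
  using M.zero_closed M.l_zero[OF M.zero_closed] unfolding linear_forms_iff by (metis add_cancel_right_right)

lemma linear_form_lincomb:
  assumes f: "f \<in> linear_forms V" and B: "B \<subseteq> carrier V" "finite B"
  shows "f (lincomb a B) = (\<Sum>b\<in>B. a b * f b)"
  using B(2,1)
proof (induction B rule: finite_induct)
  case empty
  then show ?case using linear_form_zero[OF f] by (simp add: lincomb_def)
next
  case (insert b B)
  then have "f (lincomb a (insert b B)) = f (a b \<odot>\<^bsub>V\<^esub> b \<oplus>\<^bsub>V\<^esub> lincomb a B)"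
    unfolding lincomb_def by (subst M.finsum_insert) auto
  also have "\<dots> = a b * f b + f (lincomb a B)"
    using f insert.prems by (auto simp: linear_forms_iff)
  finally show ?case using insert by simp
qed

text \<open>The dual forms certify independence: \<open>f i\<close> extracts the coefficient of
  \<open>e i\<close> from any combination.\<close>

lemma has_dimensionI:
  assumes "finite I" and e: "e \<in> I \<rightarrow> carrier V"
    and f: "\<And>i. i \<in> I \<Longrightarrow> f i \<in> linear_forms V"
    and dual: "\<And>i k. i \<in> I \<Longrightarrow> k \<in> I \<Longrightarrow> f i (e k) = (if i = k then 1 else 0)"
    and span: "span (e ` I) = carrier V"
  shows "has_dimension V (card I)"
proof -
  have inj: "inj_on e I"
    using dual by (intro inj_onI) (metis zero_neq_one)
  have eI: "e ` I \<subseteq> carrier V" "finite (e ` I)"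
    using e \<open>finite I\<close> by auto
  have "lin_indpt (e ` I)"
  proof (rule finite_lin_indpt2[OF eI(2,1)], intro ballI)
    fix a v assume a: "lincomb a (e ` I) = \<zero>\<^bsub>V\<^esub>" and "v \<in> e ` I"
    then obtain i where i: "i \<in> I" "v = e i" by auto
    have "0 = (\<Sum>b\<in>e ` I. a b * f i b)"
      using linear_form_lincomb[OF f[OF i(1)] eI, of a] linear_form_zero[OF f[OF i(1)]] a by simp
    also have "\<dots> = (\<Sum>k\<in>I. a (e k) * f i (e k))"
      by (simp add: sum.reindex[OF inj])
    also have "\<dots> = (\<Sum>k\<in>I. if k = i then a (e k) else 0)"
      using dual i(1) by (intro sum.cong) auto
    also have "\<dots> = a v" using i \<open>finite I\<close> by simp
    finally show "a v = \<zero>\<^bsub>class_ring\<^esub>" by simp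
  qed
  then have "basis (e ` I)"
    using eI span by (simp add: basis_def)
  then have "dim = card I"
    using dim_basis[OF eI(2)] card_image[OF inj] by simp
  moreover have "fin_dim"
    using eI span unfolding fin_dim_def by blast
  ultimately show ?thesis
    using vectorspace_axioms by (simp add: has_dimension_def)
qed

text \<open>The difference between \<open>v\<close> and its expansion with coefficients
  \<open>f i v\<close> is killed by all forms, hence zero by \<open>sep\<close>.\<close>

lemma span_eqI:
  assumes "finite I" and e: "e \<in> I \<rightarrow> carrier V"
    and f: "\<And>i. i \<in> I \<Longrightarrow> f i \<in> linear_forms V"
    and dual: "\<And>i k. i \<in> I \<Longrightarrow> k \<in> I \<Longrightarrow> f i (e k) = (if i = k then 1 else 0)"
    and sep: "\<And>v. v \<in> carrier V \<Longrightarrow> (\<And>i. i \<in> I \<Longrightarrow> f i v = 0) \<Longrightarrow> v = \<zero>\<^bsub>V\<^esub>"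
  shows "span (e ` I) = carrier V"
proof
  have inj: "inj_on e I"
    using dual by (intro inj_onI) (metis zero_neq_one)
  have eI: "e ` I \<subseteq> carrier V" "finite (e ` I)"
    using e \<open>finite I\<close> by auto
  show "span (e ` I) \<subseteq> carrier V"
    by (rule span_is_subset2[OF eI(1)])
  show "carrier V \<subseteq> span (e ` I)"
  proof
    fix v assume v: "v \<in> carrier V"
    \<comment> \<open>The coefficient of \<open>e i\<close> is \<open>f i v\<close>; a linear
      combination is indexed by vectors, so \<open>i\<close> is recovered from
      \<open>e i\<close>.\<close>
    define a where "a = (\<lambda>b. f (the_inv_into I e b) v)"
    have lc: "lincomb a (e ` I) \<in> carrier V"
      using eI by auto
    have m1: "(- 1 :: complex) \<odot>\<^bsub>V\<^esub> lincomb a (e ` I) = \<ominus>\<^bsub>V\<^esub> lincomb a (e ` I)"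
      using lc by (rule complex_smult_simps)
    have "v \<ominus>\<^bsub>V\<^esub> lincomb a (e ` I) = \<zero>\<^bsub>V\<^esub>"
    proof (rule sep)
      show "v \<ominus>\<^bsub>V\<^esub> lincomb a (e ` I) \<in> carrier V"
        using v lc by simp
      fix i assume i: "i \<in> I"
      have "f i (lincomb a (e ` I)) = (\<Sum>b\<in>e ` I. a b * f i b)"
        by (rule linear_form_lincomb[OF f[OF i] eI])
      also have "\<dots> = (\<Sum>k\<in>I. a (e k) * f i (e k))"
        by (simp add: sum.reindex[OF inj])
      also have "\<dots> = (\<Sum>k\<in>I. if k = i then f k v else 0)"
        using dual i by (intro sum.cong) (auto simp: a_def the_inv_into_f_f[OF inj])
      also have "\<dots> = f i v" using i \<open>finite I\<close> by simp
      finally have "f i (lincomb a (e ` I)) = f i v" .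
      moreover have "f i (v \<ominus>\<^bsub>V\<^esub> lincomb a (e ` I)) = f i v - f i (lincomb a (e ` I))"
        using f[OF i] v lc unfolding a_minus_def m1[symmetric] by (simp add: linear_forms_iff)
      ultimately show "f i (v \<ominus>\<^bsub>V\<^esub> lincomb a (e ` I)) = 0" by simp
    qed
    then have "v = lincomb a (e ` I)"
      using M.minus_other_side[OF v lc] by blast
    moreover have "lincomb a (e ` I) \<in> span (e ` I)"
      unfolding span_def by (rule CollectI, rule exI[of _ a], rule exI[of _ "e ` I"]) (simp add: eI)
    ultimately show "v \<in> span (e ` I)"
      by (rule ssubst)
  qed
qed

lemma submodI:
  assumes "W \<subseteq> carrier V" "\<zero>\<^bsub>V\<^esub> \<in> W"
    and "\<And>v w. v \<in> W \<Longrightarrow> w \<in> W \<Longrightarrow> v \<oplus>\<^bsub>V\<^esub> w \<in> W"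
    and "\<And>c v. v \<in> W \<Longrightarrow> c \<odot>\<^bsub>V\<^esub> v \<in> W"
  shows "submod V W"
  using assms by unfold_locales auto

lemma cvs_submod: "submod V W \<Longrightarrow> cvs (V\<lparr>carrier := W\<rparr>)"
  unfolding cvs_def by (intro subspace_is_vs subspace.intro vectorspace_axioms)

lemma submod_subspace: "submod V W \<Longrightarrow> VectorSpace.subspace class_ring W V"
  by (intro subspace.intro vectorspace_axioms)

end

subsection \<open>Quotients\<close>

context cvs
begin

context
  fixes W assumes W: "submod V W"
begin

lemma abelian_subgroup_submod: "abelian_subgroup W V"
proof (rule abelian_subgroupI3)
  interpret W: submodule class_ring W V by (rule W)
  have "\<ominus>\<^bsub>V\<^esub> x \<in> W" if "x \<in> W" for x
  proof -
    have "(- 1 :: complex) \<odot>\<^bsub>V\<^esub> x \<in> W"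
      using that by (intro W.smult_closed) simp_all
    then show ?thesis unfolding complex_smult_simps(4)[OF subsetD[OF W.subset that]] .
  qed
  then show "additive_subgroup W V"
    using W.subset by unfold_locales (auto simp: a_inv_def)
qed unfold_locales

interpretation abelian_subgroup W V by (rule abelian_subgroup_submod)

lemma quotient_carrier: "carrier (quotient_space V W) = (\<lambda>x. W +>\<^bsub>V\<^esub> x) ` carrier V"
  by (auto simp: quotient_space_def A_RCOSETS_def')

lemma quotient_add:
  "x \<in> carrier V \<Longrightarrow> y \<in> carrier V \<Longrightarrow>
    (W +>\<^bsub>V\<^esub> x) \<oplus>\<^bsub>quotient_space V W\<^esub> (W +>\<^bsub>V\<^esub> y) = W +>\<^bsub>V\<^esub> (x \<oplus>\<^bsub>V\<^esub> y)"
  by (simp add: quotient_space_def a_rcos_sum)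

lemma quotient_zero: "\<zero>\<^bsub>quotient_space V W\<^esub> = W" "\<zero>\<^bsub>quotient_space V W\<^esub> = W +>\<^bsub>V\<^esub> \<zero>\<^bsub>V\<^esub>"
  using a_subset by (simp_all add: quotient_space_def)

lemma coset_eq_iff:
  assumes "x \<in> carrier V" "y \<in> carrier V"
  shows "W +>\<^bsub>V\<^esub> x = W +>\<^bsub>V\<^esub> y \<longleftrightarrow> x \<ominus>\<^bsub>V\<^esub> y \<in> W"
proof -
  have "W +>\<^bsub>V\<^esub> x = W +>\<^bsub>V\<^esub> y \<longleftrightarrow> x \<in> W +>\<^bsub>V\<^esub> y"
    using assms a_rcos_self a_repr_independence[of x W y] a_subgroup by auto
  also have "\<dots> \<longleftrightarrow> x \<ominus>\<^bsub>V\<^esub> y \<in> W"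
    using assms a_subset by (simp add: a_rcos_module a_minus_def)
  finally show ?thesis .
qed

text \<open>Representatives of one coset differ by elements of \<open>W\<close>, which is stable
  under scalars, so the union defining \<open>smult\<close> runs over a single repeated
  coset.\<close>

lemma quotient_smult:
  assumes "x \<in> carrier V"
  shows "c \<odot>\<^bsub>quotient_space V W\<^esub> (W +>\<^bsub>V\<^esub> x) = W +>\<^bsub>V\<^esub> (c \<odot>\<^bsub>V\<^esub> x)"
proof -
  interpret W: submodule class_ring W V by (rule W)
  have "W +>\<^bsub>V\<^esub> (c \<odot>\<^bsub>V\<^esub> y) = W +>\<^bsub>V\<^esub> (c \<odot>\<^bsub>V\<^esub> x)" if "y \<in> W +>\<^bsub>V\<^esub> x" for y
  proof -
    have y: "y \<in> carrier V"
      using that a_r_coset_subset_G[OF a_subset assms] by auto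
    then have "y \<ominus>\<^bsub>V\<^esub> x \<in> W"
      using that assms by (simp add: a_rcos_module a_minus_def)
    then have "c \<odot>\<^bsub>V\<^esub> (y \<ominus>\<^bsub>V\<^esub> x) \<in> W" by auto
    also have "c \<odot>\<^bsub>V\<^esub> (y \<ominus>\<^bsub>V\<^esub> x) = c \<odot>\<^bsub>V\<^esub> y \<ominus>\<^bsub>V\<^esub> c \<odot>\<^bsub>V\<^esub> x"
      unfolding a_minus_def using smult_r_distr[of c y "\<ominus>\<^bsub>V\<^esub> x"] smult_r_minus[of c x] y assms by simp
    finally show ?thesis using y assms by (simp add: coset_eq_iff)
  qed
  moreover have "W +>\<^bsub>V\<^esub> x \<noteq> {}" using a_rcos_self[OF assms] by auto
  ultimately have "(\<Union>y\<in>W +>\<^bsub>V\<^esub> x. W +>\<^bsub>V\<^esub> (c \<odot>\<^bsub>V\<^esub> y)) = W +>\<^bsub>V\<^esub> (c \<odot>\<^bsub>V\<^esub> x)"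
    by (intro SUP_eq_const)
  then show ?thesis
    unfolding quotient_space_def by simp
qed

lemma cvs_quotient: "cvs (quotient_space V W)"
  unfolding cvs_def
proof (rule vs_criteria)
  have neg: "\<exists>y\<in>carrier V. W +>\<^bsub>V\<^esub> (x \<oplus>\<^bsub>V\<^esub> y) = W +>\<^bsub>V\<^esub> \<zero>\<^bsub>V\<^esub>" if "x \<in> carrier V" for x
    using that by (intro bexI[of _ "\<ominus>\<^bsub>V\<^esub> x"]) (simp_all add: M.r_neg)
  show "\<forall>v\<in>carrier (quotient_space V W). \<exists>neg_v\<in>carrier (quotient_space V W).
      v \<oplus>\<^bsub>quotient_space V W\<^esub> neg_v = \<zero>\<^bsub>quotient_space V W\<^esub>"
    using neg by (auto simp: quotient_carrier quotient_add quotient_zero(2) simp del: a_coset_add_zero)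
qed (auto simp: quotient_carrier quotient_add quotient_smult quotient_zero(2) class_field
    M.a_ac complex_smult_simps smult_r_distr simp del: a_coset_add_zero)

end

end


subsection \<open>Unions of linear subspaces\<close>

context cvs
begin

text \<open>Irreducibility is tested on lines only, where polynomial functions become univariate
  polynomials.\<close>

lemma polynomial_function_on_line:
  assumes "f \<in> polynomial_functions V" and v: "v \<in> carrier V" "w \<in> carrier V"
  shows "\<exists>p. \<forall>t. f (v \<oplus>\<^bsub>V\<^esub> t \<odot>\<^bsub>V\<^esub> w) = poly p t"
  using assms(1)
proof (induction rule: polynomial_functions.induct)
  case (const c)
  show ?case by (rule exI[of _ "[:c:]"]) simp
next
  case (linear f)
  then show ?case
    using v by (intro exI[of _ "[:f v, f w:]"]) (auto simp: linear_forms_iff)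
next
  case (add f g)
  then show ?case by (metis poly_add)
next
  case (mult f g)
  then show ?case by (metis poly_mult)
qed

text \<open>If neither closed set contains \<open>L\<close>, take \<open>v\<close> in
  \<open>L\<close> outside one and \<open>w\<close> in \<open>L\<close> outside the other. On the
  line through them the two witnessing polynomials are nonzero in one variable, so they have a
  common non-root: a point of \<open>L\<close> outside both sets.\<close>

lemma zariski_irreducible_submod:
  assumes L: "submod V L"
  shows "zariski_irreducible V L"
  unfolding zariski_irreducible_def
proof (intro conjI allI impI)
  interpret L: submodule class_ring L V by (rule L)
  show "L \<subseteq> carrier V" by (rule L.subset)
  show "L \<noteq> {}" using L.zero_closed by blast
  fix Y Z assume "zariski_closed V Y \<and> zariski_closed V Z \<and> L \<subseteq> Y \<union> Z"
  then obtain P Q where P: "P \<subseteq> polynomial_functions V" "Y = {v \<in> carrier V. \<forall>p\<in>P. p v = 0}"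
    and Q: "Q \<subseteq> polynomial_functions V" "Z = {v \<in> carrier V. \<forall>p\<in>Q. p v = 0}"
    and LYZ: "L \<subseteq> Y \<union> Z"
    unfolding zariski_closed_def by blast
  show "L \<subseteq> Y \<or> L \<subseteq> Z"
  proof (rule ccontr)
    assume "\<not> (L \<subseteq> Y \<or> L \<subseteq> Z)"
    then obtain v w p q where v: "v \<in> L" "p \<in> P" "p v \<noteq> 0" and w: "w \<in> L" "q \<in> Q" "q w \<noteq> 0"
      using L.subset P Q by blast
    have V: "v \<in> carrier V" "w \<in> carrier V" using v w L.subset by auto
    \<comment> \<open>The direction \<open>w - v\<close>, so that the parameters \<open>0\<close>
      and \<open>1\<close> give \<open>v\<close> and \<open>w\<close>.\<close>
    define u where "u = w \<oplus>\<^bsub>V\<^esub> (- 1 :: complex) \<odot>\<^bsub>V\<^esub> v"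
    have u: "u \<in> L" "u \<in> carrier V"
      using v w V by (auto simp: u_def)
    have line: "v \<oplus>\<^bsub>V\<^esub> t \<odot>\<^bsub>V\<^esub> u \<in> L" for t :: complex
      using v u by auto
    obtain p' q' where p': "\<And>t. p (v \<oplus>\<^bsub>V\<^esub> t \<odot>\<^bsub>V\<^esub> u) = poly p' t"
      and q': "\<And>t. q (v \<oplus>\<^bsub>V\<^esub> t \<odot>\<^bsub>V\<^esub> u) = poly q' t"
      using polynomial_function_on_line[OF _ V(1) u(2)] P Q v(2) w(2) by (meson subset_iff)
    have "v \<oplus>\<^bsub>V\<^esub> (0 :: complex) \<odot>\<^bsub>V\<^esub> u = v"
      using lmult_0[OF u(2)] V by simp
    then have "poly p' 0 \<noteq> 0" using p'[of 0] v(3) by simp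
    moreover have "v \<oplus>\<^bsub>V\<^esub> (1 :: complex) \<odot>\<^bsub>V\<^esub> u = w"
    proof -
      show ?thesis
        unfolding complex_smult_simps(3)[OF u(2)] unfolding u_def complex_smult_simps(4)[OF V(1)]
        using V M.a_lcomm[of v w "\<ominus>\<^bsub>V\<^esub> v"] by (simp add: M.r_neg)
    qed
    then have "poly q' 1 \<noteq> 0" using q'[of 1] w(3) by simp
    ultimately have "p' * q' \<noteq> 0" by auto
    then have "finite {t. poly (p' * q') t = 0}" by (rule poly_roots_finite)
    then obtain t where "poly (p' * q') t \<noteq> 0"
      using ex_new_if_finite[OF infinite_UNIV_char_0] by blast
    then have "p (v \<oplus>\<^bsub>V\<^esub> t \<odot>\<^bsub>V\<^esub> u) \<noteq> 0" "q (v \<oplus>\<^bsub>V\<^esub> t \<odot>\<^bsub>V\<^esub> u) \<noteq> 0"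
      using p' q' by auto
    then show False
      using line[of t] LYZ P(2) Q(2) v(2) w(2) by blast
  qed
qed

end

section \<open>Irreducible components of finite unions\<close>

lemma zariski_closed_Un:
  assumes "zariski_closed V Y" "zariski_closed V Z"
  shows "zariski_closed V (Y \<union> Z)"
proof -
  obtain P Q where P: "P \<subseteq> polynomial_functions V" "Y = {v \<in> carrier V. \<forall>p\<in>P. p v = 0}"
    and Q: "Q \<subseteq> polynomial_functions V" "Z = {v \<in> carrier V. \<forall>p\<in>Q. p v = 0}"
    using assms unfolding zariski_closed_def by blast
  let ?PQ = "(\<lambda>(p, q) v. p v * q v) ` (P \<times> Q)"
  have "Y \<union> Z = {v \<in> carrier V. \<forall>p\<in>P. \<forall>q\<in>Q. p v = 0 \<or> q v = 0}"
    unfolding P(2) Q(2) by blast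
  also have "\<dots> = {v \<in> carrier V. \<forall>p\<in>?PQ. p v = 0}"
    by simp
  finally have "Y \<union> Z = {v \<in> carrier V. \<forall>p\<in>?PQ. p v = 0}" .
  moreover have "?PQ \<subseteq> polynomial_functions V"
    using P(1) Q(1) by (auto intro!: polynomial_functions.mult)
  ultimately show ?thesis unfolding zariski_closed_def by blast
qed

lemma zariski_closed_empty: "zariski_closed V {}"
  unfolding zariski_closed_def
  by (intro exI[of _ "{\<lambda>_. 1}"]) (auto intro: polynomial_functions.const)

lemma zariski_closed_Union:
  "finite A \<Longrightarrow> (\<And>Z. Z \<in> A \<Longrightarrow> zariski_closed V Z) \<Longrightarrow> zariski_closed V (\<Union>A)"
  by (induction A rule: finite_induct) (auto intro: zariski_closed_Un zariski_closed_empty)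

lemma zariski_irreducible_subset_Union:
  assumes S: "zariski_irreducible V S" and "finite A" "\<And>Z. Z \<in> A \<Longrightarrow> zariski_closed V Z" "S \<subseteq> \<Union>A"
  shows "\<exists>Z\<in>A. S \<subseteq> Z"
  using assms(2-)
proof (induction A rule: finite_induct)
  case empty
  then show ?case using S by (simp add: zariski_irreducible_def)
next
  case (insert Z A)
  have "zariski_closed V (\<Union>A)"
    using insert by (intro zariski_closed_Union) auto
  then have "S \<subseteq> Z \<or> S \<subseteq> \<Union>A"
    using S insert.prems unfolding zariski_irreducible_def by (simp add: Union_insert)
  then show ?case using insert by auto
qed

text \<open>An irreducible subset of a finite union of closed sets lies in one of them, so a maximal
  one is a member of \<open>A\<close>. Conversely, \<open>anti\<close> makes each member
  maximal.\<close>

lemma irreducible_components_Union: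
  assumes "finite A" and closed: "\<And>Z. Z \<in> A \<Longrightarrow> zariski_closed V Z"
    and irred: "\<And>Z. Z \<in> A \<Longrightarrow> zariski_irreducible V Z"
    and anti: "\<And>Y Z. Y \<in> A \<Longrightarrow> Z \<in> A \<Longrightarrow> Y \<subseteq> Z \<Longrightarrow> Y = Z"
  shows "irreducible_components V (\<Union>A) = A"
proof (intro equalityI subsetI)
  fix S assume "S \<in> irreducible_components V (\<Union>A)"
  then have S: "S \<subseteq> \<Union>A" "zariski_irreducible V S"
    and max: "\<And>T. T \<subseteq> \<Union>A \<Longrightarrow> zariski_irreducible V T \<Longrightarrow> S \<subseteq> T \<Longrightarrow> T = S"
    by (auto simp: irreducible_components_def)
  obtain Z where Z: "Z \<in> A" "S \<subseteq> Z"
    using zariski_irreducible_subset_Union[OF S(2) \<open>finite A\<close> closed S(1)] by blast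
  then have "Z = S" using max[of Z] irred by blast
  then show "S \<in> A" using Z by simp
next
  fix Z assume Z: "Z \<in> A"
  have "T = Z" if T: "T \<subseteq> \<Union>A" "zariski_irreducible V T" "Z \<subseteq> T" for T
  proof -
    obtain Y where "Y \<in> A" "T \<subseteq> Y"
      using zariski_irreducible_subset_Union[OF T(2) \<open>finite A\<close> closed T(1)] by blast
    then show ?thesis using anti[OF Z, of Y] T(3) by auto
  qed
  then show "Z \<in> irreducible_components V (\<Union>A)"
    using Z irred by (auto simp: irreducible_components_def)
qed

lemma zariski_closed_linear:
  "P \<subseteq> linear_forms V \<Longrightarrow> zariski_closed V {v \<in> carrier V. \<forall>p\<in>P. p v = 0}"
  unfolding zariski_closed_def by (intro exI[of _ P]) (auto intro: polynomial_functions.linear)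


section \<open>Cohomology in degrees one and two\<close>

definition additive_on :: "('a, 'm) monoid_scheme \<Rightarrow> ('a \<Rightarrow> complex) \<Rightarrow> bool" where
  "additive_on G f \<longleftrightarrow> (\<forall>g\<in>carrier G. \<forall>h\<in>carrier G. f (g \<otimes>\<^bsub>G\<^esub> h) = f g + f h)"

text \<open>Cochains are extensional functions on lists. \<open>cochain1\<close> and
  \<open>cochain2\<close> present them by ordinary functions of one or two group elements.\<close>

definition cochain1 :: "('a, 'm) monoid_scheme \<Rightarrow> ('a \<Rightarrow> complex) \<Rightarrow> 'a list \<Rightarrow> complex" where
  "cochain1 G f = (\<lambda>gs\<in>tuples G 1. f (hd gs))"

definition cochain2 :: "('a, 'm) monoid_scheme \<Rightarrow> ('a \<Rightarrow> 'a \<Rightarrow> complex) \<Rightarrow> 'a list \<Rightarrow> complex" where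
  "cochain2 G F = (\<lambda>gs\<in>tuples G 2. F (hd gs) (hd (tl gs)))"

definition cocycle2 :: "('a, 'm) monoid_scheme \<Rightarrow> ('a \<Rightarrow> 'a \<Rightarrow> complex) \<Rightarrow> bool" where
  "cocycle2 G F \<longleftrightarrow> (\<forall>g\<in>carrier G. \<forall>h\<in>carrier G. \<forall>k\<in>carrier G.
    F h k - F (g \<otimes>\<^bsub>G\<^esub> h) k + F g (h \<otimes>\<^bsub>G\<^esub> k) - F g h = 0)"

text \<open>A singleton, because with trivial coefficients the only 1-coboundary is zero.\<close>

definition class1 :: "('a, 'm) monoid_scheme \<Rightarrow> ('a \<Rightarrow> complex) \<Rightarrow> ('a list \<Rightarrow> complex) set" where
  "class1 G f = {cochain1 G f}"

definition class2 :: "('a, 'm) monoid_scheme \<Rightarrow> ('a \<Rightarrow> 'a \<Rightarrow> complex) \<Rightarrow> ('a list \<Rightarrow> complex) set" where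
  "class2 G F = coboundaries G 2 +>\<^bsub>cochains G 2\<^esub> cochain2 G F"

text \<open>For commuting \<open>g\<close> and \<open>h\<close>, evaluation on the 2-cycle
  \<open>[g|h] - [h|g]\<close>, the image of the fundamental class of a torus. Only then is the
  value independent of the representative, so that \<open>the_elem\<close> meets a
  singleton.\<close>

definition comm_form :: "'a \<Rightarrow> 'a \<Rightarrow> ('a list \<Rightarrow> complex) set \<Rightarrow> complex" where
  "comm_form g h X = the_elem ((\<lambda>f. f [g, h] - f [h, g]) ` X)"

lemma tuples_iff:
  "gs \<in> tuples G 0 \<longleftrightarrow> gs = []"
  "gs \<in> tuples G 1 \<longleftrightarrow> (\<exists>g\<in>carrier G. gs = [g])"
  "gs \<in> tuples G 2 \<longleftrightarrow> (\<exists>g\<in>carrier G. \<exists>h\<in>carrier G. gs = [g, h])"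
  "gs \<in> tuples G 3 \<longleftrightarrow> (\<exists>g\<in>carrier G. \<exists>h\<in>carrier G. \<exists>k\<in>carrier G. gs = [g, h, k])"
proof -
  have three: "(3 :: nat) = Suc (Suc (Suc 0))" by simp
  show "gs \<in> tuples G 0 \<longleftrightarrow> gs = []"
    "gs \<in> tuples G 1 \<longleftrightarrow> (\<exists>g\<in>carrier G. gs = [g])"
    "gs \<in> tuples G 2 \<longleftrightarrow> (\<exists>g\<in>carrier G. \<exists>h\<in>carrier G. gs = [g, h])"
    "gs \<in> tuples G 3 \<longleftrightarrow> (\<exists>g\<in>carrier G. \<exists>h\<in>carrier G. \<exists>k\<in>carrier G. gs = [g, h, k])"
    unfolding tuples_def One_nat_def numeral_2_eq_2 three by (auto simp: length_Suc_conv)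
qed

lemma cochains_simps:
  "carrier (cochains G p) = (tuples G p \<rightarrow>\<^sub>E UNIV)"
  "\<zero>\<^bsub>cochains G p\<^esub> = (\<lambda>gs\<in>tuples G p. 0)"
  "f \<oplus>\<^bsub>cochains G p\<^esub> f' = (\<lambda>gs\<in>tuples G p. f gs + f' gs)"
  "c \<odot>\<^bsub>cochains G p\<^esub> f = (\<lambda>gs\<in>tuples G p. c * f gs)"
  by (simp_all add: cochains_def class_ring.func_space_def)

lemma cvs_cochains: "cvs (cochains G p)"
proof -
  have "Module.module (class_ring :: complex ring) (LinearCombinations.ring.func_space class_ring (tuples G p))"
    by (rule cring.func_space_is_module[OF class_cring.cring_axioms])
  then show ?thesis
    by (simp add: cvs_def vectorspace_def cochains_def class_field)
qed

lemma cochain1_apply [simp]: "g \<in> carrier G \<Longrightarrow> cochain1 G f [g] = f g"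
  by (simp add: cochain1_def tuples_iff)

lemma cochain2_apply [simp]:
  "g \<in> carrier G \<Longrightarrow> h \<in> carrier G \<Longrightarrow> cochain2 G F [g, h] = F g h"
  by (simp add: cochain2_def tuples_iff)

lemma cochain1_eq_iff: "cochain1 G f = cochain1 G f' \<longleftrightarrow> (\<forall>g\<in>carrier G. f g = f' g)"
  by (auto simp: cochain1_def tuples_iff fun_eq_iff restrict_def)

lemma cochain2_eq_iff:
  "cochain2 G F = cochain2 G F' \<longleftrightarrow> (\<forall>g\<in>carrier G. \<forall>h\<in>carrier G. F g h = F' g h)"
proof
  assume "cochain2 G F = cochain2 G F'"
  then show "\<forall>g\<in>carrier G. \<forall>h\<in>carrier G. F g h = F' g h"
    by (metis cochain2_apply)
qed (auto simp: cochain2_def tuples_iff intro!: restrict_ext)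

lemma carrier_cochains1: "carrier (cochains G 1) = range (cochain1 G)"
proof (intro equalityI subsetI)
  fix f assume "f \<in> carrier (cochains G 1)"
  then have "f = cochain1 G (\<lambda>g. f [g])"
    by (intro extensionalityI[of f "tuples G 1"])
      (auto simp: cochains_simps cochain1_def tuples_iff PiE_def)
  then show "f \<in> range (cochain1 G)" by blast
qed (auto simp: cochains_simps cochain1_def)

lemma carrier_cochains2: "carrier (cochains G 2) = range (cochain2 G)"
proof (intro equalityI subsetI)
  fix f assume "f \<in> carrier (cochains G 2)"
  then have "f = cochain2 G (\<lambda>g h. f [g, h])"
    by (intro extensionalityI[of f "tuples G 2"])
      (auto simp: cochains_simps cochain2_def tuples_iff PiE_def)
  then show "f \<in> range (cochain2 G)" by blast
qed (auto simp: cochains_simps cochain2_def)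

lemma cochain1_simps:
  "\<zero>\<^bsub>cochains G 1\<^esub> = cochain1 G (\<lambda>_. 0)"
  "cochain1 G f \<oplus>\<^bsub>cochains G 1\<^esub> cochain1 G f' = cochain1 G (\<lambda>g. f g + f' g)"
  "c \<odot>\<^bsub>cochains G 1\<^esub> cochain1 G f = cochain1 G (\<lambda>g. c * f g)"
  by (auto simp: cochains_simps cochain1_def)

lemma cochain2_simps:
  "\<zero>\<^bsub>cochains G 2\<^esub> = cochain2 G (\<lambda>_ _. 0)"
  "cochain2 G F \<oplus>\<^bsub>cochains G 2\<^esub> cochain2 G F' = cochain2 G (\<lambda>g h. F g h + F' g h)"
  "c \<odot>\<^bsub>cochains G 2\<^esub> cochain2 G F = cochain2 G (\<lambda>g h. c * F g h)"
  by (auto simp: cochains_simps cochain2_def)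

section \<open>Cocycles, classes and cup products for an arbitrary group\<close>

context group
begin

lemma coboundary0: "coboundary G 0 f = cochain1 G (\<lambda>_. 0)"
  unfolding coboundary_def cochain1_def One_nat_def[symmetric]
  by (intro restrict_ext) (auto simp: tuples_iff)

lemma coboundary1: "coboundary G 1 (cochain1 G f) = cochain2 G (\<lambda>g h. f h - f (g \<otimes> h) + f g)"
  unfolding coboundary_def cochain2_def Suc_1
  by (intro restrict_ext) (auto simp: tuples_iff)

lemma coboundary2:
  "coboundary G 2 (cochain2 G F) = \<zero>\<^bsub>cochains G 3\<^esub> \<longleftrightarrow> cocycle2 G F"
proof -
  have three: "Suc 2 = (3 :: nat)" by simp
  have "coboundary G 2 (cochain2 G F) [g, h, k] =
      F h k - F (g \<otimes> h) k + F g (h \<otimes> k) - F g h"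
    if "g \<in> carrier G" "h \<in> carrier G" "k \<in> carrier G" for g h k
    using that unfolding coboundary_def three
    by (simp add: tuples_iff numeral_2_eq_2 lessThan_Suc power3_eq_cube)
  moreover have "coboundary G 2 (cochain2 G F) = \<zero>\<^bsub>cochains G 3\<^esub> \<longleftrightarrow>
      (\<forall>gs\<in>tuples G 3. coboundary G 2 (cochain2 G F) gs = 0)"
    unfolding coboundary_def cochains_simps three by (auto simp: fun_eq_iff)
  ultimately show ?thesis
    by (auto simp: cocycle2_def tuples_iff)
qed

lemma cocycles1: "cocycles G 1 = cochain1 G ` {f. additive_on G f}"
  unfolding cocycles_def carrier_cochains1 Suc_1
  by (auto simp: coboundary1 cochain2_simps cochain2_eq_iff additive_on_def algebra_simps)

lemma cocycles2: "cocycles G 2 = cochain2 G ` {F. cocycle2 G F}"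
  unfolding cocycles_def carrier_cochains2 by (auto simp: coboundary2)

lemma coboundaries1: "coboundaries G 1 = {cochain1 G (\<lambda>_. 0)}"
proof -
  have "(\<lambda>gs\<in>tuples G 0. 0) \<in> carrier (cochains G 0)"
    by (auto simp: cochains_simps)
  then show ?thesis
    unfolding One_nat_def coboundaries.simps by (auto simp: coboundary0)
qed

lemma coboundaries2:
  "coboundaries G 2 = (\<lambda>f. cochain2 G (\<lambda>g h. f h - f (g \<otimes> h) + f g)) ` UNIV"
proof -
  have "coboundaries G 2 = coboundary G 1 ` carrier (cochains G 1)"
    unfolding numeral_2_eq_2 One_nat_def by simp
  then show ?thesis
    by (auto simp: carrier_cochains1 coboundary1 image_image)
qed

lemma cocycle2_coboundary: "cocycle2 G (\<lambda>g h. f h - f (g \<otimes> h) + f g)"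
  by (simp add: cocycle2_def m_assoc)

lemma cocycle2_mult: "additive_on G f \<Longrightarrow> additive_on G f' \<Longrightarrow> cocycle2 G (\<lambda>g h. f g * f' h)"
  by (simp add: cocycle2_def additive_on_def algebra_simps)

lemma cocycle2_lin:
  "cocycle2 G (\<lambda>_ _. 0)"
  "cocycle2 G F \<Longrightarrow> cocycle2 G F' \<Longrightarrow> cocycle2 G (\<lambda>g h. F g h + F' g h)"
  "cocycle2 G F \<Longrightarrow> cocycle2 G (\<lambda>g h. c * F g h)"
proof -
  show "cocycle2 G (\<lambda>_ _. 0)" by (simp add: cocycle2_def)
  show "cocycle2 G (\<lambda>g h. F g h + F' g h)" if F: "cocycle2 G F" and F': "cocycle2 G F'"
    unfolding cocycle2_def
  proof (intro ballI)
    fix g h k assume "g \<in> carrier G" "h \<in> carrier G" "k \<in> carrier G"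
    then have "F h k - F (g \<otimes> h) k + F g (h \<otimes> k) - F g h = 0"
      "F' h k - F' (g \<otimes> h) k + F' g (h \<otimes> k) - F' g h = 0"
      using F F' by (simp_all add: cocycle2_def)
    then show "F h k + F' h k - (F (g \<otimes> h) k + F' (g \<otimes> h) k) + (F g (h \<otimes> k) + F' g (h \<otimes> k))
        - (F g h + F' g h) = 0"
      by (simp add: algebra_simps)
  qed
  show "cocycle2 G (\<lambda>g h. c * F g h)" if "cocycle2 G F"
    using that unfolding cocycle2_def
    by (simp add: right_diff_distrib[symmetric] distrib_left[symmetric])
qed

lemma additive_on_lin:
  "additive_on G (\<lambda>_. 0)"
  "additive_on G f \<Longrightarrow> additive_on G f' \<Longrightarrow> additive_on G (\<lambda>g. f g + f' g)"
  "additive_on G f \<Longrightarrow> additive_on G (\<lambda>g. c * f g)"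
  by (auto simp: additive_on_def algebra_simps)

abbreviation (input) Z1 where "Z1 \<equiv> (cochains G 1)\<lparr>carrier := cocycles G 1\<rparr>"
abbreviation (input) Z2 where "Z2 \<equiv> (cochains G 2)\<lparr>carrier := cocycles G 2\<rparr>"

lemma cvs_Z1: "cvs Z1"
  by (rule cvs.cvs_submod[OF cvs_cochains], rule cvs.submodI[OF cvs_cochains])
    (auto simp: cocycles1 carrier_cochains1 cochain1_simps additive_on_lin)

lemma cvs_Z2: "cvs Z2"
  by (rule cvs.cvs_submod[OF cvs_cochains], rule cvs.submodI[OF cvs_cochains])
    (auto simp: cocycles2 carrier_cochains2 cochain2_simps cocycle2_lin)

lemma submod_B1: "submod Z1 (coboundaries G 1)"
  by (rule cvs.submodI[OF cvs_Z1])
    (auto simp: cocycles1 coboundaries1 cochain1_simps additive_on_lin)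

lemma submod_B2: "submod Z2 (coboundaries G 2)"
proof (rule cvs.submodI[OF cvs_Z2])
  show "coboundaries G 2 \<subseteq> carrier Z2"
    using cocycle2_coboundary by (auto simp: cocycles2 coboundaries2)
  show "\<zero>\<^bsub>Z2\<^esub> \<in> coboundaries G 2"
    unfolding coboundaries2 by (rule image_eqI[of _ _ "\<lambda>_. 0"]) (simp_all add: cochain2_simps)
next
  fix F F' assume "F \<in> coboundaries G 2" "F' \<in> coboundaries G 2"
  then obtain f f' where "F = cochain2 G (\<lambda>g h. f h - f (g \<otimes> h) + f g)"
    "F' = cochain2 G (\<lambda>g h. f' h - f' (g \<otimes> h) + f' g)"
    by (auto simp: coboundaries2)
  then show "F \<oplus>\<^bsub>Z2\<^esub> F' \<in> coboundaries G 2"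
    unfolding coboundaries2
    by (intro image_eqI[of _ _ "\<lambda>g. f g + f' g"]) (simp_all add: cochain2_simps cochain2_eq_iff)
next
  fix c F assume "F \<in> coboundaries G 2"
  then obtain f where "F = cochain2 G (\<lambda>g h. f h - f (g \<otimes> h) + f g)"
    by (auto simp: coboundaries2)
  then show "c \<odot>\<^bsub>Z2\<^esub> F \<in> coboundaries G 2"
    unfolding coboundaries2
    by (intro image_eqI[of _ _ "\<lambda>g. c * f g"])
      (simp_all add: cochain2_simps cochain2_eq_iff algebra_simps)
qed

lemma cvs_H1: "cvs (cohomology G 1)"
  unfolding cohomology_def by (rule cvs.cvs_quotient[OF cvs_Z1 submod_B1])

lemma cvs_H2: "cvs (cohomology G 2)"
  unfolding cohomology_def by (rule cvs.cvs_quotient[OF cvs_Z2 submod_B2])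

lemma coset_carrier_update: "W +>\<^bsub>V\<lparr>carrier := C\<rparr>\<^esub> x = W +>\<^bsub>V\<^esub> x"
  by (simp add: a_r_coset_def')

lemma class1_coset: "class1 G f = coboundaries G 1 +>\<^bsub>Z1\<^esub> cochain1 G f"
  by (simp add: class1_def coboundaries1 a_r_coset_def' cochain1_simps)

lemma class2_coset: "class2 G F = coboundaries G 2 +>\<^bsub>Z2\<^esub> cochain2 G F"
  by (simp add: class2_def coset_carrier_update)

lemma carrier_H1: "carrier (cohomology G 1) = class1 G ` {f. additive_on G f}"
  unfolding cohomology_def cvs.quotient_carrier[OF cvs_Z1 submod_B1]
  by (auto simp: class1_coset cocycles1)

lemma H1_simps:
  "\<zero>\<^bsub>cohomology G 1\<^esub> = class1 G (\<lambda>_. 0)"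
  "additive_on G f \<Longrightarrow> additive_on G f' \<Longrightarrow>
    class1 G f \<oplus>\<^bsub>cohomology G 1\<^esub> class1 G f' = class1 G (\<lambda>g. f g + f' g)"
  "additive_on G f \<Longrightarrow> c \<odot>\<^bsub>cohomology G 1\<^esub> class1 G f = class1 G (\<lambda>g. c * f g)"
proof -
  have Z: "cochain1 G f \<in> carrier Z1" if "additive_on G f" for f
    using that by (simp add: cocycles1)
  show "\<zero>\<^bsub>cohomology G 1\<^esub> = class1 G (\<lambda>_. 0)"
    unfolding cohomology_def cvs.quotient_zero(1)[OF cvs_Z1 submod_B1]
    by (simp add: class1_def coboundaries1)
  show "class1 G f \<oplus>\<^bsub>cohomology G 1\<^esub> class1 G f' = class1 G (\<lambda>g. f g + f' g)"
    if "additive_on G f" "additive_on G f'"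
    unfolding cohomology_def class1_coset cvs.quotient_add[OF cvs_Z1 submod_B1 Z[OF that(1)] Z[OF that(2)]]
    by (simp add: cochain1_simps)
  show "c \<odot>\<^bsub>cohomology G 1\<^esub> class1 G f = class1 G (\<lambda>g. c * f g)" if "additive_on G f"
    unfolding cohomology_def class1_coset cvs.quotient_smult[OF cvs_Z1 submod_B1 Z[OF that]]
    by (simp add: cochain1_simps)
qed

lemma class1_eq_iff: "class1 G f = class1 G f' \<longleftrightarrow> (\<forall>g\<in>carrier G. f g = f' g)"
  by (simp add: class1_def cochain1_eq_iff)

lemma eval1_class1 [simp]: "g \<in> carrier G \<Longrightarrow> eval1 (class1 G f) g = f g"
  by (simp add: eval1_def class1_def)

lemma class2_closed: "cocycle2 G F \<Longrightarrow> class2 G F \<in> carrier (cohomology G 2)"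
  unfolding cohomology_def cvs.quotient_carrier[OF cvs_Z2 submod_B2]
  by (auto simp: class2_coset cocycles2)

lemma carrier_H2: "carrier (cohomology G 2) = class2 G ` {F. cocycle2 G F}"
  unfolding cohomology_def cvs.quotient_carrier[OF cvs_Z2 submod_B2]
  by (auto simp: class2_coset cocycles2)

lemma H2_simps:
  "\<zero>\<^bsub>cohomology G 2\<^esub> = class2 G (\<lambda>_ _. 0)"
  "cocycle2 G F \<Longrightarrow> cocycle2 G F' \<Longrightarrow>
    class2 G F \<oplus>\<^bsub>cohomology G 2\<^esub> class2 G F' = class2 G (\<lambda>g h. F g h + F' g h)"
  "cocycle2 G F \<Longrightarrow> c \<odot>\<^bsub>cohomology G 2\<^esub> class2 G F = class2 G (\<lambda>g h. c * F g h)"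
proof -
  have Z: "cochain2 G F \<in> carrier Z2" if "cocycle2 G F" for F
    using that by (simp add: cocycles2)
  show "\<zero>\<^bsub>cohomology G 2\<^esub> = class2 G (\<lambda>_ _. 0)"
    unfolding cohomology_def cvs.quotient_zero(2)[OF cvs_Z2 submod_B2]
    by (simp add: class2_coset cochain2_simps)
  show "class2 G F \<oplus>\<^bsub>cohomology G 2\<^esub> class2 G F' = class2 G (\<lambda>g h. F g h + F' g h)"
    if "cocycle2 G F" "cocycle2 G F'"
    unfolding cohomology_def class2_coset cvs.quotient_add[OF cvs_Z2 submod_B2 Z[OF that(1)] Z[OF that(2)]]
    by (simp add: cochain2_simps)
  show "c \<odot>\<^bsub>cohomology G 2\<^esub> class2 G F = class2 G (\<lambda>g h. c * F g h)" if "cocycle2 G F"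
    unfolding cohomology_def class2_coset cvs.quotient_smult[OF cvs_Z2 submod_B2 Z[OF that]]
    by (simp add: cochain2_simps)
qed

lemma class2_eqI:
  assumes "cocycle2 G F" "cocycle2 G F'"
    and "\<And>g h. g \<in> carrier G \<Longrightarrow> h \<in> carrier G \<Longrightarrow> F g h = F' g h + (f h - f (g \<otimes> h) + f g)"
  shows "class2 G F = class2 G F'"
proof -
  let ?D = "\<lambda>g h. f h - f (g \<otimes> h) + f g"
  have "cochain2 G ?D \<in> coboundaries G 2"
    by (auto simp: coboundaries2)
  moreover have "cochain2 G F = cochain2 G ?D \<oplus>\<^bsub>cochains G 2\<^esub> cochain2 G F'"
    using assms(3) by (simp add: cochain2_simps cochain2_eq_iff)
  ultimately have "cochain2 G F \<in> coboundaries G 2 +>\<^bsub>Z2\<^esub> cochain2 G F'"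
    by (auto simp: a_r_coset_def')
  moreover interpret S: abelian_subgroup "coboundaries G 2" Z2
    by (rule cvs.abelian_subgroup_submod[OF cvs_Z2 submod_B2])
  have "subgroup (coboundaries G 2) (add_monoid Z2)" "abelian_group Z2"
    by (rule S.a_subgroup, rule S.abelian_group_axioms)
  ultimately show ?thesis
    unfolding class2_coset using assms(2)
    by (intro abelian_group.a_repr_independence[symmetric]) (simp_all add: cocycles2)
qed

lemma class2_eq_zeroI:
  assumes "cocycle2 G F" and "\<And>g h. g \<in> carrier G \<Longrightarrow> h \<in> carrier G \<Longrightarrow> F g h = f h - f (g \<otimes> h) + f g"
  shows "class2 G F = \<zero>\<^bsub>cohomology G 2\<^esub>"
  unfolding H2_simps using assms by (intro class2_eqI[where f = f]) (simp_all add: cocycle2_lin)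

lemma mem_class2:
  assumes "X \<in> class2 G F"
  obtains f where "\<forall>g\<in>carrier G. \<forall>h\<in>carrier G. X [g, h] = f h - f (g \<otimes> h) + f g + F g h"
proof -
  obtain f where "X = cochain2 G (\<lambda>g h. f h - f (g \<otimes> h) + f g) \<oplus>\<^bsub>cochains G 2\<^esub> cochain2 G F"
    using assms by (auto simp: class2_def a_r_coset_def' coboundaries2)
  then show thesis using that[of f] by (simp add: cochain2_simps)
qed

text \<open>A coboundary \<open>f h - f (g h) + f g\<close> is symmetric in a commuting pair and
  drops out.\<close>

lemma comm_form_class2:
  assumes g: "g \<in> carrier G" and h: "h \<in> carrier G" and comm: "g \<otimes> h = h \<otimes> g"
  shows "comm_form g h (class2 G F) = F g h - F h g"
proof -
  have "X [g, h] - X [h, g] = F g h - F h g" if X: "X \<in> class2 G F" for X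
  proof -
    obtain f where "\<forall>g\<in>carrier G. \<forall>h\<in>carrier G. X [g, h] = f h - f (g \<otimes> h) + f g + F g h"
      by (rule mem_class2[OF X])
    then show ?thesis using g h comm by simp
  qed
  moreover have "class2 G F \<noteq> {}"
    by (auto simp: class2_def a_r_coset_def' coboundaries2)
  ultimately have "(\<lambda>f. f [g, h] - f [h, g]) ` class2 G F = {F g h - F h g}"
    by (auto simp: image_def)
  then show ?thesis by (simp add: comm_form_def)
qed

lemma cup_class1: "cup G 1 1 (class1 G f) (class1 G f') = class2 G (\<lambda>g h. f g * f' h)"
proof -
  have "cochain_cup G 1 1 (cochain1 G f) (cochain1 G f') = cochain2 G (\<lambda>g h. f g * f' h)"
    unfolding cochain_cup_def cochain2_def one_add_one
    by (intro restrict_ext) (auto simp: tuples_iff take_Cons' drop_Cons')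
  then show ?thesis
    unfolding cup_def class1_def class2_def one_add_one by simp
qed

lemma comm_form_linear:
  assumes g: "g \<in> carrier G" and h: "h \<in> carrier G" and comm: "g \<otimes> h = h \<otimes> g"
  shows "comm_form g h \<in> linear_forms (cohomology G 2)"
  unfolding linear_forms_iff carrier_H2
  by (auto simp: H2_simps comm_form_class2[OF assms] algebra_simps)

lemma eval1_linear: "g \<in> carrier G \<Longrightarrow> (\<lambda>a. eval1 a g) \<in> linear_forms (cohomology G 1)"
  unfolding linear_forms_iff carrier_H1 by (auto simp: H1_simps)

lemma cup_closed:
  assumes "a \<in> carrier (cohomology G 1)" "b \<in> carrier (cohomology G 1)"
  shows "cup G 1 1 a b \<in> carrier (cohomology G 2)"
  using assms by (auto simp: carrier_H1 cup_class1 intro!: class2_closed cocycle2_mult)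

lemma cup_bilinear:
  assumes "a \<in> carrier (cohomology G 1)" "b \<in> carrier (cohomology G 1)" "d \<in> carrier (cohomology G 1)"
  shows "cup G 1 1 (a \<oplus>\<^bsub>cohomology G 1\<^esub> b) d = cup G 1 1 a d \<oplus>\<^bsub>cohomology G 2\<^esub> cup G 1 1 b d"
    and "cup G 1 1 a (b \<oplus>\<^bsub>cohomology G 1\<^esub> d) = cup G 1 1 a b \<oplus>\<^bsub>cohomology G 2\<^esub> cup G 1 1 a d"
    and "cup G 1 1 (c \<odot>\<^bsub>cohomology G 1\<^esub> a) b = c \<odot>\<^bsub>cohomology G 2\<^esub> cup G 1 1 a b"
    and "cup G 1 1 a (c \<odot>\<^bsub>cohomology G 1\<^esub> b) = c \<odot>\<^bsub>cohomology G 2\<^esub> cup G 1 1 a b"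
  using assms
  by (auto simp: carrier_H1 H1_simps cup_class1 H2_simps cocycle2_mult algebra_simps)

lemma cup_anticommute:
  assumes "a \<in> carrier (cohomology G 1)" "b \<in> carrier (cohomology G 1)"
  shows "cup G 1 1 b a = (- 1) \<odot>\<^bsub>cohomology G 2\<^esub> cup G 1 1 a b"
proof -
  obtain f f' where f: "additive_on G f" "a = class1 G f" "additive_on G f'" "b = class1 G f'"
    using assms by (auto simp: carrier_H1)
  have "class2 G (\<lambda>g h. f' g * f h) = class2 G (\<lambda>g h. (- 1) * (f g * f' h))"
  \<comment> \<open>For additive \<open>f\<close> and \<open>f'\<close>, the coboundary of
    \<open>- f f'\<close> is \<open>f g * f' h + f h * f' g\<close>.\<close>
  proof (rule class2_eqI[where f = "\<lambda>g. - (f g * f' g)"])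
    fix g h assume "g \<in> carrier G" "h \<in> carrier G"
    then show "f' g * f h = (- 1) * (f g * f' h) +
        (- (f h * f' h) - - (f (g \<otimes> h) * f' (g \<otimes> h)) + - (f g * f' g))"
      using f(1,3) by (simp add: additive_on_def algebra_simps)
  qed (intro cocycle2_lin cocycle2_mult f)+
  then show ?thesis
    using f by (simp add: cup_class1 H2_simps cocycle2_mult)
qed

lemma cup_eq_zero_commuting:
  assumes "a \<in> carrier (cohomology G 1)" "b \<in> carrier (cohomology G 1)"
    and "cup G 1 1 a b = \<zero>\<^bsub>cohomology G 2\<^esub>"
    and "g \<in> carrier G" "h \<in> carrier G" "g \<otimes> h = h \<otimes> g"
  shows "eval1 a g * eval1 b h = eval1 a h * eval1 b g"
proof -
  obtain f f' where f: "a = class1 G f" "b = class1 G f'"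
    using assms by (auto simp: carrier_H1)
  have "comm_form g h (cup G 1 1 a b) = 0"
    unfolding assms(3) H2_simps using assms(4-6) by (simp add: comm_form_class2)
  then show ?thesis
    using assms(4-6) by (simp add: f cup_class1 comm_form_class2)
qed

end


section \<open>Cohomology of the upper McCool group\<close>

text \<open>Used twice: \<open>pairs_below n\<close> indexes the generators, and
  \<open>pairs_below (j - 1)\<close> indexes the basis of the image of the cup product on
  \<open>L_space n i j\<close>. The larger index comes first.\<close>

definition pairs_below :: "nat \<Rightarrow> (nat \<times> nat) set" where
  "pairs_below n = {(i, j). 1 \<le> j \<and> j < i \<and> i \<le> n}"

lemma pairs_below_Sigma: "pairs_below n = (SIGMA i:{1..n}. {1..<i})"
  by (auto simp: pairs_below_def)

lemma finite_pairs_below: "finite (pairs_below n)"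
  by (simp add: pairs_below_Sigma)

lemma card_pairs_below: "card (pairs_below n) = n choose 2"
proof -
  have "card (pairs_below n) = (\<Sum>i=1..n. i - 1)"
    by (simp add: pairs_below_Sigma)
  also have "\<dots> = n choose 2"
    by (induction n) (simp_all add: numeral_2_eq_2)
  finally show ?thesis .
qed

abbreviation H2_mccool ::
    "nat \<Rightarrow> (complex, ((nat word \<Rightarrow> nat word) list \<Rightarrow> complex) set) module" where
  "H2_mccool n \<equiv> cohomology (upper_mccool n) 2"

abbreviation cup_mccool where
  "cup_mccool n \<equiv> cup (upper_mccool n) 1 1"

definition char_class ::
    "nat \<Rightarrow> nat \<Rightarrow> nat \<Rightarrow> ((nat word \<Rightarrow> nat word) list \<Rightarrow> complex) set" where
  "char_class n i j = class1 (upper_mccool n) (\<lambda>g. of_int (mccool_char i j g))"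

text \<open>Its coordinates at \<open>(i, k)\<close> and \<open>(j, k)\<close> are \<open>1\<close>
  and \<open>- 1\<close>, as the equation \<open>x_ik + x_jk = 0\<close> of
  \<open>L_space n i j\<close> requires. For \<open>k < j\<close> these are the directions of
  \<open>L_space n i j\<close> that complement \<open>char_class n i j\<close>.\<close>

definition diff_class ::
    "nat \<Rightarrow> nat \<Rightarrow> nat \<Rightarrow> nat \<Rightarrow> ((nat word \<Rightarrow> nat word) list \<Rightarrow> complex) set" where
  "diff_class n i j k =
    class1 (upper_mccool n) (\<lambda>g. of_int (mccool_char i k g) - of_int (mccool_char j k g))"

context
  fixes n :: nat
begin

interpretation G: group "upper_mccool n" by (rule group_upper_mccool)
interpretation H1: cvs "H1_mccool n" by (rule G.cvs_H1)
interpretation H2: cvs "H2_mccool n" by (rule G.cvs_H2)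

lemma additive_char: "j < i \<Longrightarrow> i \<le> n \<Longrightarrow> additive_on (upper_mccool n) (\<lambda>g. of_int (mccool_char i j g))"
  by (simp add: additive_on_def mccool_char_mult)

lemma additive_diff:
  assumes "k < j" "j < i" "i \<le> n"
  shows "additive_on (upper_mccool n) (\<lambda>g. of_int (mccool_char i k g) - of_int (mccool_char j k g))"
  using assms by (simp add: additive_on_def mccool_char_mult)

lemma char_class_closed: "j < i \<Longrightarrow> i \<le> n \<Longrightarrow> char_class n i j \<in> carrier (H1_mccool n)"
  by (auto simp: char_class_def G.carrier_H1 additive_char)

lemma diff_class_closed: "k < j \<Longrightarrow> j < i \<Longrightarrow> i \<le> n \<Longrightarrow> diff_class n i j k \<in> carrier (H1_mccool n)"
  by (auto simp: diff_class_def G.carrier_H1 additive_diff)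

lemma mccool_coord_char:
  assumes "1 \<le> j" "j < i" "i \<le> n" "1 \<le> t" "t < s" "s \<le> n"
  shows "mccool_coord n s t (char_class n i j) = (if (s, t) = (i, j) then 1 else 0)"
  using assms by (auto simp: mccool_coord_def char_class_def mccool_gen_closed mccool_char_gen)

lemma mccool_coord_diff:
  assumes "1 \<le> k" "k < j" "j < i" "i \<le> n" "1 \<le> t" "t < s" "s \<le> n"
  shows "mccool_coord n s t (diff_class n i j k) =
    (if (s, t) = (i, k) then 1 else if (s, t) = (j, k) then - 1 else 0)"
  using assms by (auto simp: mccool_coord_def diff_class_def mccool_gen_closed mccool_char_gen)

lemma mccool_coord_linear:
  "1 \<le> t \<Longrightarrow> t < s \<Longrightarrow> s \<le> n \<Longrightarrow> mccool_coord n s t \<in> linear_forms (H1_mccool n)"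
  using G.eval1_linear[OF mccool_gen_closed, of t s] unfolding mccool_coord_def[abs_def] by blast

lemma mccool_coord_separate:
  assumes "a \<in> carrier (H1_mccool n)" "b \<in> carrier (H1_mccool n)"
    and "\<And>s t. 1 \<le> t \<Longrightarrow> t < s \<Longrightarrow> s \<le> n \<Longrightarrow> mccool_coord n s t a = mccool_coord n s t b"
  shows "a = b"
proof -
  obtain f f' where f: "additive_on (upper_mccool n) f" "a = class1 (upper_mccool n) f"
    "additive_on (upper_mccool n) f'" "b = class1 (upper_mccool n) f'"
    using assms(1,2) by (auto simp: G.carrier_H1)
  have "f (mccool_gen n s t) = f' (mccool_gen n s t)" if "1 \<le> t" "t < s" "s \<le> n" for s t
    using assms(3)[OF that] that by (simp add: f mccool_coord_def mccool_gen_closed)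
  then have "f g = f' g" if "g \<in> carrier (upper_mccool n)" for g
    using that f(1,3) by (intro additive_on_upper_mccool_eqI[of n f f' g]) (auto simp: additive_on_def)
  then show ?thesis by (simp add: f G.class1_eq_iff)
qed

lemma mccool_coord_zero:
  "1 \<le> t \<Longrightarrow> t < s \<Longrightarrow> s \<le> n \<Longrightarrow> mccool_coord n s t \<zero>\<^bsub>H1_mccool n\<^esub> = 0"
  by (intro H1.linear_form_zero mccool_coord_linear)

lemma has_dimension_H1: "has_dimension (H1_mccool n) (n choose 2)"
proof -
  let ?e = "\<lambda>(i, j). char_class n i j" and ?f = "\<lambda>(i, j). mccool_coord n i j"
  have e: "?e \<in> pairs_below n \<rightarrow> carrier (H1_mccool n)"
    by (auto simp: pairs_below_def char_class_closed)
  have f: "?f p \<in> linear_forms (H1_mccool n)" if "p \<in> pairs_below n" for p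
    using that by (auto simp: pairs_below_def mccool_coord_linear)
  have dual: "?f p (?e q) = (if p = q then 1 else 0)" if "p \<in> pairs_below n" "q \<in> pairs_below n" for p q
    using that by (auto simp: pairs_below_def mccool_coord_char split: if_splits)
  have "vspan (H1_mccool n) (?e ` pairs_below n) = carrier (H1_mccool n)"
  proof (rule H1.span_eqI[OF finite_pairs_below e f dual])
    fix v assume v: "v \<in> carrier (H1_mccool n)" and 0: "\<And>p. p \<in> pairs_below n \<Longrightarrow> ?f p v = 0"
    show "v = \<zero>\<^bsub>H1_mccool n\<^esub>"
    proof (rule mccool_coord_separate[OF v H1.M.zero_closed])
      fix s t assume "1 \<le> t" "t < s" "s \<le> n"
      then show "mccool_coord n s t v = mccool_coord n s t \<zero>\<^bsub>H1_mccool n\<^esub>"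
        using 0[of "(s, t)"] by (simp add: pairs_below_def mccool_coord_zero)
    qed
  qed
  then show ?thesis
    using H1.has_dimensionI[OF finite_pairs_below e f dual] by (simp add: card_pairs_below)
qed

lemma cup_diff_char:
  assumes "1 \<le> k" "k < j" "j < i" "i \<le> n"
  shows "cup_mccool n (diff_class n i j k) (char_class n i j) = \<zero>\<^bsub>H2_mccool n\<^esub>"
  unfolding diff_class_def char_class_def G.cup_class1
\<comment> \<open>The sign arises because a coboundary is minus the defect from additivity that
  \<open>mccool_cochain_mult\<close> computes.\<close>
proof (rule G.class2_eq_zeroI[where f = "\<lambda>g. - of_int (mccool_cochain i j k g)"])
  show "cocycle2 (upper_mccool n) (\<lambda>g h. (of_int (mccool_char i k g) - of_int (mccool_char j k g)) *
      of_int (mccool_char i j h))"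
    using assms by (intro G.cocycle2_mult additive_diff additive_char)
  fix g h assume "g \<in> carrier (upper_mccool n)" "h \<in> carrier (upper_mccool n)"
  then show "(of_int (mccool_char i k g) - of_int (mccool_char j k g) :: complex) * of_int (mccool_char i j h) =
      - of_int (mccool_cochain i j k h) - - of_int (mccool_cochain i j k (g \<otimes>\<^bsub>upper_mccool n\<^esub> h)) +
      - of_int (mccool_cochain i j k g)"
    using assms by (simp add: mccool_cochain_mult algebra_simps)
qed

lemma cup_char_diff:
  assumes "1 \<le> k" "k < j" "j < i" "i \<le> n"
  shows "cup_mccool n (char_class n i j) (diff_class n i j k) = \<zero>\<^bsub>H2_mccool n\<^esub>"
proof -
  have "cup_mccool n (char_class n i j) (diff_class n i j k) = (- 1) \<odot>\<^bsub>H2_mccool n\<^esub> \<zero>\<^bsub>H2_mccool n\<^esub>"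
    using G.cup_anticommute[OF diff_class_closed char_class_closed, of k j i j i] assms
    by (simp add: cup_diff_char)
  then show ?thesis by (simp add: H2.smult_r_null)
qed

lemma cup_self:
  assumes "a \<in> carrier (H1_mccool n)"
  shows "cup_mccool n a a = \<zero>\<^bsub>H2_mccool n\<^esub>"
proof -
  obtain f where f: "additive_on (upper_mccool n) f" "a = class1 (upper_mccool n) f"
    using assms by (auto simp: G.carrier_H1)
  show ?thesis
    unfolding f(2) G.cup_class1 using f(1)
    \<comment> \<open>The coboundary of \<open>- f^2 / 2\<close> is \<open>f g * f h\<close> for
      additive \<open>f\<close>.\<close>
    by (intro G.class2_eq_zeroI[where f = "\<lambda>g. - (f g * f g) / 2"] G.cocycle2_mult)
      (auto simp: additive_on_def field_simps)
qed


section \<open>The components\<close>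

context
  fixes i j :: nat
  assumes ij: "2 \<le> j" "j < i" "i \<le> n"
begin

text \<open>With the equations gathered as one set of linear forms, closedness and linearity of
  \<open>L_space n i j\<close> follow uniformly.\<close>

definition component_forms :: "(((nat word \<Rightarrow> nat word) list \<Rightarrow> complex) set \<Rightarrow> complex) set" where
  "component_forms =
    (\<lambda>l a. mccool_coord n i l a + mccool_coord n j l a) ` {1..j - 1} \<union>
    mccool_coord n i ` {j + 1..i - 1} \<union>
    (\<lambda>(s, t). mccool_coord n s t) ` {(s, t). s \<in> {1..n} \<and> s \<noteq> i \<and> s \<noteq> j \<and> 1 \<le> t \<and> t < s}"

lemma component_forms_linear: "component_forms \<subseteq> linear_forms (H1_mccool n)"
proof -
  have "(\<lambda>a. mccool_coord n i l a + mccool_coord n j l a) \<in> linear_forms (H1_mccool n)"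
    if "l \<in> {1..j - 1}" for l
    using that ij by (intro linear_forms_add mccool_coord_linear) auto
  moreover have "mccool_coord n i l \<in> linear_forms (H1_mccool n)" if "l \<in> {j + 1..i - 1}" for l
    using that ij by (intro mccool_coord_linear) auto
  moreover have "mccool_coord n s t \<in> linear_forms (H1_mccool n)" if "s \<in> {1..n}" "1 \<le> t" "t < s" for s t
    using that by (intro mccool_coord_linear) auto
  ultimately show ?thesis by (auto simp: component_forms_def)
qed

lemma L_space_eq: "L_space n i j = {a \<in> carrier (H1_mccool n). \<forall>p\<in>component_forms. p a = 0}"
  unfolding L_space_def component_forms_def by (rule Collect_cong) (auto simp: ball_Un)

lemma zariski_closed_L_space: "zariski_closed (H1_mccool n) (L_space n i j)"
  unfolding L_space_eq by (rule zariski_closed_linear[OF component_forms_linear])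

lemma submod_L_space: "submod (H1_mccool n) (L_space n i j)"
proof (rule H1.submodI)
  show "L_space n i j \<subseteq> carrier (H1_mccool n)"
    by (auto simp: L_space_def)
  show "\<zero>\<^bsub>H1_mccool n\<^esub> \<in> L_space n i j"
    using component_forms_linear by (auto simp: L_space_eq intro: H1.linear_form_zero)
  have lin: "p (v \<oplus>\<^bsub>H1_mccool n\<^esub> w) = p v + p w" "p (c \<odot>\<^bsub>H1_mccool n\<^esub> v) = c * p v"
    if "p \<in> component_forms" "v \<in> carrier (H1_mccool n)" "w \<in> carrier (H1_mccool n)" for p c v w
    using subsetD[OF component_forms_linear that(1)] that(2,3) by (simp_all add: linear_forms_iff)
  show "v \<oplus>\<^bsub>H1_mccool n\<^esub> w \<in> L_space n i j" if "v \<in> L_space n i j" "w \<in> L_space n i j" for v w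
    using that unfolding L_space_eq by (auto simp: lin(1))
  show "c \<odot>\<^bsub>H1_mccool n\<^esub> v \<in> L_space n i j" if "v \<in> L_space n i j" for c v
    using that unfolding L_space_eq by (auto simp: lin(2)[of _ v v])
qed

text \<open>Dual to the coordinates \<open>x_il\<close> with \<open>l <= j\<close>. These are free
  on \<open>L_space n i j\<close>; every other coordinate is zero or equal to some
  \<open>- x_il\<close>.\<close>

definition component_basis :: "nat \<Rightarrow> ((nat word \<Rightarrow> nat word) list \<Rightarrow> complex) set" where
  "component_basis l = (if l = j then char_class n i j else diff_class n i j l)"

lemma component_basis_closed:
  "l \<in> {1..j} \<Longrightarrow> component_basis l \<in> carrier (H1_mccool n)"
  using ij by (auto simp: component_basis_def char_class_closed diff_class_closed)

lemma component_basis_in_L: "l \<in> {1..j} \<Longrightarrow> component_basis l \<in> L_space n i j"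
  using ij component_basis_closed[of l]
  by (auto simp: L_space_def component_basis_def mccool_coord_char mccool_coord_diff)

lemma component_basis_dual:
  "l \<in> {1..j} \<Longrightarrow> m \<in> {1..j} \<Longrightarrow> mccool_coord n i l (component_basis m) = (if l = m then 1 else 0)"
  using ij by (auto simp: component_basis_def mccool_coord_char mccool_coord_diff)

lemma L_space_coord_eq_0:
  assumes a: "a \<in> L_space n i j" and 0: "\<And>l. l \<in> {1..j} \<Longrightarrow> mccool_coord n i l a = 0"
  shows "a = \<zero>\<^bsub>H1_mccool n\<^esub>"
proof (rule mccool_coord_separate[OF _ H1.M.zero_closed])
  show "a \<in> carrier (H1_mccool n)" using a by (simp add: L_space_def)
  fix s t assume st: "1 \<le> t" "t < s" "s \<le> n"
  have "mccool_coord n s t a = 0"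
  proof (cases "s = i \<or> s = j")
    case True
    then show ?thesis
    proof (cases "t \<le> j - 1")
      case le: True
      have "\<forall>l\<in>{1..j - 1}. mccool_coord n i l a + mccool_coord n j l a = 0"
        using a by (simp add: L_space_def)
      then have "mccool_coord n i t a + mccool_coord n j t a = 0"
        using le st by simp
      moreover have "mccool_coord n i t a = 0"
        using 0[of t] le st by simp
      ultimately show ?thesis using True by auto
    next
      case False
      \<comment> \<open>Here \<open>t >= j\<close>, and \<open>s = j\<close> would contradict
        \<open>t < s\<close>.\<close>
      then have "s = i" using True st by auto
      have "\<forall>l\<in>{j + 1..i - 1}. mccool_coord n i l a = 0"
        using a by (simp add: L_space_def)
      moreover have "t = j \<or> t \<in> {j + 1..i - 1}"
        using False st \<open>s = i\<close> by auto
      ultimately show ?thesis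
        using 0[of j] ij \<open>s = i\<close> by auto
    qed
  next
    case False
    have "\<forall>s\<in>{1..n}. \<forall>t. s \<noteq> i \<and> s \<noteq> j \<and> 1 \<le> t \<and> t < s \<longrightarrow> mccool_coord n s t a = 0"
      using a by (simp add: L_space_def)
    then show ?thesis using False st by simp
  qed
  then show "mccool_coord n s t a = mccool_coord n s t \<zero>\<^bsub>H1_mccool n\<^esub>"
    using st by (simp add: mccool_coord_zero)
qed

lemma L_space_span_dim:
  shows L_space_span: "vspan (H1_mccool n) (component_basis ` {1..j}) = L_space n i j"
    and has_dimension_L_space: "has_dimension ((H1_mccool n)\<lparr>carrier := L_space n i j\<rparr>) j"
proof -
  let ?L = "(H1_mccool n)\<lparr>carrier := L_space n i j\<rparr>"
  interpret L: cvs ?L by (rule H1.cvs_submod[OF submod_L_space])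
  have e: "component_basis \<in> {1..j} \<rightarrow> carrier ?L"
    by (simp add: component_basis_in_L Pi_iff)
  have f: "mccool_coord n i l \<in> linear_forms ?L" if "l \<in> {1..j}" for l
    using that ij by (intro linear_forms_subspace mccool_coord_linear) (auto simp: L_space_def)
  have span: "vspan ?L (component_basis ` {1..j}) = carrier ?L"
  proof (rule L.span_eqI[OF _ e f component_basis_dual])
    fix v assume v: "v \<in> carrier ?L" and 0: "\<And>l. l \<in> {1..j} \<Longrightarrow> mccool_coord n i l v = 0"
    have "v = \<zero>\<^bsub>H1_mccool n\<^esub>"
      by (rule L_space_coord_eq_0) (use v 0 in auto)
    then show "v = \<zero>\<^bsub>?L\<^esub>" by simp
  qed simp_all
  then show "vspan (H1_mccool n) (component_basis ` {1..j}) = L_space n i j"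
    using H1.span_li_not_depend(1)[OF _ submod_L_space, of "component_basis ` {1..j}"] e by auto
  show "has_dimension ?L j"
    using L.has_dimensionI[OF _ e f component_basis_dual span] by simp
qed

text \<open>Extends statements about basis classes to the whole component, one argument of the cup
  product at a time. Linearity of \<open>P\<close> is expressed by its solution set being a
  submodule.\<close>

lemma L_space_induct [consumes 1, case_names basis submod]:
  assumes "a \<in> L_space n i j"
    and "\<And>l. l \<in> {1..j} \<Longrightarrow> P (component_basis l)"
    and "submod (H1_mccool n) {a \<in> carrier (H1_mccool n). P a}"
  shows "P a"
proof -
  have "component_basis ` {1..j} \<subseteq> {a \<in> carrier (H1_mccool n). P a}"
    using assms(2) component_basis_closed by auto
  then have "L_space n i j \<subseteq> {a \<in> carrier (H1_mccool n). P a}"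
    unfolding L_space_span[symmetric] by (rule H1.span_is_subset[OF _ assms(3)])
  then show ?thesis using assms(1) by auto
qed

section \<open>Cup products on a component\<close>

lemma submod_cup_right:
  assumes T: "submod (H2_mccool n) T" and a: "a \<in> carrier (H1_mccool n)"
  shows "submod (H1_mccool n) {b \<in> carrier (H1_mccool n). cup_mccool n a b \<in> T}"
proof (rule H1.submodI)
  interpret T: submodule class_ring T "H2_mccool n" by (rule T)
  have "\<zero>\<^bsub>H1_mccool n\<^esub> = (0 :: complex) \<odot>\<^bsub>H1_mccool n\<^esub> a"
    using H1.lmult_0[OF a] by simp
  then have "cup_mccool n a \<zero>\<^bsub>H1_mccool n\<^esub> = (0 :: complex) \<odot>\<^bsub>H2_mccool n\<^esub> cup_mccool n a a"
    using G.cup_bilinear(4)[OF a a a] by simp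
  also have "\<dots> = \<zero>\<^bsub>H2_mccool n\<^esub>"
    using H2.lmult_0[OF G.cup_closed[OF a a]] by simp
  finally show "\<zero>\<^bsub>H1_mccool n\<^esub> \<in> {b \<in> carrier (H1_mccool n). cup_mccool n a b \<in> T}"
    by simp
qed (use a T in \<open>auto simp: G.cup_bilinear submodule.m_closed submodule.smult_closed\<close>)

text \<open>Anticommutativity reduces this to the right argument. The quantifier over
  \<open>B\<close> lets an induction over the second factor be nested inside one over the
  first.\<close>

lemma submod_cup_left:
  assumes T: "submod (H2_mccool n) T" and B: "B \<subseteq> carrier (H1_mccool n)"
  shows "submod (H1_mccool n) {a \<in> carrier (H1_mccool n). \<forall>b\<in>B. cup_mccool n a b \<in> T}"
proof -
  have eq: "{a \<in> carrier (H1_mccool n). \<forall>b\<in>B. cup_mccool n a b \<in> T} =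
      {a \<in> carrier (H1_mccool n). \<forall>b\<in>B. cup_mccool n b a \<in> T}"
  proof -
    interpret T: submodule class_ring T "H2_mccool n" by (rule T)
    have "cup_mccool n b a \<in> T" if "a \<in> carrier (H1_mccool n)" "b \<in> carrier (H1_mccool n)"
      "cup_mccool n a b \<in> T" for a b
      using G.cup_anticommute[OF that(1,2)] T.smult_closed[of "- 1" "cup_mccool n a b"] that(3) by simp
    then show ?thesis using B by blast
  qed
  show ?thesis
    unfolding eq
  proof (rule H1.submodI)
    have sub: "submod (H1_mccool n) {a \<in> carrier (H1_mccool n). cup_mccool n b a \<in> T}" if "b \<in> B" for b
      using submod_cup_right[OF T, of b] B that by auto
    note zero = submodule.zero_closed[OF sub] and add = submodule.m_closed[OF sub]
      and smult = submodule.smult_closed[OF sub]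
    show "\<zero>\<^bsub>H1_mccool n\<^esub> \<in> {a \<in> carrier (H1_mccool n). \<forall>b\<in>B. cup_mccool n b a \<in> T}"
      using zero by auto
    show "v \<oplus>\<^bsub>H1_mccool n\<^esub> w \<in> {a \<in> carrier (H1_mccool n). \<forall>b\<in>B. cup_mccool n b a \<in> T}"
      if "v \<in> {a \<in> carrier (H1_mccool n). \<forall>b\<in>B. cup_mccool n b a \<in> T}"
        "w \<in> {a \<in> carrier (H1_mccool n). \<forall>b\<in>B. cup_mccool n b a \<in> T}" for v w
      using add[of _ v w] that by auto
    show "c \<odot>\<^bsub>H1_mccool n\<^esub> v \<in> {a \<in> carrier (H1_mccool n). \<forall>b\<in>B. cup_mccool n b a \<in> T}"
      if "v \<in> {a \<in> carrier (H1_mccool n). \<forall>b\<in>B. cup_mccool n b a \<in> T}" for c v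
      using smult[of _ c v] that by auto
  qed auto
qed

lemma submod_zero: "submod (H2_mccool n) {\<zero>\<^bsub>H2_mccool n\<^esub>}"
  by (rule H2.submodI) (auto simp: H2.smult_r_null)

lemma cup_basis_char: "l \<in> {1..j} \<Longrightarrow> cup_mccool n (component_basis l) (char_class n i j) = \<zero>\<^bsub>H2_mccool n\<^esub>"
  using ij by (auto simp: component_basis_def cup_diff_char cup_self char_class_closed)

text \<open>This makes \<open>u_ij\<close> the partner that shows an element of the component to be
  resonant, provided it is not a multiple of that element.\<close>

lemma cup_L_char:
  assumes "a \<in> L_space n i j"
  shows "cup_mccool n a (char_class n i j) = \<zero>\<^bsub>H2_mccool n\<^esub>"
  using assms
proof (induction rule: L_space_induct)
  case submod
  show ?case
    using submod_cup_left[OF submod_zero, of "{char_class n i j}"] char_class_closed ij by simp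
qed (rule cup_basis_char)

text \<open>Products with \<open>u_ij\<close> vanish, so the image is spanned by the products of the
  remaining \<open>j - 1\<close> basis classes. These are independent because the commuting pairs
  \<alpha>_jq, \<alpha>_ip with \<open>p < q < j\<close> define dual linear forms.\<close>

lemma isotropic_L_space: "isotropic (upper_mccool n) ((j - 1) choose 2) (L_space n i j)"
proof -
  let ?e = "\<lambda>(q, p). cup_mccool n (diff_class n i j p) (diff_class n i j q)"
  \<comment> \<open>In this order the sign of \<open>diff_class\<close> at \<open>(j, q)\<close>
    cancels the sign of the antisymmetrization, giving \<open>+1\<close> on the matching product.
    The other term would need the index pair \<open>(q, p)\<close> reversed, which
    \<open>p < q\<close> excludes.\<close>
  let ?f = "\<lambda>(q, p). comm_form (mccool_gen n j q) (mccool_gen n i p)"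
  let ?I = "pairs_below (j - 1)"
  let ?T = "vspan (H2_mccool n) (?e ` ?I)"
  let ?S = "{cup_mccool n a b | a b. a \<in> L_space n i j \<and> b \<in> L_space n i j}"
  have idx: "1 \<le> p \<and> p < q \<and> q < j" if "(q, p) \<in> ?I" for p q
    using that by (auto simp: pairs_below_def)
  have diff: "diff_class n i j p \<in> carrier (H1_mccool n)" "diff_class n i j p \<in> L_space n i j"
    if "1 \<le> p" "p < j" for p
    using component_basis_in_L[of p] component_basis_closed[of p] that by (auto simp: component_basis_def)
  have eS: "?e ` ?I \<subseteq> ?S"
  proof
    fix x assume "x \<in> ?e ` ?I"
    then obtain p q where "(q, p) \<in> ?I" "x = ?e (q, p)" by auto
    then show "x \<in> ?S" using idx[of q p] diff(2)[of p] diff(2)[of q] by auto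
  qed
  have LC: "L_space n i j \<subseteq> carrier (H1_mccool n)"
    by (auto simp: L_space_def)
  have S: "?S \<subseteq> carrier (H2_mccool n)"
    using LC by (auto intro: G.cup_closed)
  have eC: "?e ` ?I \<subseteq> carrier (H2_mccool n)" by (rule subset_trans[OF eS S])
  have T: "submod (H2_mccool n) ?T"
    by (rule H2.span_is_submodule[OF eC])
  interpret T: submodule class_ring ?T "H2_mccool n" by (rule T)
  have eT: "?e ` ?I \<subseteq> ?T" by (rule H2.in_own_span[OF eC])
  have basis_mem: "cup_mccool n (component_basis l) (component_basis m) \<in> ?T"
    if l: "l \<in> {1..j}" and m: "m \<in> {1..j}" for l m
  proof -
    have less: "cup_mccool n (diff_class n i j p) (diff_class n i j q) \<in> ?T"
      if "1 \<le> p" "p < q" "q < j" for p q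
    proof -
      have "(q, p) \<in> ?I" using that by (auto simp: pairs_below_def)
      then show ?thesis using eT by (auto simp: image_subset_iff)
    qed
    consider "l = m" | "l = j" "m < j" | "m = j" "l < j" | "l < m" "m < j" | "m < l" "l < j"
      using l m by force
    then show ?thesis
    proof cases
      case 1
      then show ?thesis using cup_self[OF component_basis_closed[OF m]] by simp
    next
      case 2
      then show ?thesis using m ij cup_char_diff[of m j i] by (simp add: component_basis_def)
    next
      case 3
      then show ?thesis using l ij cup_diff_char[of l j i] by (simp add: component_basis_def)
    next
      case 4
      then show ?thesis using less[of l m] l by (simp add: component_basis_def)
    next
      case 5
      then have "cup_mccool n (diff_class n i j l) (diff_class n i j m) =
          (- 1) \<odot>\<^bsub>H2_mccool n\<^esub> cup_mccool n (diff_class n i j m) (diff_class n i j l)"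
        using l m by (intro G.cup_anticommute diff) auto
      then show ?thesis
        using less[of m l] 5 m T.smult_closed[of "- 1"] by (simp add: component_basis_def)
    qed
  qed
  have ST: "?S \<subseteq> ?T"
  proof -
    have "\<forall>b\<in>L_space n i j. cup_mccool n a b \<in> ?T" if "a \<in> L_space n i j" for a
      using that
    proof (induction rule: L_space_induct)
      case (basis l)
      show ?case
      proof
        fix b assume "b \<in> L_space n i j"
        then show "cup_mccool n (component_basis l) b \<in> ?T"
        proof (induction rule: L_space_induct)
          case submod
          show ?case by (rule submod_cup_right[OF T component_basis_closed[OF basis]])
        qed (rule basis_mem[OF basis])
      qed
    next
      case submod
      show ?case by (rule submod_cup_left[OF T LC])
    qed
    then show ?thesis by blast
  qed
  have span_eq: "vspan (H2_mccool n) ?S = ?T"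
    using H2.span_is_subset[OF ST T] H2.span_is_monotone[OF eS] by blast
  let ?V = "(H2_mccool n)\<lparr>carrier := ?T\<rparr>"
  interpret V: cvs ?V by (rule H2.cvs_submod[OF T])
  have comm: "mccool_gen n j q \<otimes>\<^bsub>upper_mccool n\<^esub> mccool_gen n i p =
      mccool_gen n i p \<otimes>\<^bsub>upper_mccool n\<^esub> mccool_gen n j q" if "1 \<le> p" "p < j" "1 \<le> q" "q < j" for p q
    using that ij by (intro mccool_gen_commute) auto
  have "has_dimension ?V (card ?I)"
  proof (rule V.has_dimensionI[where e = ?e and f = ?f])
    show "?e \<in> ?I \<rightarrow> carrier ?V" using eT by auto
    show "?f x \<in> linear_forms ?V" if "x \<in> ?I" for x
    proof -
      obtain q p where x: "x = (q, p)" by force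
      have "?f x \<in> linear_forms (H2_mccool n)"
        using idx[of q p] that ij unfolding x
        by (auto intro!: G.comm_form_linear mccool_gen_closed comm)
      then show ?thesis by (rule linear_forms_subspace) (rule T.subset)
    qed
    show "?f x (?e y) = (if x = y then 1 else 0)" if "x \<in> ?I" "y \<in> ?I" for x y
    proof -
      obtain q p q' p' where xy: "x = (q, p)" "y = (q', p')" by (metis surj_pair)
      have "1 \<le> p" "p < q" "q < j" "1 \<le> p'" "p' < q'" "q' < j"
        using idx[of q p] idx[of q' p'] that xy by auto
      then show ?thesis
        using ij unfolding xy
        by (auto simp: diff_class_def G.cup_class1 G.comm_form_class2 mccool_gen_closed comm mccool_char_gen)
    qed
    show "vspan ?V (?e ` ?I) = carrier ?V"
      using H2.span_li_not_depend(1)[OF eT T] by simp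
  qed (rule finite_pairs_below)
  then show ?thesis
    unfolding isotropic_def span_eq card_pairs_below
    using H1.submod_subspace[OF submod_L_space] by simp
qed

end

end


section \<open>Resonance\<close>

text \<open>Cramer's rule: \<open>(x, y)\<close> is parallel to the independent vectors
  \<open>(a1, b1)\<close> and \<open>(a2, b2)\<close>.\<close>

lemma minors_eq_0:
  fixes x y :: "'a :: field"
  assumes "x * b1 = a1 * y" "x * b2 = a2 * y" "a1 * b2 \<noteq> a2 * b1"
  shows "x = 0 \<and> y = 0"
proof -
  have "x * (a1 * b2 - a2 * b1) = a1 * (x * b2) - a2 * (x * b1)"
    "y * (a1 * b2 - a2 * b1) = (a1 * y) * b2 - (a2 * y) * b1"
    by (simp_all add: algebra_simps)
  then have "x * (a1 * b2 - a2 * b1) = a1 * (a2 * y) - a2 * (a1 * y)"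
    "y * (a1 * b2 - a2 * b1) = (x * b1) * b2 - (x * b2) * b1"
    using assms(1,2) by simp_all
  then have "x * (a1 * b2 - a2 * b1) = 0" "y * (a1 * b2 - a2 * b1) = 0"
    by (simp_all add: algebra_simps)
  then show ?thesis using assms(3) by simp
qed

text \<open>The pairs \<open>(a i j, b i j)\<close> are treated as vectors in the plane. The hypotheses say that certain
  minors vanish, and the argument repeatedly shows that a vector is parallel to two independent
  ones, hence zero.\<close>

locale resonant_pair =
  fixes n :: nat and a b :: "nat \<Rightarrow> nat \<Rightarrow> complex"
  assumes comm: "\<And>i j k l. 1 \<le> j \<Longrightarrow> j < i \<Longrightarrow> i \<le> n \<Longrightarrow> 1 \<le> l \<Longrightarrow> l < k \<Longrightarrow> k \<le> n \<Longrightarrow>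
      i \<noteq> k \<Longrightarrow> i \<noteq> l \<Longrightarrow> j \<noteq> k \<Longrightarrow> a i j * b k l = a k l * b i j"
    and triple: "\<And>i j k. 1 \<le> k \<Longrightarrow> k < j \<Longrightarrow> j < i \<Longrightarrow> i \<le> n \<Longrightarrow>
      a i j * (b i k + b j k) = (a i k + a j k) * b i j"
begin

definition valid :: "nat \<Rightarrow> nat \<Rightarrow> bool" where
  "valid i j \<longleftrightarrow> 1 \<le> j \<and> j < i \<and> i \<le> n"

text \<open>By \<open>comm\<close>, a nonzero minor can only occur within one row or at chained
  positions \<open>(i, j), (j, k)\<close>. In the chained case \<open>triple\<close> says that the
  minors at \<open>(i, j), (i, k)\<close> and at \<open>(i, j), (j, k)\<close> are negatives of each
  other.\<close>

lemma exists_triple: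
  assumes p: "valid p1 p2" and q: "valid q1 q2" and ne: "a p1 p2 * b q1 q2 \<noteq> a q1 q2 * b p1 p2"
  obtains i j k where "1 \<le> k" "k < j" "j < i" "i \<le> n" "a i j * b i k \<noteq> a i k * b i j"
proof -
  have step: "a i j * b i k \<noteq> a i k * b i j"
    if "1 \<le> k" "k < j" "j < i" "i \<le> n" "a i j * b j k \<noteq> a j k * b i j" for i j k
    using triple[OF that(1-4)] that(5) by (auto simp: algebra_simps)
  consider "p1 = q1" "p2 < q2" | "p1 = q1" "q2 < p2" | "p1 = q2" | "p2 = q1"
    using comm[of p2 p1 q2 q1] p q ne by (cases "p2 = q2") (force simp: valid_def)+
  then show thesis
  proof cases
    case 1
    then show ?thesis using that[of p2 q2 p1] p q ne by (auto simp: valid_def)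
  next
    case 2
    then show ?thesis using that[of q2 p2 p1] p q ne by (auto simp: valid_def)
  next
    case 3
    have ord: "1 \<le> p2" "p2 < p1" "p1 < q1" "q1 \<le> n" using p q 3 by (auto simp: valid_def)
    then show ?thesis using that[OF ord step[OF ord]] ne 3 by auto
  next
    case 4
    have ord: "1 \<le> q2" "q2 < q1" "q1 < p1" "p1 \<le> n" using p q 4 by (auto simp: valid_def)
    then show ?thesis using that[OF ord step[OF ord]] ne 4 by auto
  qed
qed

context
  fixes i j k :: nat
  assumes ord: "1 \<le> k" "k < j" "j < i" "i \<le> n" and ne: "a i j * b i k \<noteq> a i k * b i j"
begin

text \<open>The sum of the vectors at \<open>(i, k)\<close> and \<open>(j, k)\<close> is parallel to
  the one at \<open>(i, j)\<close> by \<open>triple\<close>, and to the one at \<open>(i, k)\<close>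
  because \<alpha>_ik and \<alpha>_jk commute.\<close>

lemma opposite: "a i k + a j k = 0 \<and> b i k + b j k = 0"
proof (rule minors_eq_0)
  show "(a i k + a j k) * b i j = a i j * (b i k + b j k)"
    using triple[OF ord] by simp
  show "(a i k + a j k) * b i k = a i k * (b i k + b j k)"
    using comm[of k i k j] ord by (simp add: algebra_simps)
  show "a i j * b i k \<noteq> a i k * b i j" by (rule ne)
qed

text \<open>By \<open>opposite\<close> the vectors at \<open>(i, k)\<close> and
  \<open>(j, k)\<close> are negatives of each other. So \<alpha>_jk can stand in for \<alpha>_ik
  when an automorphism commutes only with the former.\<close>

lemma parallel: "x * b j k = a j k * y \<longleftrightarrow> x * b i k = a i k * y"
proof -
  have "a j k = - a i k" "b j k = - b i k"
    using opposite by (simp_all add: add_eq_0_iff)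
  then show ?thesis by simp
qed

lemma vanish: "x * b i j = a i j * y \<Longrightarrow> x * b i k = a i k * y \<Longrightarrow> x = 0 \<and> y = 0"
  using ne by (rule minors_eq_0[rotated 2])

lemma vanish_outside:
  assumes st: "1 \<le> t" "t < s" "s \<le> n" and s: "s \<noteq> i" "s \<noteq> j"
  shows "a s t = 0 \<and> b s t = 0"
proof (cases "s = k")
  \<comment> \<open>The automorphism \<alpha>_kt moves the conjugating letter of \<alpha>_ik and
    \<alpha>_jk. The relation for \<open>t < k < i\<close> replaces the missing commutation, once
    the vector at \<open>(i, t)\<close> is known to be parallel to that at
    \<open>(i, k)\<close>.\<close>
  case True
  have t: "t < k" using st True by simp
  have "a i t * b j k = a j k * b i t"
    using comm[of t i k j] ord t st by simp
  then have 1: "a i t * b i k = a i k * b i t"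
    by (simp add: parallel)
  have "a i k * (b i t + b k t) = (a i t + a k t) * b i k"
    using triple[of t k i] ord t st by simp
  then have 2: "a k t * b i k = a i k * b k t"
    using 1 by (simp add: algebra_simps)
  have "a k t * b i j = a i j * b k t"
    using comm[of t k j i] ord t st by simp
  then show ?thesis using vanish[OF _ 2] True by simp
next
  case sk: False
  consider "t = i" | "t = j" | "t \<noteq> i" "t \<noteq> j" by blast
  then show ?thesis
  proof cases
    \<comment> \<open>Now \<alpha>_si does not commute with \<alpha>_ij. The vector at
      \<open>(s, j)\<close> is shown to vanish first, so that the relation for
      \<open>j < i < s\<close> reduces to the missing minor.\<close>
    case 1
    have si: "i < s" using st 1 by simp
    have "a s i * b j k = a j k * b s i"
      using comm[of i s k j] ord si st s sk by simp
    then have p: "a s i * b i k = a i k * b s i" by (simp add: parallel)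
    have q: "a s j * b i k = a i k * b s j"
      using comm[of j s k i] ord si st s sk by simp
    have "a s j = 0 \<and> b s j = 0"
    proof (rule vanish[OF _ q])
      show "a s j * b i j = a i j * b s j"
        using comm[of j s j i] ord si st s by simp
    qed
    then have "a s i * b i j = a i j * b s i"
      using triple[of j i s] ord si st by simp
    then show ?thesis using vanish[OF _ p] 1 by simp
  next
    case 2
    have p: "a s j * b i k = a i k * b s j"
      using comm[of j s k i] ord st s sk 2 by simp
    have "a s j * b i j = a i j * b s j"
      using comm[of j s j i] ord st s 2 by simp
    then show ?thesis using vanish[OF _ p] 2 by simp
  next
    case 3
    have p: "a s t * b i k = a i k * b s t"
      using comm[of t s k i] ord st s sk 3 by simp
    have "a s t * b i j = a i j * b s t"
      using comm[of t s j i] ord st s 3 by simp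
    then show ?thesis using vanish[OF _ p] by simp
  qed
qed

text \<open>The vector at \<open>(t, j)\<close> vanishes by \<open>vanish_outside\<close>, so the
  relation for \<open>j < t < i\<close> gives parallelism with \<open>(i, j)\<close>. Parallelism
  with \<open>(i, k)\<close> comes from \<alpha>_jk.\<close>

lemma vanish_between:
  assumes t: "j < t" "t < i"
  shows "a i t = 0 \<and> b i t = 0"
proof (rule vanish)
  have "a t j = 0 \<and> b t j = 0"
    using vanish_outside[of j t] ord t by simp
  then show "a i t * b i j = a i j * b i t"
    using triple[of j t i] ord t by simp
  have "a i t * b j k = a j k * b i t"
    using comm[of t i k j] ord t by simp
  then show "a i t * b i k = a i k * b i t" by (simp add: parallel)
qed

text \<open>Carries \<open>opposite\<close> from \<open>k\<close> to every \<open>t < j\<close>: the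
  sum is parallel to \<open>(i, j)\<close> by \<open>triple\<close>, and each summand to
  \<open>(i, k)\<close> by commutation.\<close>

lemma vanish_sum:
  assumes t: "1 \<le> t" "t < j"
  shows "a i t + a j t = 0 \<and> b i t + b j t = 0"
proof (cases "t = k")
  case True
  then show ?thesis using opposite by simp
next
  case False
  show ?thesis
  proof (rule vanish)
    show "(a i t + a j t) * b i j = a i j * (b i t + b j t)"
      using triple[of t j i] ord t by simp
    have "a i t * b j k = a j k * b i t"
      using comm[of t i k j] ord t by simp
    then have "a i t * b i k = a i k * b i t" by (simp add: parallel)
    moreover have "a j t * b i k = a i k * b j t"
      using comm[of t j k i] ord t by simp
    ultimately show "(a i t + a j t) * b i k = a i k * (b i t + b j t)"
      by (simp add: algebra_simps)
  qed
qed

end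

end

section \<open>The resonance variety and its decomposition\<close>

context
  fixes n :: nat
begin

interpretation G: group "upper_mccool n" by (rule group_upper_mccool)
interpretation H1: cvs "H1_mccool n" by (rule G.cvs_H1)
interpretation H2: cvs "H2_mccool n" by (rule G.cvs_H2)

lemma resonant_pair_of_cup:
  assumes a: "a \<in> carrier (H1_mccool n)" and b: "b \<in> carrier (H1_mccool n)"
    and cup: "cup_mccool n a b = \<zero>\<^bsub>H2_mccool n\<^esub>"
  shows "resonant_pair n (\<lambda>i j. mccool_coord n i j a) (\<lambda>i j. mccool_coord n i j b)"
proof
  fix i j k l assume "1 \<le> j" "j < i" "i \<le> n" "1 \<le> l" "l < k" "k \<le> n" "i \<noteq> k" "i \<noteq> l" "j \<noteq> k"
  then show "mccool_coord n i j a * mccool_coord n k l b = mccool_coord n k l a * mccool_coord n i j b"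
    unfolding mccool_coord_def
    by (intro G.cup_eq_zero_commuting[OF a b cup] mccool_gen_closed mccool_gen_commute)
next
  fix i j k assume ord: "1 \<le> k" "k < j" "j < i" "i \<le> n"
  have gens: "mccool_gen n i j \<in> carrier (upper_mccool n)" "mccool_gen n i k \<in> carrier (upper_mccool n)"
    "mccool_gen n j k \<in> carrier (upper_mccool n)"
    using ord by (simp_all add: mccool_gen_closed)
  have add: "eval1 x (mccool_gen n i k \<otimes>\<^bsub>upper_mccool n\<^esub> mccool_gen n j k) =
      eval1 x (mccool_gen n i k) + eval1 x (mccool_gen n j k)" if "x \<in> carrier (H1_mccool n)" for x
    using that gens by (auto simp: G.carrier_H1 additive_on_def)
  have "eval1 a (mccool_gen n i j) * eval1 b (mccool_gen n i k \<otimes>\<^bsub>upper_mccool n\<^esub> mccool_gen n j k) =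
      eval1 a (mccool_gen n i k \<otimes>\<^bsub>upper_mccool n\<^esub> mccool_gen n j k) * eval1 b (mccool_gen n i j)"
    using gens mccool_gen_commute_mult[OF ord]
    by (intro G.cup_eq_zero_commuting[OF a b cup]) simp_all
  then show "mccool_coord n i j a * (mccool_coord n i k b + mccool_coord n j k b) =
      (mccool_coord n i k a + mccool_coord n j k a) * mccool_coord n i j b"
    by (simp add: mccool_coord_def add a b)
qed

lemma resonance_subset:
  assumes n: "3 \<le> n" and a: "a \<in> resonance1 (upper_mccool n)"
  shows "\<exists>i j. 2 \<le> j \<and> j < i \<and> i \<le> n \<and> a \<in> L_space n i j"
proof -
  obtain b where a: "a \<in> carrier (H1_mccool n)" and b: "b \<in> carrier (H1_mccool n)"
    and indep: "\<And>c. b \<noteq> c \<odot>\<^bsub>H1_mccool n\<^esub> a" and cup: "cup_mccool n a b = \<zero>\<^bsub>H2_mccool n\<^esub>"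
    using a by (auto simp: resonance1_def)
  interpret resonant_pair n "\<lambda>i j. mccool_coord n i j a" "\<lambda>i j. mccool_coord n i j b"
    by (rule resonant_pair_of_cup[OF a b cup])
  show ?thesis
  proof (cases "a = \<zero>\<^bsub>H1_mccool n\<^esub>")
    case True
    \<comment> \<open>The zero class lies in every component, and this one exists since
      \<open>n >= 3\<close>.\<close>
    have "a \<in> L_space n 3 2"
      unfolding True using n by (intro submodule.zero_closed[OF submod_L_space]) auto
    then show ?thesis using n by (intro exI[of _ 3] exI[of _ 2]) simp
  next
    case False
    then obtain s t where st: "valid s t" "mccool_coord n s t a \<noteq> 0"
      using mccool_coord_separate[OF a H1.M.zero_closed] by (force simp: valid_def mccool_coord_zero)
    \<comment> \<open>The only scalar for which \<open>b = c a\<close> could hold at the coordinate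
      \<open>(s, t)\<close>. Since \<open>b\<close> differs from \<open>c a\<close>, some coordinate
      \<open>(p, q)\<close> disagrees, which gives a nonzero minor.\<close>
    define c where "c = mccool_coord n s t b / mccool_coord n s t a"
    obtain p q where pq: "valid p q" "mccool_coord n p q b \<noteq> mccool_coord n p q (c \<odot>\<^bsub>H1_mccool n\<^esub> a)"
      using mccool_coord_separate[OF b H1.smult_in[OF a, of c]] indep[of c] by (auto simp: valid_def)
    have ca: "mccool_coord n p q (c \<odot>\<^bsub>H1_mccool n\<^esub> a) = c * mccool_coord n p q a"
      using mccool_coord_linear[of q p n] pq(1) a by (auto simp: valid_def linear_forms_iff)
    have "mccool_coord n s t a * mccool_coord n p q b \<noteq> mccool_coord n p q a * mccool_coord n s t b"
      using pq(2)[unfolded ca] st(2) by (auto simp: c_def field_simps)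
    then obtain i j k where ord: "1 \<le> k" "k < j" "j < i" "i \<le> n"
      and ne: "mccool_coord n i j a * mccool_coord n i k b \<noteq> mccool_coord n i k a * mccool_coord n i j b"
      by (rule exists_triple[OF st(1) pq(1)])
    have "a \<in> L_space n i j"
      unfolding L_space_def
    proof (intro CollectI conjI ballI allI impI)
      show "mccool_coord n i l a + mccool_coord n j l a = 0" if "l \<in> {1..j - 1}" for l
        using vanish_sum[OF ord ne, of l] that by auto
      show "mccool_coord n i l a = 0" if "l \<in> {j + 1..i - 1}" for l
        using vanish_between[OF ord ne, of l] that by auto
      show "mccool_coord n s t a = 0" if "s \<in> {1..n}" "s \<noteq> i \<and> s \<noteq> j \<and> 1 \<le> t \<and> t < s" for s t
        using vanish_outside[OF ord ne, of t s] that by auto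
    qed (rule a)
    then show ?thesis using ord by (intro exI[of _ i] exI[of _ j]) simp
  qed
qed

text \<open>The partner is \<open>u_ij\<close> unless it is a multiple of \<open>a\<close>. In that
  case \<open>a\<close> is a nonzero multiple of \<open>u_ij\<close>, and \<open>u_i1 - u_j1\<close>
  serves instead; the index \<open>1\<close> lies below \<open>j\<close> because
  \<open>j >= 2\<close>.\<close>

lemma L_space_subset_resonance:
  assumes ij: "2 \<le> j" "j < i" "i \<le> n"
  shows "L_space n i j \<subseteq> resonance1 (upper_mccool n)"
proof
  fix a assume a: "a \<in> L_space n i j"
  then have aC: "a \<in> carrier (H1_mccool n)" by (simp add: L_space_def)
  let ?u = "char_class n i j" and ?x = "diff_class n i j 1"
  have u: "?u \<in> carrier (H1_mccool n)" and x: "?x \<in> carrier (H1_mccool n)"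
    using ij by (simp_all add: char_class_closed diff_class_closed)
  have "\<exists>b\<in>carrier (H1_mccool n). (\<forall>c. b \<noteq> c \<odot>\<^bsub>H1_mccool n\<^esub> a) \<and> cup_mccool n a b = \<zero>\<^bsub>H2_mccool n\<^esub>"
  proof (cases "\<exists>c. ?u = c \<odot>\<^bsub>H1_mccool n\<^esub> a")
    case False
    then show ?thesis using u cup_L_char[OF ij a] by blast
  next
    case True
    then obtain c where c: "?u = c \<odot>\<^bsub>H1_mccool n\<^esub> a" by blast
    have coord: "mccool_coord n s t (d \<odot>\<^bsub>H1_mccool n\<^esub> a) = d * mccool_coord n s t a"
      if "1 \<le> t" "t < s" "s \<le> n" for s t d
      using mccool_coord_linear[of t s n] that aC by (auto simp: linear_forms_iff)
    have "mccool_coord n i j ?u = 1" "mccool_coord n i 1 ?u = 0"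
      using ij by (simp_all add: mccool_coord_char)
    then have "c * mccool_coord n i j a = 1" "c * mccool_coord n i 1 a = 0"
      using ij unfolding c by (simp_all add: coord)
    then have c0: "c \<noteq> 0" and a1: "mccool_coord n i 1 a = 0" by auto
    have "cup_mccool n a ?x = (inverse c * c) \<odot>\<^bsub>H2_mccool n\<^esub> cup_mccool n a ?x"
      using c0 H2.complex_smult_simps(3)[OF G.cup_closed[OF aC x]] by simp
    also have "\<dots> = inverse c \<odot>\<^bsub>H2_mccool n\<^esub> cup_mccool n ?u ?x"
      unfolding c G.cup_bilinear(3)[OF aC x x] by (rule H2.complex_smult_simps(2)[OF G.cup_closed[OF aC x]])
    also have "\<dots> = \<zero>\<^bsub>H2_mccool n\<^esub>"
      using ij by (simp add: cup_char_diff H2.smult_r_null)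
    finally have "cup_mccool n a ?x = \<zero>\<^bsub>H2_mccool n\<^esub>" .
    moreover have "?x \<noteq> d \<odot>\<^bsub>H1_mccool n\<^esub> a" for d
    proof
      assume "?x = d \<odot>\<^bsub>H1_mccool n\<^esub> a"
      then have "mccool_coord n i 1 ?x = d * mccool_coord n i 1 a"
        using ij by (simp add: coord)
      then show False using ij a1 by (simp add: mccool_coord_diff)
    qed
    ultimately show ?thesis using x by blast
  qed
  then show "a \<in> resonance1 (upper_mccool n)"
    using aC by (auto simp: resonance1_def)
qed

text \<open>A nonzero coordinate must lie in a row \<open>p\<close> common to \<open>{i, j}\<close>
  and \<open>{s, t}\<close>. When exactly one row is shared, the equations of each component kill
  the other row of the other one, and the sum and middle equations then kill the shared row.\<close>

lemma L_space_disjoint: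
  assumes ij: "2 \<le> j" "j < i" "i \<le> n" and st: "2 \<le> t" "t < s" "s \<le> n" and ne: "(i, j) \<noteq> (s, t)"
  shows "L_space n i j \<inter> L_space n s t = {\<zero>\<^bsub>H1_mccool n\<^esub>}"
proof (intro equalityI subsetI)
  fix a assume "a \<in> L_space n i j \<inter> L_space n s t"
  then have a: "a \<in> carrier (H1_mccool n)"
    and out: "\<And>p q. p \<noteq> i \<Longrightarrow> p \<noteq> j \<Longrightarrow> 1 \<le> q \<Longrightarrow> q < p \<Longrightarrow> p \<le> n \<Longrightarrow> mccool_coord n p q a = 0"
      "\<And>p q. p \<noteq> s \<Longrightarrow> p \<noteq> t \<Longrightarrow> 1 \<le> q \<Longrightarrow> q < p \<Longrightarrow> p \<le> n \<Longrightarrow> mccool_coord n p q a = 0"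
    and sum: "\<And>l. 1 \<le> l \<Longrightarrow> l < j \<Longrightarrow> mccool_coord n i l a + mccool_coord n j l a = 0"
      "\<And>l. 1 \<le> l \<Longrightarrow> l < t \<Longrightarrow> mccool_coord n s l a + mccool_coord n t l a = 0"
    and mid: "\<And>l. j < l \<Longrightarrow> l < i \<Longrightarrow> mccool_coord n i l a = 0"
      "\<And>l. t < l \<Longrightarrow> l < s \<Longrightarrow> mccool_coord n s l a = 0"
    by (auto simp: L_space_def)
  have "mccool_coord n p q a = 0" if pq: "1 \<le> q" "q < p" "p \<le> n" for p q
  proof (cases "p \<in> {i, j} \<and> p \<in> {s, t}")
    case False
    then show ?thesis using out pq by auto
  next
    case True
    then consider "p = i" "p = s" | "p = i" "p = t" | "p = j" "p = s" | "p = j" "p = t" by auto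
    then show ?thesis
    proof cases
      case 1
      then have "j \<noteq> t" using ne by auto
      have j0: "mccool_coord n j l a = 0" if "1 \<le> l" "l < j" for l
        using out(2)[of j l] that 1 \<open>j \<noteq> t\<close> ij by auto
      have t0: "mccool_coord n t l a = 0" if "1 \<le> l" "l < t" for l
        using out(1)[of t l] that 1 \<open>j \<noteq> t\<close> st by auto
      \<comment> \<open>Since \<open>j\<close> and \<open>t\<close> differ, the cases are
        exhaustive: even the free column \<open>q = j\<close> of one component is constrained by the
        other.\<close>
      consider "q < j" | "q < t" | "j < q" | "t < q" using \<open>j \<noteq> t\<close> by linarith
      then show ?thesis
        using sum(1)[of q] sum(2)[of q] j0[of q] t0[of q] mid(1)[of q] mid(2)[of q] 1 pq
        by cases auto
    next
      case 2
      have ne': "j \<noteq> s" "j \<noteq> t" "s \<noteq> i" using 2 ij st by auto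
      have "mccool_coord n s q a = 0"
        using out(1)[of s q] ne' st pq 2 by auto
      then show ?thesis using sum(2)[of q] 2 pq by auto
    next
      case 3
      have ne': "i \<noteq> s" "i \<noteq> t" using 3 ij st by auto
      have "mccool_coord n i q a = 0"
        using out(2)[of i q] ne' ij pq 3 by auto
      then show ?thesis using sum(1)[of q] 3 pq by auto
    next
      case 4
      have ne': "i \<noteq> s" "i \<noteq> t" using 4 ij st ne by auto
      have "mccool_coord n i q a = 0"
        using out(2)[of i q] ne' ij pq 4 by auto
      then show ?thesis using sum(1)[of q] 4 pq by auto
    qed
  qed
  then have "a = \<zero>\<^bsub>H1_mccool n\<^esub>"
    by (intro mccool_coord_separate[OF a H1.M.zero_closed]) (simp add: mccool_coord_zero)
  then show "a \<in> {\<zero>\<^bsub>H1_mccool n\<^esub>}" by simp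
qed (use submodule.zero_closed[OF submod_L_space[OF ij]] submodule.zero_closed[OF submod_L_space[OF st]] in auto)

lemma L_space_nonzero:
  assumes ij: "2 \<le> j" "j < i" "i \<le> n"
  shows "char_class n i j \<in> L_space n i j" "char_class n i j \<noteq> \<zero>\<^bsub>H1_mccool n\<^esub>"
proof -
  show "char_class n i j \<in> L_space n i j"
    using component_basis_in_L[OF ij, of j] ij by (simp add: component_basis_def[OF ij])
  show "char_class n i j \<noteq> \<zero>\<^bsub>H1_mccool n\<^esub>"
    using mccool_coord_char[of j i n j i] mccool_coord_zero[of j i n] ij by auto
qed

text \<open>Distinct components meet only in zero and each contains a nonzero \<open>u_ij\<close>,
  so none contains another.\<close>

lemma components_L_space:
  "irreducible_components (H1_mccool n) (\<Union> {L_space n i j | i j. 2 \<le> j \<and> j < i \<and> i \<le> n}) =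
    {L_space n i j | i j. 2 \<le> j \<and> j < i \<and> i \<le> n}"
proof (rule irreducible_components_Union)
  have "{L_space n i j | i j. 2 \<le> j \<and> j < i \<and> i \<le> n} \<subseteq> (\<lambda>(i, j). L_space n i j) ` ({..n} \<times> {..n})"
    by auto
  then show "finite {L_space n i j | i j. 2 \<le> j \<and> j < i \<and> i \<le> n}"
    by (rule finite_subset) simp
next
  fix Y Z assume "Y \<in> {L_space n i j | i j. 2 \<le> j \<and> j < i \<and> i \<le> n}"
    "Z \<in> {L_space n i j | i j. 2 \<le> j \<and> j < i \<and> i \<le> n}" and sub: "Y \<subseteq> Z"
  then obtain i j s t where ij: "2 \<le> j" "j < i" "i \<le> n" and st: "2 \<le> t" "t < s" "s \<le> n"
    and YZ: "Y = L_space n i j" "Z = L_space n s t" by blast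
  show "Y = Z"
  proof (rule ccontr)
    assume "Y \<noteq> Z"
    then have "(i, j) \<noteq> (s, t)" using YZ by auto
    then have "Y \<inter> Z = {\<zero>\<^bsub>H1_mccool n\<^esub>}" unfolding YZ by (rule L_space_disjoint[OF ij st])
    then show False using L_space_nonzero[OF ij] sub YZ(1) by blast
  qed
qed (auto intro: zariski_closed_L_space H1.zariski_irreducible_submod submod_L_space)

end

theorem theorem1p3:
  fixes n :: nat
  assumes "n \<ge> 3"
  shows
    "has_dimension (H1_mccool n) (n choose 2) \<and>
     resonance1 (upper_mccool n) = \<Union> {L_space n i j | i j. 2 \<le> j \<and> j < i \<and> i \<le> n} \<and>
     irreducible_components (H1_mccool n) (resonance1 (upper_mccool n)) =
       {L_space n i j | i j. 2 \<le> j \<and> j < i \<and> i \<le> n} \<and>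
     (\<forall>i j. 2 \<le> j \<and> j < i \<and> i \<le> n \<longrightarrow>
        VectorSpace.subspace class_ring (L_space n i j) (H1_mccool n) \<and>
        has_dimension ((H1_mccool n)\<lparr>carrier := L_space n i j\<rparr>) j) \<and>
     (\<forall>i j s t. 2 \<le> j \<and> j < i \<and> i \<le> n \<and> 2 \<le> t \<and> t < s \<and> s \<le> n \<and> (i, j) \<noteq> (s, t) \<longrightarrow>
        L_space n i j \<inter> L_space n s t = {\<zero>\<^bsub>H1_mccool n\<^esub>}) \<and>
     (\<forall>i j. 2 \<le> j \<and> j < i \<and> i \<le> n \<longrightarrow>
        (j = 2 \<longrightarrow> isotropic (upper_mccool n) 0 (L_space n i j)) \<and>
        (j \<ge> 3 \<longrightarrow> isotropic (upper_mccool n) ((j - 1) choose 2) (L_space n i j)))"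
proof -
  interpret H1: cvs "H1_mccool n" by (rule group.cvs_H1[OF group_upper_mccool])
  have R: "resonance1 (upper_mccool n) = \<Union> {L_space n i j | i j. 2 \<le> j \<and> j < i \<and> i \<le> n}"
  proof (intro equalityI subsetI)
    fix a assume "a \<in> resonance1 (upper_mccool n)"
    then obtain i j where "2 \<le> j" "j < i" "i \<le> n" and a: "a \<in> L_space n i j"
      using resonance_subset[OF assms] by blast
    then have "L_space n i j \<in> {L_space n i j | i j. 2 \<le> j \<and> j < i \<and> i \<le> n}" by blast
    then show "a \<in> \<Union> {L_space n i j | i j. 2 \<le> j \<and> j < i \<and> i \<le> n}" using a by (rule UnionI)
  next
    fix a assume "a \<in> \<Union> {L_space n i j | i j. 2 \<le> j \<and> j < i \<and> i \<le> n}"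
    then obtain i j where "2 \<le> j" "j < i" "i \<le> n" and a: "a \<in> L_space n i j" by auto
    then have "L_space n i j \<subseteq> resonance1 (upper_mccool n)" by (intro L_space_subset_resonance)
    then show "a \<in> resonance1 (upper_mccool n)" using a by (rule subsetD)
  qed
  have comps: "irreducible_components (H1_mccool n) (resonance1 (upper_mccool n)) =
      {L_space n i j | i j. 2 \<le> j \<and> j < i \<and> i \<le> n}"
    unfolding R by (rule components_L_space)
  have iso: "isotropic (upper_mccool n) ((j - 1) choose 2) (L_space n i j)"
    if "2 \<le> j \<and> j < i \<and> i \<le> n" for i j
    using that by (intro isotropic_L_space) auto
  \<comment> \<open>For \<open>j = 2\<close> the rank is \<open>1 choose 2\<close>, which is
    zero.\<close>
  have iso2: "isotropic (upper_mccool n) 0 (L_space n i j)"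
    if "2 \<le> j \<and> j < i \<and> i \<le> n" "j = 2" for i j
    using iso[OF that(1)] that(2) by (simp add: binomial_eq_0)
  have subspace: "VectorSpace.subspace class_ring (L_space n i j) (H1_mccool n)"
    "has_dimension ((H1_mccool n)\<lparr>carrier := L_space n i j\<rparr>) j" if "2 \<le> j \<and> j < i \<and> i \<le> n" for i j
    using that by (auto intro!: H1.submod_subspace submod_L_space has_dimension_L_space)
  have disj: "L_space n i j \<inter> L_space n s t = {\<zero>\<^bsub>H1_mccool n\<^esub>}"
    if "2 \<le> j \<and> j < i \<and> i \<le> n \<and> 2 \<le> t \<and> t < s \<and> s \<le> n \<and> (i, j) \<noteq> (s, t)" for i j s t
    using that by (intro L_space_disjoint) auto
  show ?thesis
    by (intro conjI allI impI has_dimension_H1 R comps) (assumption | erule subspace disj iso iso2)+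
qed

end
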